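(* Consider the family of load balancing systems parametrized by $\epsilon\in(0,\mu_\Sigma)$ described in the context, operating under the Join the Shortest Queue (JSQ) routing policy, and assume $\lim_{\epsilon\downarrow0}\sigma_a^{(\epsilon)}=\sigma_a$. Let $\overline{\boldsymbol q}^{(\epsilon)}$ be the steady-state random vector to which $\{\boldsymbol q^{(\epsilon)}(k):k\ge1\}$ converges in distribution. Then, as $\epsilon\downarrow0$, $\epsilon\overline{\boldsymbol q}^{(\epsilon)}$ converges in distribution to $\widetilde\Upsilon_1\boldsymbol 1$, where $\widetilde\Upsilon_1$ is an exponential random variable with mean $$\frac{1}{2n}\Big(\sigma_a^2+\sum_{i=1}^n\sum_{j=1}^n\mathrm{Cov}[s_i,s_j]\Big).$$
   Context: Load balancing system: a discrete-time system with $n$ queues, each with its own server and infinite buffer. $q_i^{(\epsilon)}(k)$ is the number of jobs in queue $i$ at the beginning of slot $k\ge 1$. The potential service vectors $\boldsymbol s(k)=(s_1(k),\dots,s_n(k))$, $k\ge1$, are i.i.d. over $k$ with nonnegative integer components that may be correlated with each other; they do not depend on $\epsilon$, and are independent of the queue lengths $\boldsymbol q^{(\epsilon)}(k)$. $\mu_i=E[s_i(1)]$, $\mu_\Sigma=\sum_{i=1}^n\mu_i$, and $\mathrm{Cov}[s_i,s_j]$ is the covariance of $s_i(1)$ and $s_j(1)$. There is a single arrival stream: $\{a^{(\epsilon)}(k):k\ge1\}$ is an i.i.d. sequence of nonnegative integer-valued random variables, independent of the queue lengths and of the service process, with $E[a^{(\epsilon)}(1)]=\mu_\Sigma-\epsilon$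 and $\mathrm{Var}[a^{(\epsilon)}(1)]=(\sigma_a^{(\epsilon)})^2$. There are finite constants $A_{\max},S_{\max}$ (not depending on $\epsilon$) with $a^{(\epsilon)}(k)\le A_{\max}$ and $s_i(k)\le S_{\max}$ with probability 1. In slot $k$ all arrivals are routed to one queue $i^*(k)$: $a_i^{(\epsilon)}(k)=a^{(\epsilon)}(k)$ if $i=i^*(k)$ and $0$ otherwise. Under JSQ, $i^*(k)\in\arg\min_{i\in\{1,\dots,n\}}q_i^{(\epsilon)}(k)$, breaking ties at random. The dynamics are $q_i^{(\epsilon)}(k+1)=\max\{q_i^{(\epsilon)}(k)+a_i^{(\epsilon)}(k)-s_i(k),0\}$. $\boldsymbol 1$ is the all-ones vector. *)

theory Defs
  imports "HOL-Probability.Probability"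
begin

(* The library's weak_conv_m only covers sequences of laws on the real line. The spaces N i and N'
   may differ, as is usual for convergence in distribution, and F is an arbitrary filter so that
   both k -> infinity and epsilon -> 0+ are instances. *)
definition converges_in_distribution ::
  "'i filter \<Rightarrow> ('i \<Rightarrow> 'a measure) \<Rightarrow> ('i \<Rightarrow> 'a \<Rightarrow> 'c::topological_space) \<Rightarrow>
   'b measure \<Rightarrow> ('b \<Rightarrow> 'c) \<Rightarrow> bool"
  where "converges_in_distribution F N X N' Y \<longleftrightarrow>
    (\<forall>f :: 'c \<Rightarrow> real. continuous_on UNIV f \<and> bounded (range f) \<longrightarrow>
      ((\<lambda>i. \<integral>\<omega>. f (X i \<omega>) \<partial>N i) \<longlongrightarrow> (\<integral>\<omega>. f (Y \<omega>) \<partial>N')) F)"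

definition covariance :: "'a measure \<Rightarrow> ('a \<Rightarrow> real) \<Rightarrow> ('a \<Rightarrow> real) \<Rightarrow> real"
  where "covariance M X Y =
    (\<integral>\<omega>. (X \<omega> - (\<integral>\<omega>'. X \<omega>' \<partial>M)) * (Y \<omega> - (\<integral>\<omega>'. Y \<omega>' \<partial>M)) \<partial>M)"

(* Same notion as indep_var, which requires X and Y to take values in the same type. *)
definition (in prob_space) indep_rvs ::
  "'b measure \<Rightarrow> ('a \<Rightarrow> 'b) \<Rightarrow> 'c measure \<Rightarrow> ('a \<Rightarrow> 'c) \<Rightarrow> bool"
  where "indep_rvs A X B Y \<longleftrightarrow>
    random_variable A X \<and> random_variable B Y \<and>
    indep_set {X -` E \<inter> space M | E. E \<in> sets A} {Y -` E \<inter> space M | E. E \<in> sets B}"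

(* Discrete-valued random variables indexed by the slots 1, 2, ... *)
definition (in prob_space) iid_slots :: "(nat \<Rightarrow> 'a \<Rightarrow> 'b) \<Rightarrow> bool"
  where "iid_slots X \<longleftrightarrow>
    indep_vars (\<lambda>_. count_space UNIV) X {1..} \<and>
    (\<forall>k\<ge>1. distr M (count_space UNIV) (X k) = distr M (count_space UNIV) (X 1))"

definition total_service_rate :: "'a measure \<Rightarrow> (nat \<Rightarrow> 'a \<Rightarrow> 'n::finite \<Rightarrow> nat) \<Rightarrow> real"
  where "total_service_rate M s = (\<Sum>i\<in>UNIV. \<integral>\<omega>. real (s 1 \<omega> i) \<partial>M)"

definition shortest_queues :: "('n \<Rightarrow> nat) \<Rightarrow> 'n set"
  where "shortest_queues x = {i. \<forall>j. x i \<le> x j}"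

definition real_vec :: "('n::finite \<Rightarrow> nat) \<Rightarrow> real ^ 'n"
  where "real_vec x = (\<chi> i. real (x i))"

(* One system, with a fixed epsilon. The queues are indexed by the finite type 'n, so n = CARD('n),
   and slots are numbered from 1: the values of the processes at index 0 play no role.
   s k, a k, q k and route k are the potential services, the arrivals, the queue lengths and the
   queue receiving the arrivals in slot k. *)
locale jsq_system = prob_space M
  for M :: "'a measure"
    and s :: "nat \<Rightarrow> 'a \<Rightarrow> 'n::finite \<Rightarrow> nat"
    and a :: "nat \<Rightarrow> 'a \<Rightarrow> nat"
    and q :: "nat \<Rightarrow> 'a \<Rightarrow> 'n \<Rightarrow> nat"
    and route :: "nat \<Rightarrow> 'a \<Rightarrow> 'n"
    and \<epsilon> A_max S_max :: real +
  assumes q_rv: "\<And>k. k \<ge> 1 \<Longrightarrow> random_variable (count_space UNIV) (q k)"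
    and route_rv: "\<And>k. k \<ge> 1 \<Longrightarrow> random_variable (count_space UNIV) (route k)"
    and s_iid: "iid_slots s"
    and a_iid: "iid_slots a"
    and a_indep_s: "indep_rvs
      (\<Pi>\<^sub>M k\<in>{1..}. count_space UNIV) (\<lambda>\<omega>. \<lambda>k\<in>{1..}. a k \<omega>)
      (\<Pi>\<^sub>M k\<in>{1..}. count_space UNIV) (\<lambda>\<omega>. \<lambda>k\<in>{1..}. s k \<omega>)"
    (* q (k+1) is a function of a k and s k, so "independent of the queue lengths" refers to those
       up to slot k; the routing decisions made so far are part of that past. *)
    and indep_past: "\<And>k. k \<ge> 1 \<Longrightarrow> indep_rvs
      (count_space UNIV) (\<lambda>\<omega>. (a k \<omega>, s k \<omega>))
      (\<Pi>\<^sub>M j\<in>{1..k}. count_space UNIV) (\<lambda>\<omega>. \<lambda>j\<in>{1..k}. (q j \<omega>, route j \<omega>))"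
    and a_bounded: "\<And>k. k \<ge> 1 \<Longrightarrow> AE \<omega> in M. real (a k \<omega>) \<le> A_max"
    and s_bounded: "\<And>k i. k \<ge> 1 \<Longrightarrow> AE \<omega> in M. real (s k \<omega> i) \<le> S_max"
    and a_mean: "(\<integral>\<omega>. real (a 1 \<omega>) \<partial>M) = total_service_rate M s - \<epsilon>"
    and jsq: "\<And>k \<omega>. k \<ge> 1 \<Longrightarrow> \<omega> \<in> space M \<Longrightarrow> route k \<omega> \<in> shortest_queues (q k \<omega>)"
    (* Given the queue lengths x 1, ..., x k so far, ties are broken uniformly at random. *)
    and random_ties: "\<And>k i x. k \<ge> 1 \<Longrightarrow>
      prob {\<omega> \<in> space M. (\<forall>j\<in>{1..k}. q j \<omega> = x j) \<and> route k \<omega> = i} =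
      prob {\<omega> \<in> space M. \<forall>j\<in>{1..k}. q j \<omega> = x j} * pmf (pmf_of_set (shortest_queues (x k))) i"
    and dynamics: "\<And>k i \<omega>. k \<ge> 1 \<Longrightarrow> \<omega> \<in> space M \<Longrightarrow>
      int (q (k + 1) \<omega> i) =
        max (int (q k \<omega> i) + (if i = route k \<omega> then int (a k \<omega>) else 0) - int (s k \<omega> i)) 0"

end

theory Submission
  imports Defs
begin

text \<open>The proof compares Laplace transforms. Write \<open>x\<close> for the stationary queue vector, \<open>t\<close> for the total
  number of jobs, \<open>d\<close> for the arrivals minus the total potential service in a slot and \<open>u\<close> for the
  service that is wasted on empty queues, so that \<open>t + d + u\<close> is the total in the next slot. With
  \<open>h = \<theta> * \<epsilon>\<close>, stationarity of \<open>exp (- h * t)\<close> and the independence of \<open>d\<close> and \<open>x\<close> give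
  \<open>E (exp (- h * t)) * (E (exp (- h * d)) - 1) = E (exp (- h * t') * (exp (h * u) - 1))\<close>, where \<open>t'\<close> is the
  total after the slot (\<open>laplace_transform_balance\<close>). The mean of \<open>d\<close> is \<open>- \<epsilon>\<close>, hence that of \<open>u\<close> is
  \<open>\<epsilon>\<close>. If \<open>t'\<close> were \<open>0\<close> whenever \<open>u > 0\<close>, the right-hand side would be \<open>h * \<epsilon>\<close> up to higher order, while
  the second bracket on the left is \<open>h * \<epsilon> + h\<^sup>2 * v / 2\<close> up to higher order, with \<open>v\<close> the second moment
  of \<open>d\<close>. Dividing by \<open>\<epsilon>\<^sup>2\<close> shows that the transform of \<open>\<epsilon> * t\<close> at \<open>\<theta>\<close> tends to
  \<open>1 / (1 + \<theta> * v / 2)\<close>, the transform of an exponential law of mean \<open>v / 2\<close>.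

  The correct version of "\<open>t'\<close> is \<open>0\<close> whenever \<open>u > 0\<close>" is state space collapse: wasted service means an empty
  queue, and then \<open>t'\<close> equals the imbalance of the queues, the total excess over the shortest one. Since JSQ
  always feeds the shortest queue, the squared distance of the queue vector from the diagonal has a drift that
  is negative and proportional to the imbalance. Using the square of that quantity as a Lyapunov function
  bounds the second moment of the imbalance uniformly in \<open>\<epsilon>\<close> (\<open>imbalance_second_moment\<close>). This
  makes the error in the balance equation negligible, and it also shows that \<open>\<epsilon> * x\<close> is asymptotically
  \<open>\<epsilon> * t / n\<close> times the all-ones vector (\<open>state_space_collapse\<close>). Laplace transforms determine
  limits in distribution by the Weierstrass approximation theorem (\<open>laplace_convergence_compact_support\<close>).

  Two points precede this argument. First, the limit vector \<open>q_bar\<close> is only known as a limit in distribution;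
  because the queue vectors live on the integer lattice, bounded functions of the state extend to bounded
  continuous functions, so the law of \<open>q_bar\<close> is an invariant law of the JSQ Markov chain
  (\<open>stationary_limit_law\<close>). Second, the drift estimate needs every server to have a positive service rate,
  although only the sum of the rates is assumed to be positive. A queue that is never served can only grow, so under an
  invariant law it never receives arrivals and is never a shortest queue; but as soon as arrivals can
  exceed the total service, the other queues would climb above it (\<open>every_queue_served\<close>). Arrivals can exceed the service
  for small \<open>\<epsilon>\<close> because otherwise the limiting variance, and with it the mean of the exponential law,
  would vanish.\<close>

section \<open>Convergence in distribution through Laplace transforms\<close>

lemma (in prob_space) integrable_bounded_real:
  fixes f :: "'a \<Rightarrow> real"
  assumes "f \<in> borel_measurable M" "\<And>\<omega>. \<omega> \<in> space M \<Longrightarrow> \<bar>f \<omega>\<bar> \<le> B"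
  shows "integrable M f"
  by (rule integrable_const_bound[of _ B]) (use assms in auto)

text \<open>A cutoff function that is close to 1 in expectation under the limit law is also close to 1 in expectation
  under the approximating laws, since it is itself a test function. Hence no mass escapes to infinity and truncated
  test functions suffice.\<close>

lemma converges_in_distribution_compact_support:
  fixes X :: "'i \<Rightarrow> 'a \<Rightarrow> 'c::euclidean_space" and Y :: "'b \<Rightarrow> 'c"
  assumes X: "\<forall>\<^sub>F i in F. prob_space (N i) \<and> X i \<in> borel_measurable (N i)"
    and N': "prob_space N'" and Y [measurable]: "Y \<in> borel_measurable N'"
    and lim: "\<And>(f :: 'c \<Rightarrow> real) r. continuous_on UNIV f \<Longrightarrow> (\<And>x. norm x \<ge> r \<Longrightarrow> f x = 0) \<Longrightarrow>
      ((\<lambda>i. \<integral>\<omega>. f (X i \<omega>) \<partial>N i) \<longlongrightarrow> (\<integral>\<omega>. f (Y \<omega>) \<partial>N')) F"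
  shows "converges_in_distribution F N X N' Y"
  unfolding converges_in_distribution_def
proof (intro allI impI, elim conjE)
  fix f :: "'c \<Rightarrow> real"
  assume f: "continuous_on UNIV f" and "bounded (range f)"
  then obtain B where B: "\<And>x. \<bar>f x\<bar> \<le> B"
    by (auto simp: bounded_iff)
  have fm [measurable]: "f \<in> borel_measurable borel"
    using f by (rule borel_measurable_continuous_onI)
  interpret N': prob_space N' by (rule N')
  \<comment> \<open>A cutoff equal to 1 on the ball of radius \<open>R\<close> and 0 outside that of radius \<open>R + 1\<close>.\<close>
  define c :: "real \<Rightarrow> 'c \<Rightarrow> real" where "c R x = max 0 (min 1 (R + 1 - norm x))" for R x
  have c01: "0 \<le> c R x" "c R x \<le> 1" for R x by (auto simp: c_def)
  have c_cont: "continuous_on UNIV (c R)" for R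
    unfolding c_def by (intro continuous_intros)
  have c_m [measurable]: "c R \<in> borel_measurable borel" for R
    using c_cont by (rule borel_measurable_continuous_onI)
  have c_supp: "c R x = 0" if "norm x \<ge> R + 1" for R x using that by (simp add: c_def)
  have "(\<lambda>k. \<integral>\<omega>. c (real k) (Y \<omega>) \<partial>N') \<longlonglongrightarrow> (\<integral>\<omega>. 1 \<partial>N')"
  proof (rule integral_dominated_convergence[where w="\<lambda>_. 1"])
    show "AE \<omega> in N'. (\<lambda>k. c (real k) (Y \<omega>)) \<longlonglongrightarrow> 1"
    proof (rule AE_I2, rule tendsto_eventually)
      fix \<omega>
      show "\<forall>\<^sub>F k in sequentially. c (real k) (Y \<omega>) = 1"
        using eventually_ge_at_top[of "nat \<lceil>norm (Y \<omega>)\<rceil>"]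
      proof eventually_elim
        case (elim k)
        then have "norm (Y \<omega>) \<le> real k" by linarith
        then show ?case by (simp add: c_def)
      qed
    qed
  qed (use c01 in \<open>auto simp: abs_le_iff intro!: AE_I2\<close>)
  then have c_lim: "(\<lambda>k. \<integral>\<omega>. c (real k) (Y \<omega>) \<partial>N') \<longlonglongrightarrow> 1" by (simp add: N'.prob_space)
  show "((\<lambda>i. \<integral>\<omega>. f (X i \<omega>) \<partial>N i) \<longlongrightarrow> (\<integral>\<omega>. f (Y \<omega>) \<partial>N')) F"
  proof (rule tendstoI)
    fix e :: real assume "e > 0"
    define e' where "e' = e / (3 * \<bar>B\<bar> + 2)"
    have e': "e' > 0" "(3 * \<bar>B\<bar> + 2) * e' = e" using \<open>e > 0\<close> by (auto simp: e'_def add_pos_nonneg field_simps)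
    obtain k where k: "\<bar>(\<integral>\<omega>. c (real k) (Y \<omega>) \<partial>N') - 1\<bar> < e'"
      using c_lim e'(1) unfolding LIMSEQ_def dist_real_def by blast
    let ?c = "c (real k)"
    have "((\<lambda>i. \<integral>\<omega>. f (X i \<omega>) * ?c (X i \<omega>) \<partial>N i) \<longlongrightarrow> (\<integral>\<omega>. f (Y \<omega>) * ?c (Y \<omega>) \<partial>N')) F"
      by (rule lim[where f="\<lambda>x. f x * ?c x" and r="real k + 1"]) (auto intro!: continuous_on_mult f c_cont simp: c_supp)
    then have 1: "\<forall>\<^sub>F i in F. \<bar>(\<integral>\<omega>. f (X i \<omega>) * ?c (X i \<omega>) \<partial>N i) - (\<integral>\<omega>. f (Y \<omega>) * ?c (Y \<omega>) \<partial>N')\<bar> < e'"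
      using e'(1) by (auto dest!: tendstoD simp: dist_real_def)
    have "((\<lambda>i. \<integral>\<omega>. ?c (X i \<omega>) \<partial>N i) \<longlongrightarrow> (\<integral>\<omega>. ?c (Y \<omega>) \<partial>N')) F"
      by (rule lim[where f="?c" and r="real k + 1"]) (auto intro!: c_cont simp: c_supp)
    then have 2: "\<forall>\<^sub>F i in F. \<bar>(\<integral>\<omega>. ?c (X i \<omega>) \<partial>N i) - (\<integral>\<omega>. ?c (Y \<omega>) \<partial>N')\<bar> < e'"
      using e'(1) by (auto dest!: tendstoD simp: dist_real_def)
    have cut: "\<bar>(\<integral>\<omega>. f (Z \<omega>) \<partial>P) - (\<integral>\<omega>. f (Z \<omega>) * ?c (Z \<omega>) \<partial>P)\<bar> \<le> \<bar>B\<bar> * (1 - (\<integral>\<omega>. ?c (Z \<omega>) \<partial>P))"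
      if P: "prob_space P" and Z [measurable]: "Z \<in> borel_measurable P" for P and Z :: "'x \<Rightarrow> 'c"
    proof -
      interpret P: prob_space P by (rule P)
      have i1: "integrable P (\<lambda>\<omega>. f (Z \<omega>))"
        by (rule P.integrable_bounded_real[of _ B]) (use B in auto)
      have i3: "integrable P (\<lambda>\<omega>. ?c (Z \<omega>))"
        by (rule P.integrable_bounded_real[of _ 1]) (use c01 in auto)
      have i2: "integrable P (\<lambda>\<omega>. f (Z \<omega>) * ?c (Z \<omega>))"
        by (rule P.integrable_bounded_real[of _ "\<bar>B\<bar> * 1"])
          (auto simp: abs_mult c01 intro!: mult_mono order_trans[OF B] simp del: mult_1_right)
      have i4: "integrable P (\<lambda>\<omega>. f (Z \<omega>) * (1 - ?c (Z \<omega>)))"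
        using i1 i2 by (simp add: right_diff_distrib)
      have "\<bar>(\<integral>\<omega>. f (Z \<omega>) \<partial>P) - (\<integral>\<omega>. f (Z \<omega>) * ?c (Z \<omega>) \<partial>P)\<bar> = \<bar>\<integral>\<omega>. f (Z \<omega>) * (1 - ?c (Z \<omega>)) \<partial>P\<bar>"
        using i1 i2 by (simp add: right_diff_distrib)
      also have "\<dots> \<le> (\<integral>\<omega>. \<bar>f (Z \<omega>) * (1 - ?c (Z \<omega>))\<bar> \<partial>P)" by (rule integral_abs_bound)
      also have "\<dots> \<le> (\<integral>\<omega>. \<bar>B\<bar> * (1 - ?c (Z \<omega>)) \<partial>P)"
        using c01 i3 by (intro integral_mono integrable_abs i4)
          (auto simp: abs_mult intro!: mult_mono order_trans[OF B])
      also have "\<dots> = \<bar>B\<bar> * (1 - (\<integral>\<omega>. ?c (Z \<omega>) \<partial>P))" using i3 by (simp add: P.prob_space)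
      finally show ?thesis .
    qed
    note cY = cut[OF N' Y]
    show "\<forall>\<^sub>F i in F. dist (\<integral>\<omega>. f (X i \<omega>) \<partial>N i) (\<integral>\<omega>. f (Y \<omega>) \<partial>N') < e"
      using 1 2 X
    proof eventually_elim
      case (elim i)
      then have cX: "\<bar>(\<integral>\<omega>. f (X i \<omega>) \<partial>N i) - (\<integral>\<omega>. f (X i \<omega>) * ?c (X i \<omega>) \<partial>N i)\<bar>
        \<le> \<bar>B\<bar> * (1 - (\<integral>\<omega>. ?c (X i \<omega>) \<partial>N i))"
        using cut by blast
      have "\<bar>B\<bar> * (1 - (\<integral>\<omega>. ?c (Y \<omega>) \<partial>N')) \<le> \<bar>B\<bar> * e'"
        using k by (intro mult_left_mono) auto
      moreover have "\<bar>B\<bar> * (1 - (\<integral>\<omega>. ?c (X i \<omega>) \<partial>N i)) \<le> \<bar>B\<bar> * (2 * e')"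
        using k elim by (intro mult_left_mono) auto
      moreover have "3 * (\<bar>B\<bar> * e') + 2 * e' = e" using e'(2) by (simp add: algebra_simps)
      ultimately show ?case using cX cY elim e'(1) unfolding dist_real_def by linarith
    qed
  qed
qed

text \<open>In the variable \<open>z = exp (- x)\<close> a continuous function with compact support on the half-line becomes a
  continuous function on the unit interval that vanishes near 0. By Weierstrass it is uniformly close to a polynomial
  in \<open>z\<close>, and expectations of such polynomials are combinations of Laplace transforms at natural numbers.\<close>

lemma laplace_convergence_compact_support:
  fixes X :: "'i \<Rightarrow> 'a \<Rightarrow> real" and Y :: "'b \<Rightarrow> real" and f :: "real \<Rightarrow> real"
  assumes X: "\<forall>\<^sub>F i in F. prob_space (N i) \<and> X i \<in> borel_measurable (N i) \<and> (AE \<omega> in N i. 0 \<le> X i \<omega>)"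
    and N': "prob_space N'" and Y [measurable]: "Y \<in> borel_measurable N'" and Y0: "AE \<omega> in N'. 0 \<le> Y \<omega>"
    and lim: "\<And>j::nat. ((\<lambda>i. \<integral>\<omega>. exp (- (real j * X i \<omega>)) \<partial>N i) \<longlongrightarrow> (\<integral>\<omega>. exp (- (real j * Y \<omega>)) \<partial>N')) F"
    and f: "continuous_on UNIV f" and supp: "\<And>x. x \<ge> r \<Longrightarrow> f x = 0"
  shows "((\<lambda>i. \<integral>\<omega>. f (X i \<omega>) \<partial>N i) \<longlongrightarrow> (\<integral>\<omega>. f (Y \<omega>) \<partial>N')) F"
proof (rule tendstoI)
  fix e :: real assume "e > 0"
  have [measurable]: "f \<in> borel_measurable borel"
    using f by (rule borel_measurable_continuous_onI)
  define h where "h z = (if z \<le> 0 then 0 else f (- ln z))" for z :: real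
  have h_exp: "h (exp (- y)) = f y" for y by (simp add: h_def)
  have "continuous_on ({..<exp (-r)} \<union> {0<..}) h"
  proof (rule continuous_on_open_Un)
    have "h z = 0" if "z < exp (-r)" for z
    proof (cases "z \<le> 0")
      case False
      then have "ln z < -r" using that ln_less_cancel_iff[of z "exp (-r)"] by simp
      then show ?thesis using False by (simp add: h_def supp)
    qed (simp add: h_def)
    then show "continuous_on {..<exp (-r)} h"
      by (subst continuous_on_cong[OF refl, of _ _ "\<lambda>_. 0"]) (auto)
    show "continuous_on {0<..} h"
    proof (subst continuous_on_cong[OF refl])
      show "continuous_on {0<..} (\<lambda>z. f (- ln z))"
        by (intro continuous_on_compose2[OF f] continuous_intros) auto
    qed (auto simp: h_def)
  qed auto
  then have hc: "continuous_on {0..1} h"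
    by (rule continuous_on_subset) (auto simp: not_less le_less)
  obtain p where p: "real_polynomial_function p" "\<And>z. z \<in> {0..1} \<Longrightarrow> \<bar>h z - p z\<bar> < e / 3"
    using Stone_Weierstrass_real_polynomial_function[OF _ hc, of "e / 3"] \<open>e > 0\<close> by auto
  then obtain a n where p_eq: "p = (\<lambda>z. \<Sum>j\<le>n. a j * z ^ j)"
    by (auto simp: real_polynomial_function_iff_sum)
  have p_exp: "p (exp (- y)) = (\<Sum>j\<le>n. a j * exp (- (real j * y)))" for y
    by (simp add: p_eq exp_of_nat_mult[symmetric])
  have approx: "\<bar>(\<integral>\<omega>. f (Z \<omega>) \<partial>P) - (\<Sum>j\<le>n. a j * (\<integral>\<omega>. exp (- (real j * Z \<omega>)) \<partial>P))\<bar> \<le> e / 3"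
    if P: "prob_space P" and Z [measurable]: "Z \<in> borel_measurable P" and Z0: "AE \<omega> in P. 0 \<le> Z \<omega>"
    for P and Z :: "'x \<Rightarrow> real"
  proof -
    interpret P: prob_space P by (rule P)
    have i1: "integrable P (\<lambda>\<omega>. exp (- (real j * Z \<omega>)))" for j
      by (rule P.integrable_const_bound[of _ 1]) (use Z0 in auto)
    have i2: "integrable P (\<lambda>\<omega>. p (exp (- Z \<omega>)))"
      unfolding p_exp using i1 by auto
    have d: "AE \<omega> in P. \<bar>f (Z \<omega>) - p (exp (- Z \<omega>))\<bar> \<le> e / 3"
      using Z0
    proof eventually_elim
      case (elim \<omega>)
      then show ?case using p(2)[of "exp (- Z \<omega>)"] by (simp add: h_exp)
    qed
    have [measurable]: "(\<lambda>\<omega>. p (exp (- Z \<omega>))) \<in> borel_measurable P"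
      using i2 by auto
    have i3: "integrable P (\<lambda>\<omega>. f (Z \<omega>) - p (exp (- Z \<omega>)))"
      by (rule P.integrable_const_bound[of _ "e/3"]) (use d in auto)
    then have i4: "integrable P (\<lambda>\<omega>. f (Z \<omega>))"
      using Bochner_Integration.integrable_add[OF i3 i2] by simp
    have "\<bar>(\<integral>\<omega>. f (Z \<omega>) \<partial>P) - (\<integral>\<omega>. p (exp (- Z \<omega>)) \<partial>P)\<bar> = \<bar>\<integral>\<omega>. f (Z \<omega>) - p (exp (- Z \<omega>)) \<partial>P\<bar>"
      using i4 i2 by simp
    also have "\<dots> \<le> (\<integral>\<omega>. \<bar>f (Z \<omega>) - p (exp (- Z \<omega>))\<bar> \<partial>P)" by (rule integral_abs_bound)
    also have "\<dots> \<le> (\<integral>\<omega>. e / 3 \<partial>P)" using d i3 by (intro integral_mono_AE) auto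
    finally show ?thesis using i1 by (simp add: P.prob_space p_exp)
  qed
  have "((\<lambda>i. \<Sum>j\<le>n. a j * (\<integral>\<omega>. exp (- (real j * X i \<omega>)) \<partial>N i)) \<longlongrightarrow>
      (\<Sum>j\<le>n. a j * (\<integral>\<omega>. exp (- (real j * Y \<omega>)) \<partial>N'))) F"
    by (intro tendsto_intros lim)
  then have "\<forall>\<^sub>F i in F. dist (\<Sum>j\<le>n. a j * (\<integral>\<omega>. exp (- (real j * X i \<omega>)) \<partial>N i))
      (\<Sum>j\<le>n. a j * (\<integral>\<omega>. exp (- (real j * Y \<omega>)) \<partial>N')) < e / 3"
    using \<open>e > 0\<close> by (intro tendstoD) auto
  then show "\<forall>\<^sub>F i in F. dist (\<integral>\<omega>. f (X i \<omega>) \<partial>N i) (\<integral>\<omega>. f (Y \<omega>) \<partial>N') < e"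
    using X
  proof eventually_elim
    case (elim i)
    then show ?case
      using approx[of "N i" "X i"] approx[OF N' Y Y0] unfolding dist_real_def by linarith
  qed
qed

text \<open>A continuous function with compact support is uniformly continuous, so variables that are close
  in probability have nearly equal expectations.\<close>

lemma compact_support_converging_together:
  fixes X X' :: "'i \<Rightarrow> 'a \<Rightarrow> 'c::euclidean_space" and f :: "'c \<Rightarrow> real"
  assumes X: "\<forall>\<^sub>F i in F. prob_space (N i) \<and> X i \<in> borel_measurable (N i) \<and> X' i \<in> borel_measurable (N i)"
    and close: "\<And>\<delta>. \<delta> > 0 \<Longrightarrow> ((\<lambda>i. measure (N i) {\<omega> \<in> space (N i). \<delta> \<le> dist (X i \<omega>) (X' i \<omega>)}) \<longlongrightarrow> 0) F"
    and f: "continuous_on UNIV f" and supp: "\<And>x. norm x \<ge> r \<Longrightarrow> f x = (0::real)"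
    and lim: "((\<lambda>i. \<integral>\<omega>. f (X' i \<omega>) \<partial>N i) \<longlongrightarrow> L) F"
  shows "((\<lambda>i. \<integral>\<omega>. f (X i \<omega>) \<partial>N i) \<longlongrightarrow> L) F"
proof -
  have [measurable]: "f \<in> borel_measurable borel"
    using f by (rule borel_measurable_continuous_onI)
  have fc: "uniformly_continuous_on (cball 0 (r + 1)) f"
    by (rule compact_uniformly_continuous) (auto intro: continuous_on_subset[OF f])
  have "bounded (f ` cball 0 (r + 1))"
    by (intro compact_imp_bounded compact_continuous_image continuous_on_subset[OF f]) auto
  then obtain B where "\<And>x. x \<in> cball 0 (r + 1) \<Longrightarrow> \<bar>f x\<bar> \<le> B"
    unfolding bounded_iff by (metis imageI real_norm_def)
  then have B: "\<bar>f x\<bar> \<le> \<bar>B\<bar>" for x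
    by (cases "norm x \<le> r + 1") (auto simp: supp intro: order_trans[OF _ abs_ge_self])
  have "((\<lambda>i. (\<integral>\<omega>. f (X i \<omega>) \<partial>N i) - (\<integral>\<omega>. f (X' i \<omega>) \<partial>N i)) \<longlongrightarrow> 0) F"
  proof (rule tendstoI)
    fix e :: real assume "e > 0"
    obtain d0 where d0: "d0 > 0" "\<And>x y. \<lbrakk>x \<in> cball 0 (r+1); y \<in> cball 0 (r+1); dist y x < d0\<rbrakk> \<Longrightarrow> dist (f y) (f x) < e / 2"
      using fc \<open>e > 0\<close> unfolding uniformly_continuous_on_def by (meson half_gt_zero)
    \<comment> \<open>The bound by 1 keeps both points in the slightly larger ball whenever one of them is in the support.\<close>
  define d where "d = min d0 1"
    have d: "d > 0" "d \<le> 1" "d \<le> d0" using d0 by (auto simp: d_def)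
    have unif: "\<bar>f x - f y\<bar> \<le> e / 2" if "dist x y < d" for x y
    proof (cases "norm x \<le> r + 1 \<and> norm y \<le> r + 1")
      case True
      then show ?thesis using d0(2)[of y x] that d by (auto simp: dist_real_def)
    next
      case False
      have "\<bar>norm x - norm y\<bar> \<le> dist x y" by (simp add: dist_norm norm_triangle_ineq3)
      then have "norm x \<ge> r" "norm y \<ge> r" using False that d by auto
      then show ?thesis using supp \<open>e > 0\<close> by simp
    qed
    define e' where "e' = e / (4 * \<bar>B\<bar> + 4)"
    have "4 * \<bar>B\<bar> + 4 > 0" by (simp add: add_nonneg_pos)
    then have e': "e' > 0" "(4 * \<bar>B\<bar> + 4) * e' = e"
      using \<open>e > 0\<close> by (auto simp: e'_def)
    then have e'2: "4 * (\<bar>B\<bar> * e') + 4 * e' = e" by (simp add: algebra_simps)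
    have "\<forall>\<^sub>F i in F. \<bar>measure (N i) {\<omega> \<in> space (N i). d \<le> dist (X i \<omega>) (X' i \<omega>)}\<bar> < e'"
      using tendstoD[OF close[OF d(1)] e'(1)] by (simp add: dist_real_def)
    then show "\<forall>\<^sub>F i in F. dist ((\<integral>\<omega>. f (X i \<omega>) \<partial>N i) - (\<integral>\<omega>. f (X' i \<omega>) \<partial>N i)) 0 < e"
      using X
    proof eventually_elim
      case (elim i)
      interpret P: prob_space "N i" using elim by simp
      note [measurable] = elim(2)[THEN conjunct2, THEN conjunct1] elim(2)[THEN conjunct2, THEN conjunct2]
      let ?A = "{\<omega> \<in> space (N i). d \<le> dist (X i \<omega>) (X' i \<omega>)}"
      have i: "integrable (N i) (\<lambda>\<omega>. f (X i \<omega>))" "integrable (N i) (\<lambda>\<omega>. f (X' i \<omega>))"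
        by (rule P.integrable_bounded_real[of _ "\<bar>B\<bar>"]; use B in simp)+
      have "\<bar>(\<integral>\<omega>. f (X i \<omega>) \<partial>N i) - (\<integral>\<omega>. f (X' i \<omega>) \<partial>N i)\<bar> = \<bar>\<integral>\<omega>. f (X i \<omega>) - f (X' i \<omega>) \<partial>N i\<bar>"
        using i by simp
      also have "\<dots> \<le> (\<integral>\<omega>. \<bar>f (X i \<omega>) - f (X' i \<omega>)\<bar> \<partial>N i)" by (rule integral_abs_bound)
      also have "\<dots> \<le> (\<integral>\<omega>. e / 2 + 2 * \<bar>B\<bar> * indicator ?A \<omega> \<partial>N i)"
      proof (rule integral_mono)
        show "integrable (N i) (\<lambda>\<omega>. e / 2 + 2 * \<bar>B\<bar> * indicator ?A \<omega>)"
          by (auto intro!: integrable_real_indicator simp: P.emeasure_eq_measure)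
        fix \<omega> assume "\<omega> \<in> space (N i)"
        then show "\<bar>f (X i \<omega>) - f (X' i \<omega>)\<bar> \<le> e / 2 + 2 * \<bar>B\<bar> * indicator ?A \<omega>"
          using unif[of "X i \<omega>" "X' i \<omega>"] B[of "X i \<omega>"] B[of "X' i \<omega>"] \<open>e > 0\<close>
          by (auto simp: indicator_def)
      qed (use i in auto)
      also have "\<dots> = e / 2 + 2 * \<bar>B\<bar> * measure (N i) ?A"
        by (subst Bochner_Integration.integral_add)
          (auto intro!: integrable_real_indicator simp: P.emeasure_eq_measure P.prob_space)
      also have "2 * \<bar>B\<bar> * measure (N i) ?A \<le> 2 * \<bar>B\<bar> * e'"
        using elim by (intro mult_left_mono) auto
      also have "e / 2 + 2 * \<bar>B\<bar> * e' < e" using e'(1) e'2 mult_nonneg_nonneg[of "\<bar>B\<bar>" e'] by linarith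
      finally show ?case by (simp add: dist_real_def)
    qed
  qed
  from tendsto_add[OF this lim] show ?thesis by simp
qed

lemma (in prob_space) exponential_distributed_laplace_transform:
  assumes D: "distributed M lborel X (exponential_density l)" and l: "0 < l" and c: "0 \<le> c"
  shows "(\<integral>\<omega>. exp (- (c * X \<omega>)) \<partial>M) = l / (l + c)"
proof -
  have "(\<integral>\<omega>. exp (- (c * X \<omega>)) \<partial>M) = (\<integral>x. exponential_density l x * exp (- (c * x)) \<partial>lborel)"
    by (subst distributed_integral[OF D]) (auto simp: exponential_density_nonneg l)
  also have "\<dots> = (\<integral>x. l / (l + c) * exponential_density (l + c) x \<partial>lborel)"
  proof (rule Bochner_Integration.integral_cong)
    fix x
    have "exp (- x * l) * exp (- (c * x)) = exp (- x * (l + c))"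
      by (simp add: exp_add[symmetric] algebra_simps)
    then show "exponential_density l x * exp (- (c * x)) = l / (l + c) * exponential_density (l + c) x"
      using l c by (auto simp: exponential_density_def)
  qed simp
  also have "\<dots> = l / (l + c)"
  proof -
    interpret E: prob_space "density lborel (exponential_density (l + c))"
      using l c by (intro prob_space_exponential_density) auto
    have "(\<integral>x. 1 \<partial>density lborel (exponential_density (l + c))) = (\<integral>x. exponential_density (l + c) x \<partial>lborel)"
      by (subst integral_density) (use l c in \<open>auto simp: exponential_density_nonneg\<close>)
    then show ?thesis using E.prob_space by simp
  qed
  finally show ?thesis .
qed

lemma (in prob_space) exponential_distributed_AE_nonneg:
  assumes D: "distributed M lborel X (exponential_density l)" and l: "0 < l"
  shows "AE \<omega> in M. 0 \<le> X \<omega>"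
proof -
  have [measurable]: "X \<in> borel_measurable M" using D by (auto simp: distributed_def)
  have "AE x in density lborel (exponential_density l). 0 \<le> x"
    by (subst AE_density) (auto simp: exponential_density_def)
  then have "AE x in distr M lborel X. 0 \<le> x" using D unfolding distributed_def by metis
  then show ?thesis by (subst (asm) AE_distr_iff) auto
qed

section \<open>Stationary distributions of Markov chains\<close>

lemma integrable_measure_pmf_bounded:
  fixes f :: "'a \<Rightarrow> real"
  assumes "\<And>x. x \<in> set_pmf p \<Longrightarrow> \<bar>f x\<bar> \<le> B"
  shows "integrable (measure_pmf p) f"
  by (rule measure_pmf.integrable_const_bound[where B=B]) (use assms in \<open>auto simp: AE_measure_pmf_iff\<close>)

text \<open>The tower rule for nonnegative integrals, transferred to bounded real functions by adding a constant.\<close>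

lemma expectation_bind_pmf_bounded:
  fixes f :: "'b \<Rightarrow> real"
  assumes B: "\<And>y. \<bar>f y\<bar> \<le> B"
  shows "measure_pmf.expectation (bind_pmf p K) f
    = measure_pmf.expectation p (\<lambda>x. measure_pmf.expectation (K x) f)"
proof -
  have B0: "0 \<le> B" using B[of undefined] by linarith
  define h where "h y = f y + B" for y
  have h: "0 \<le> h y" "h y \<le> 2 * B" for y using B[of y] by (auto simp: h_def)
  have ih: "integrable (measure_pmf q) h" for q
    by (rule integrable_measure_pmf_bounded[of _ _ "2 * B"]) (use h in auto)
  have if': "integrable (measure_pmf q) f" for q
    by (rule integrable_measure_pmf_bounded[of _ _ B]) (use B in auto)
  have Eh: "measure_pmf.expectation q h = measure_pmf.expectation q f + B" for q
    unfolding h_def using if' by simp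
  have Eh_bd: "0 \<le> measure_pmf.expectation q h" "measure_pmf.expectation q h \<le> 2 * B" for q
    using h ih by (auto intro!: measure_pmf.integral_le_const AE_I2)
  have ie: "integrable (measure_pmf p) (\<lambda>x. measure_pmf.expectation (K x) h)"
    by (rule integrable_measure_pmf_bounded[of _ _ "2 * B"]) (use Eh_bd in auto)
  have "ennreal (measure_pmf.expectation (bind_pmf p K) h) = (\<integral>\<^sup>+ y. ennreal (h y) \<partial>bind_pmf p K)"
    using ih h by (subst nn_integral_eq_integral) auto
  also have "\<dots> = (\<integral>\<^sup>+ x. \<integral>\<^sup>+ y. ennreal (h y) \<partial>K x \<partial>p)" by simp
  also have "\<dots> = (\<integral>\<^sup>+ x. ennreal (measure_pmf.expectation (K x) h) \<partial>p)"
    using ih h by (subst nn_integral_eq_integral) auto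
  also have "\<dots> = ennreal (measure_pmf.expectation p (\<lambda>x. measure_pmf.expectation (K x) h))"
    using ie Eh_bd by (subst nn_integral_eq_integral) auto
  finally have "measure_pmf.expectation (bind_pmf p K) h = measure_pmf.expectation p (\<lambda>x. measure_pmf.expectation (K x) h)"
    using Eh_bd by (subst (asm) ennreal_inj) (auto intro!: integral_nonneg_AE)
  moreover have "measure_pmf.expectation p (\<lambda>x. measure_pmf.expectation (K x) h)
     = measure_pmf.expectation p (\<lambda>x. measure_pmf.expectation (K x) f) + B"
  proof -
    have "integrable (measure_pmf p) (\<lambda>x. measure_pmf.expectation (K x) f)"
      using Bochner_Integration.integrable_diff[OF ie, of "\<lambda>_. B"] unfolding Eh by simp
    then show ?thesis unfolding Eh by simp
  qed
  ultimately show ?thesis unfolding Eh by simp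
qed

lemma expectation_bind_pmf_bounded_on:
  fixes f :: "'b \<Rightarrow> real"
  assumes B: "\<And>x y. x \<in> set_pmf p \<Longrightarrow> y \<in> set_pmf (K x) \<Longrightarrow> \<bar>f y\<bar> \<le> B"
  shows "measure_pmf.expectation (bind_pmf p K) f
    = measure_pmf.expectation p (\<lambda>x. measure_pmf.expectation (K x) f)"
proof -
  define S where "S = set_pmf (bind_pmf p K)"
  define f' where "f' y = f y * indicator S y" for y
  have "\<bar>f' y\<bar> \<le> \<bar>B\<bar>" for y
    using B by (fastforce simp: f'_def S_def indicator_def intro: order_trans[OF _ abs_ge_self])
  then have "measure_pmf.expectation (bind_pmf p K) f'
    = measure_pmf.expectation p (\<lambda>x. measure_pmf.expectation (K x) f')"
    by (rule expectation_bind_pmf_bounded)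
  moreover have "measure_pmf.expectation (bind_pmf p K) f' = measure_pmf.expectation (bind_pmf p K) f"
    by (intro integral_cong_AE) (simp_all add: AE_measure_pmf_iff f'_def S_def)
  moreover have "measure_pmf.expectation p (\<lambda>x. measure_pmf.expectation (K x) f')
    = measure_pmf.expectation p (\<lambda>x. measure_pmf.expectation (K x) f)"
  proof (intro integral_cong_AE)
    show "AE x in p. measure_pmf.expectation (K x) f' = measure_pmf.expectation (K x) f"
      unfolding AE_measure_pmf_iff
    proof
      fix x assume "x \<in> set_pmf p"
      then have "f' y = f y" if "y \<in> set_pmf (K x)" for y
        using that by (auto simp: f'_def S_def indicator_def)
      then show "measure_pmf.expectation (K x) f' = measure_pmf.expectation (K x) f"
        by (intro integral_cong_AE) (auto simp: AE_measure_pmf_iff)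
    qed
  qed auto
  ultimately show ?thesis by simp
qed

lemma min_LIMSEQ_const: "(\<lambda>N. min (c::real) (real N)) \<longlonglongrightarrow> c"
proof (rule tendsto_eventually)
  show "\<forall>\<^sub>F N in sequentially. min c (real N) = c"
    using eventually_ge_at_top[of "nat \<lceil>c\<rceil>"]
  proof eventually_elim
    case (elim N)
    then have "c \<le> real N" by linarith
    then show ?case by simp
  qed
qed

text \<open>The Foster--Lyapunov moment bound: integrating the drift inequality would give the claim at once if the
  expectation of \<open>f\<close> were finite. To avoid that assumption the inequality is integrated for \<open>f\<close> truncated at
  level \<open>N\<close>, where the stationary expectations do cancel, and Fatou's lemma removes the truncation.\<close>

lemma stationary_drift_bound:
  fixes \<pi> :: "'s pmf" and f g :: "'s \<Rightarrow> real"
  assumes stat: "bind_pmf \<pi> P = \<pi>"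
    and fin: "\<And>x. finite (set_pmf (P x))"
    and f: "\<And>x. 0 \<le> f x" and g: "\<And>x. 0 \<le> g x" and b: "0 \<le> b"
    and drift: "\<And>x. measure_pmf.expectation (P x) f + g x \<le> f x + b"
  shows "integrable (measure_pmf \<pi>) g" "measure_pmf.expectation \<pi> g \<le> b"
proof -
  define pf where "pf x = measure_pmf.expectation (P x) f" for x
  have pf0: "0 \<le> pf x" for x unfolding pf_def using f by (intro integral_nonneg_AE) auto
  \<comment> \<open>The slack in the truncated drift inequality; it is nonnegative and tends to at least \<open>g\<close>.\<close>
  define k where "k N x = min (f x) (real N) + b - min (pf x) (real N)" for N x
  have k0: "0 \<le> k N x" for N x
    using drift[of x] g[of x] b by (auto simp: k_def pf_def[symmetric] min_def)
  have i1: "integrable (measure_pmf \<pi>) (\<lambda>x. min (f x) (real N))" for N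
    by (rule integrable_measure_pmf_bounded[of _ _ "real N"]) (use f in auto)
  have i2: "integrable (measure_pmf \<pi>) (\<lambda>x. min (pf x) (real N))" for N
    by (rule integrable_measure_pmf_bounded[of _ _ "real N"]) (use pf0 in auto)
  have k_int: "(\<integral>\<^sup>+ x. ennreal (k N x) \<partial>\<pi>) \<le> ennreal b" for N
  proof -
    have "measure_pmf.expectation \<pi> (\<lambda>x. min (f x) (real N))
        = measure_pmf.expectation (bind_pmf \<pi> P) (\<lambda>x. min (f x) (real N))" by (simp add: stat)
    also have "\<dots> = measure_pmf.expectation \<pi> (\<lambda>x. measure_pmf.expectation (P x) (\<lambda>y. min (f y) (real N)))"
      by (rule expectation_bind_pmf_bounded[of _ "real N"]) (use f in auto)
    also have "\<dots> \<le> measure_pmf.expectation \<pi> (\<lambda>x. min (pf x) (real N))"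
    proof (rule integral_mono_AE)
      have fi: "integrable (measure_pmf (P x)) h" for h :: "'s \<Rightarrow> real" and x
        by (rule integrable_measure_pmf_finite[OF fin])
      have le: "measure_pmf.expectation (P x) (\<lambda>y. min (f y) (real N)) \<le> min (pf x) (real N)" for x
        unfolding pf_def by (intro min.boundedI integral_mono fi measure_pmf.integral_le_const) auto
      have ge: "0 \<le> measure_pmf.expectation (P x) (\<lambda>y. min (f y) (real N))" for x
        using f by (intro integral_nonneg_AE) auto
      show "integrable (measure_pmf \<pi>) (\<lambda>x. measure_pmf.expectation (P x) (\<lambda>y. min (f y) (real N)))"
        by (rule integrable_measure_pmf_bounded[of _ _ "real N"]) (use le ge in \<open>auto\<close>)
      show "AE x in \<pi>. measure_pmf.expectation (P x) (\<lambda>y. min (f y) (real N)) \<le> min (pf x) (real N)"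
        using le by auto
    qed (rule i2)
    finally have "measure_pmf.expectation \<pi> (k N) \<le> b"
      unfolding k_def using i1[of N] i2[of N] by simp
    moreover have "integrable (measure_pmf \<pi>) (k N)"
      unfolding k_def using i1[of N] i2[of N] by simp
    ultimately show ?thesis using k0 b
      by (subst nn_integral_eq_integral) auto
  qed
  have "(\<integral>\<^sup>+ x. ennreal (g x) \<partial>\<pi>) \<le> (\<integral>\<^sup>+ x. liminf (\<lambda>N. ennreal (k N x)) \<partial>\<pi>)"
  proof (rule nn_integral_mono)
    fix x
    have "(\<lambda>N. k N x) \<longlonglongrightarrow> f x + b - pf x"
      unfolding k_def by (intro tendsto_intros min_LIMSEQ_const)
    then have "(\<lambda>N. ennreal (k N x)) \<longlonglongrightarrow> ennreal (f x + b - pf x)"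
      by (rule tendsto_ennrealI)
    then have "liminf (\<lambda>N. ennreal (k N x)) = ennreal (f x + b - pf x)"
      by (intro lim_imp_Liminf) auto
    then show "ennreal (g x) \<le> liminf (\<lambda>N. ennreal (k N x))"
      using drift[of x] by (auto simp: pf_def intro!: ennreal_leI)
  qed
  also have "\<dots> \<le> liminf (\<lambda>N. \<integral>\<^sup>+ x. ennreal (k N x) \<partial>\<pi>)"
    by (rule nn_integral_liminf) simp
  also have "\<dots> \<le> liminf (\<lambda>N. ennreal b)"
    by (rule Liminf_mono) (simp add: k_int)
  also have "\<dots> = ennreal b" by (simp add: Liminf_const)
  finally have le: "(\<integral>\<^sup>+ x. ennreal (g x) \<partial>\<pi>) \<le> ennreal b" .
  show int: "integrable (measure_pmf \<pi>) g"
    using le g by (intro integrableI_bounded) (auto simp: top.not_eq_extremum intro: le_less_trans)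
  show "measure_pmf.expectation \<pi> g \<le> b"
    using le g b by (subst (asm) nn_integral_eq_integral[OF int]) auto
qed

text \<open>Again the common expectation of \<open>X\<close> and \<open>Y\<close> may be infinite; truncation and dominated convergence
  for the bounded increment replace the subtraction of expectations.\<close>

lemma equidistributed_bounded_increment_mean_zero:
  fixes J :: "'w pmf" and X Y :: "'w \<Rightarrow> real"
  assumes same: "map_pmf X J = map_pmf Y J"
    and X: "\<And>w. w \<in> set_pmf J \<Longrightarrow> 0 \<le> X w" and Y: "\<And>w. w \<in> set_pmf J \<Longrightarrow> 0 \<le> Y w"
    and bd: "\<And>w. w \<in> set_pmf J \<Longrightarrow> \<bar>Y w - X w\<bar> \<le> c"
  shows "measure_pmf.expectation J (\<lambda>w. Y w - X w) = 0"
proof -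
  have "(\<lambda>N. measure_pmf.expectation J (\<lambda>w. min (Y w) (real N) - min (X w) (real N)))
      \<longlonglongrightarrow> measure_pmf.expectation J (\<lambda>w. Y w - X w)"
  proof (rule integral_dominated_convergence[where w="\<lambda>_. c"])
    show "AE w in J. (\<lambda>N. min (Y w) (real N) - min (X w) (real N)) \<longlonglongrightarrow> Y w - X w"
      by (intro AE_I2 tendsto_intros min_LIMSEQ_const)
    fix N
    show "AE w in J. norm (min (Y w) (real N) - min (X w) (real N)) \<le> c"
      using bd by (force simp: AE_measure_pmf_iff min_def)
  qed auto
  moreover have "measure_pmf.expectation J (\<lambda>w. min (Y w) (real N) - min (X w) (real N)) = 0" for N
  proof -
    have "integrable (measure_pmf J) (\<lambda>w. min (Y w) (real N))" "integrable (measure_pmf J) (\<lambda>w. min (X w) (real N))"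
      by (rule integrable_measure_pmf_bounded[of _ _ "real N"]; use X Y in force)+
    moreover have "measure_pmf.expectation J (\<lambda>w. min (X w) (real N)) = measure_pmf.expectation J (\<lambda>w. min (Y w) (real N))"
      using arg_cong[OF same, of "\<lambda>p. measure_pmf.expectation p (\<lambda>x. min x (real N))"] by simp
    ultimately show ?thesis by simp
  qed
  ultimately show ?thesis by (simp add: LIMSEQ_const_iff)
qed

section \<open>Distance from the diagonal\<close>

text \<open>The inner product of the components orthogonal to the all-ones vector.\<close>

definition inner_centred :: "('n::finite \<Rightarrow> real) \<Rightarrow> ('n \<Rightarrow> real) \<Rightarrow> real" where
  "inner_centred y z = (\<Sum>i\<in>UNIV. y i * z i) - (\<Sum>i\<in>UNIV. y i) * (\<Sum>i\<in>UNIV. z i) / real CARD('n)"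

abbreviation dispersion :: "('n::finite \<Rightarrow> real) \<Rightarrow> real" where
  "dispersion y \<equiv> inner_centred y y"

lemma inner_centred_add_left: "inner_centred (\<lambda>i. y i + z i) v = inner_centred y v + inner_centred z v"
  by (simp add: inner_centred_def sum.distrib algebra_simps add_divide_distrib)

lemma inner_centred_diff_left: "inner_centred (\<lambda>i. y i - z i) v = inner_centred y v - inner_centred z v"
  by (simp add: inner_centred_def sum_subtractf algebra_simps diff_divide_distrib)

lemma inner_centred_commute: "inner_centred y z = inner_centred z y"
  by (simp add: inner_centred_def mult.commute)

lemma inner_centred_const: "inner_centred (\<lambda>i::'n::finite. c) z = 0"
  by (simp add: inner_centred_def sum_distrib_left[symmetric])

lemma inner_centred_add_right: "inner_centred v (\<lambda>i. y i + z i) = inner_centred v y + inner_centred v z"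
  by (simp add: inner_centred_def sum.distrib algebra_simps add_divide_distrib)

lemma inner_centred_diff_right: "inner_centred v (\<lambda>i. y i - z i) = inner_centred v y - inner_centred v z"
  by (simp add: inner_centred_def sum_subtractf algebra_simps diff_divide_distrib)

lemma dispersion_add: "dispersion (\<lambda>i. y i + z i) = dispersion y + 2 * inner_centred y z + dispersion z"
  by (simp add: inner_centred_add_left inner_centred_add_right inner_centred_commute[of z y])

lemma dispersion_diff: "dispersion (\<lambda>i. y i - z i) = dispersion y - 2 * inner_centred y z + dispersion z"
  by (simp add: inner_centred_diff_left inner_centred_diff_right inner_centred_commute[of z y])

lemma inner_centred_shift: "inner_centred (\<lambda>i. y i - c) z = inner_centred y z"
  by (simp add: inner_centred_diff_left inner_centred_const)

lemma dispersion_shift: "dispersion (\<lambda>i. y i - c) = dispersion y"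
  by (simp add: dispersion_diff inner_centred_const inner_centred_commute[of y "\<lambda>i. c"])

lemma dispersion_le_sum_squares: "dispersion y \<le> (\<Sum>i\<in>UNIV. (y i)\<^sup>2)"
  by (simp add: inner_centred_def power2_eq_square)

lemma dispersion_le_bounded:
  assumes "\<And>i. \<bar>y i\<bar> \<le> L"
  shows "dispersion (y :: 'n::finite \<Rightarrow> real) \<le> real CARD('n) * L\<^sup>2"
proof -
  have "(\<Sum>i\<in>UNIV. (y i)\<^sup>2) \<le> (\<Sum>i\<in>(UNIV::'n set). L\<^sup>2)"
    by (intro sum_mono) (metis abs_ge_zero assms power2_abs power_mono)
  then show ?thesis using dispersion_le_sum_squares[of y] by simp
qed

text \<open>The dispersion is the squared Euclidean distance from the diagonal.\<close>

lemma dispersion_alt: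
  fixes y :: "'n::finite \<Rightarrow> real"
  defines "m \<equiv> (\<Sum>i\<in>UNIV. y i) / real CARD('n)"
  shows "dispersion y = (\<Sum>i\<in>UNIV. (y i - m)\<^sup>2)"
proof -
  have "(\<Sum>i\<in>UNIV. (y i - m)) = 0" by (simp add: sum_subtractf m_def)
  then have "dispersion (\<lambda>i. y i - m) = (\<Sum>i\<in>UNIV. (y i - m)\<^sup>2)"
    unfolding inner_centred_def power2_eq_square by simp
  then show ?thesis by (simp add: dispersion_shift)
qed

lemma dispersion_nonneg: "0 \<le> dispersion y"
  by (simp add: dispersion_alt sum_nonneg)

definition shortest_length :: "('n::finite \<Rightarrow> nat) \<Rightarrow> nat" where
  "shortest_length x = Min (range x)"

definition imbalance :: "('n::finite \<Rightarrow> nat) \<Rightarrow> real" where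
  "imbalance x = (\<Sum>i\<in>UNIV. real (x i) - real (shortest_length x))"

lemma shortest_length_le: "shortest_length x \<le> x i"
  by (simp add: shortest_length_def)

lemma shortest_queues_iff: "i \<in> shortest_queues x \<longleftrightarrow> x i = shortest_length x"
  unfolding shortest_queues_def shortest_length_def
  by (auto intro!: antisym Min.boundedI)

lemma ex_shortest_queue:
  fixes x :: "'n::finite \<Rightarrow> nat"
  obtains i where "i \<in> shortest_queues x"
proof -
  have "Min (range x) \<in> range x" by (intro Min_in) auto
  then show ?thesis using that unfolding shortest_queues_iff shortest_length_def by (metis imageE)
qed

lemma shortest_queues_nonempty: "shortest_queues (x :: 'n::finite \<Rightarrow> nat) \<noteq> {}"
  using ex_shortest_queue by blast

lemma imbalance_ge: "real (x i) - real (shortest_length x) \<le> imbalance x"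
  unfolding imbalance_def using shortest_length_le[of x]
  by (intro member_le_sum[of i UNIV "\<lambda>i. real (x i) - real (shortest_length x)"]) auto

lemma imbalance_nonneg: "0 \<le> imbalance x"
  unfolding imbalance_def using shortest_length_le[of x] by (intro sum_nonneg) auto

lemma dispersion_le_imbalance: "dispersion (\<lambda>i. real (x i)) \<le> (imbalance x)\<^sup>2"
proof -
  let ?z = "\<lambda>i. real (x i) - real (shortest_length x)"
  have z: "0 \<le> ?z i" "?z i \<le> imbalance x" for i using shortest_length_le[of x i] imbalance_ge[of x i] by auto
  have "dispersion (\<lambda>i. real (x i)) = dispersion ?z" by (simp add: dispersion_shift)
  also have "\<dots> \<le> (\<Sum>i\<in>UNIV. ?z i * ?z i)" using dispersion_le_sum_squares[of ?z] by (simp add: power2_eq_square)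
  also have "\<dots> \<le> (\<Sum>i\<in>UNIV. ?z i * imbalance x)" by (intro sum_mono mult_left_mono z)
  also have "\<dots> = (imbalance x)\<^sup>2" by (simp add: sum_distrib_right[symmetric] imbalance_def power2_eq_square)
  finally show ?thesis .
qed

text \<open>The deviations of a queue and of the shortest queue from the average cannot both be small when
  the two lengths differ. Together with \<open>dispersion_le_imbalance\<close> this lets the drift estimate be
  phrased with the imbalance alone.\<close>

lemma imbalance_le_dispersion:
  fixes x :: "'n::finite \<Rightarrow> nat"
  shows "(imbalance x)\<^sup>2 \<le> 2 * (real CARD('n))\<^sup>2 * dispersion (\<lambda>i. real (x i))"
proof -
  let ?n = "real CARD('n)" and ?D = "dispersion (\<lambda>i. real (x i))"
  let ?z = "\<lambda>i. real (x i) - real (shortest_length x)"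
  define m where "m = (\<Sum>i\<in>UNIV. real (x i)) / ?n"
  have D: "?D = (\<Sum>i\<in>UNIV. (real (x i) - m)\<^sup>2)" unfolding m_def by (rule dispersion_alt)
  obtain j where j: "x j = shortest_length x" using ex_shortest_queue shortest_queues_iff by metis
  have le: "(?z i)\<^sup>2 \<le> 2 * ?D" for i
  proof (cases "i = j")
    case True
    then show ?thesis using j by (simp add: dispersion_nonneg)
  next
    case False
    have "(real (x i) - m)\<^sup>2 + (real (x j) - m)\<^sup>2 = (\<Sum>k\<in>{i,j}. (real (x k) - m)\<^sup>2)" using False by simp
    also have "\<dots> \<le> ?D" unfolding D by (intro sum_mono2) auto
    finally have "(real (x i) - m)\<^sup>2 + (real (x j) - m)\<^sup>2 \<le> ?D" .
    moreover have "(?z i)\<^sup>2 \<le> 2 * ((real (x i) - m)\<^sup>2 + (real (x j) - m)\<^sup>2)"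
      unfolding j[symmetric] using zero_le_power2[of "(real (x i) - m) + (real (x j) - m)"]
      by (simp add: power2_eq_square algebra_simps)
    ultimately show ?thesis by (meson mult_left_mono order_trans zero_le_numeral)
  qed
  have "(imbalance x)\<^sup>2 \<le> (\<Sum>i\<in>UNIV. (?z i)\<^sup>2) * ?n"
    unfolding imbalance_def by (rule sum_squared_le_sum_of_squares)
  also have "\<dots> \<le> (\<Sum>i\<in>(UNIV::'n set). 2 * ?D) * ?n" by (intro mult_right_mono sum_mono le) auto
  also have "\<dots> = 2 * ?n\<^sup>2 * ?D" unfolding power2_eq_square sum_constant by (simp only: mult_ac)
  finally show ?thesis .
qed

lemma inner_centred_le_imbalance:
  fixes x :: "'n::finite \<Rightarrow> nat"
  assumes z: "\<And>i. \<bar>z i\<bar> \<le> L"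
  shows "\<bar>inner_centred (\<lambda>i. real (x i)) z\<bar> \<le> 2 * L * imbalance x"
proof -
  let ?y = "\<lambda>i. real (x i) - real (shortest_length x)"
  have y: "0 \<le> ?y i" for i using shortest_length_le[of x i] by auto
  have "\<bar>\<Sum>i\<in>UNIV. ?y i * z i\<bar> \<le> (\<Sum>i\<in>UNIV. ?y i * L)"
  proof (rule order_trans[OF sum_abs], rule sum_mono)
    fix i
    show "\<bar>?y i * z i\<bar> \<le> ?y i * L"
      using mult_left_mono[OF z[of i] y[of i]] y[of i] by (simp add: abs_mult)
  qed
  also have "\<dots> = imbalance x * L" by (simp add: imbalance_def sum_distrib_right)
  finally have 1: "\<bar>\<Sum>i\<in>UNIV. ?y i * z i\<bar> \<le> imbalance x * L" .
  have "\<bar>\<Sum>i\<in>UNIV. z i\<bar> \<le> (\<Sum>i\<in>(UNIV::'n set). L)"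
    by (rule order_trans[OF sum_abs]) (intro sum_mono z)
  then have "\<bar>\<Sum>i\<in>UNIV. z i\<bar> / real CARD('n) \<le> L" by (simp add: field_simps)
  then have "imbalance x * (\<bar>\<Sum>i\<in>UNIV. z i\<bar> / real CARD('n)) \<le> imbalance x * L"
    by (rule mult_left_mono[OF _ imbalance_nonneg])
  then have 2: "\<bar>(\<Sum>i\<in>UNIV. ?y i) * (\<Sum>i\<in>UNIV. z i) / real CARD('n)\<bar> \<le> imbalance x * L"
    using imbalance_nonneg[of x] unfolding imbalance_def[symmetric] by (simp add: abs_mult)
  have "inner_centred (\<lambda>i. real (x i)) z = inner_centred ?y z" by (simp add: inner_centred_shift)
  moreover have "\<bar>inner_centred ?y z\<bar> \<le> imbalance x * L + imbalance x * L"
    unfolding inner_centred_def by (rule order_trans[OF abs_triangle_ineq4 add_mono[OF 1 2]])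
  ultimately show ?thesis by simp
qed

section \<open>One slot under JSQ\<close>

text \<open>Subtraction on \<open>nat\<close> is truncated, which is the maximum with 0 in the queue dynamics.\<close>

definition jsq_next :: "('n \<Rightarrow> nat) \<Rightarrow> 'n \<Rightarrow> nat \<times> ('n \<Rightarrow> nat) \<Rightarrow> 'n \<Rightarrow> nat" where
  "jsq_next x i w = (\<lambda>j. x j + (if j = i then fst w else 0) - snd w j)"

definition jsq_kernel :: "(nat \<times> ('n::finite \<Rightarrow> nat)) pmf \<Rightarrow> ('n \<Rightarrow> nat) \<Rightarrow> ('n \<Rightarrow> nat) pmf" where
  "jsq_kernel \<nu> x = bind_pmf (pmf_of_set (shortest_queues x)) (\<lambda>i. map_pmf (jsq_next x i) \<nu>)"

definition net_input :: "'n \<Rightarrow> nat \<times> ('n \<Rightarrow> nat) \<Rightarrow> 'n \<Rightarrow> real" where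
  "net_input i w j = (if j = i then real (fst w) else 0) - real (snd w j)"

definition unused_service :: "('n \<Rightarrow> nat) \<Rightarrow> 'n \<Rightarrow> nat \<times> ('n \<Rightarrow> nat) \<Rightarrow> 'n \<Rightarrow> real" where
  "unused_service x i w j = real (jsq_next x i w j) - real (x j) - net_input i w j"

definition total_input :: "nat \<times> ('n::finite \<Rightarrow> nat) \<Rightarrow> real" where
  "total_input w = real (fst w) - (\<Sum>j\<in>UNIV. real (snd w j))"

lemma unused_service_eq: "unused_service x i w j = max 0 (- (real (x j) + net_input i w j))"
  unfolding unused_service_def jsq_next_def net_input_def by (auto simp: max_def)

lemma unused_service_nonneg: "0 \<le> unused_service x i w j"
  by (simp add: unused_service_eq)

lemma unused_service_le: "unused_service x i w j \<le> real (snd w j)"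
  by (auto simp: unused_service_eq net_input_def)

lemma unused_service_complementary: "real (jsq_next x i w j) * unused_service x i w j = 0"
  unfolding unused_service_def jsq_next_def net_input_def by auto

lemma sum_net_input: "(\<Sum>j\<in>UNIV. net_input i w j) = total_input (w :: nat \<times> ('n::finite \<Rightarrow> nat))"
  by (simp add: net_input_def total_input_def sum_subtractf)

lemma jsq_next_decomp: "real (jsq_next x i w j) = real (x j) + net_input i w j + unused_service x i w j"
  by (simp add: unused_service_def)

lemma net_input_abs_le:
  assumes "fst w \<le> L" "\<And>j. snd w j \<le> L"
  shows "\<bar>net_input i w j\<bar> \<le> real L"
  using assms(1) assms(2)[of j] by (auto simp: net_input_def)

lemma jsq_next_increment_le:
  assumes "fst w \<le> L" "\<And>j. snd w j \<le> L"
  shows "\<bar>real (jsq_next x i w j) - real (x j)\<bar> \<le> real L"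
  using assms(1) assms(2)[of j] by (auto simp: jsq_next_def)

text \<open>Wasted service only reduces the dispersion: it acts on queues that end the slot empty, so it is orthogonal to the new queue
  vector and its centred inner product with it is nonpositive. What remains is the free expansion of the
  dispersion along \<open>net_input\<close>.\<close>

lemma dispersion_jsq_next_le:
  fixes x :: "'n::finite \<Rightarrow> nat"
  assumes "fst w \<le> L" "\<And>j. snd w j \<le> L"
  shows "dispersion (\<lambda>j. real (jsq_next x i w j))
    \<le> dispersion (\<lambda>j. real (x j)) + 2 * inner_centred (\<lambda>j. real (x j)) (net_input i w) + real CARD('n) * (real L)\<^sup>2"
proof -
  let ?x' = "\<lambda>j. real (jsq_next x i w j)" and ?u = "unused_service x i w"
  have "inner_centred ?x' ?u = - (\<Sum>j\<in>UNIV. ?x' j) * (\<Sum>j\<in>UNIV. ?u j) / real CARD('n)"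
    by (simp add: inner_centred_def unused_service_complementary)
  then have "inner_centred ?x' ?u \<le> 0"
    by (simp add: sum_nonneg unused_service_nonneg)
  then have "dispersion ?x' \<le> dispersion (\<lambda>j. ?x' j - ?u j)"
    using dispersion_nonneg[of ?u] by (simp add: dispersion_diff)
  also have "(\<lambda>j. ?x' j - ?u j) = (\<lambda>j. real (x j) + net_input i w j)"
    by (simp add: jsq_next_decomp)
  also have "dispersion \<dots> \<le> dispersion (\<lambda>j. real (x j)) + 2 * inner_centred (\<lambda>j. real (x j)) (net_input i w) + real CARD('n) * (real L)\<^sup>2"
    using dispersion_le_bounded[of "net_input i w", OF net_input_abs_le[OF assms]]
    by (simp add: dispersion_add)
  finally show ?thesis .
qed

lemma dispersion_increment_le:
  fixes x :: "'n::finite \<Rightarrow> nat"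
  assumes "fst w \<le> L" "\<And>j. snd w j \<le> L"
  shows "\<bar>dispersion (\<lambda>j. real (jsq_next x i w j)) - dispersion (\<lambda>j. real (x j))\<bar>
    \<le> 4 * real L * imbalance x + real CARD('n) * (real L)\<^sup>2"
proof -
  let ?d = "\<lambda>j. real (jsq_next x i w j) - real (x j)"
  have d: "\<bar>?d j\<bar> \<le> real L" for j by (rule jsq_next_increment_le[OF assms])
  have "dispersion (\<lambda>j. real (x j) + ?d j) - dispersion (\<lambda>j. real (x j)) = 2 * inner_centred (\<lambda>j. real (x j)) ?d + dispersion ?d"
    by (simp only: dispersion_add)
  moreover have "\<bar>inner_centred (\<lambda>j. real (x j)) ?d\<bar> \<le> 2 * real L * imbalance x"
    by (rule inner_centred_le_imbalance[OF d])
  moreover have "dispersion ?d \<le> real CARD('n) * (real L)\<^sup>2" "0 \<le> dispersion ?d"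
    by (rule dispersion_le_bounded[OF d], rule dispersion_nonneg)
  ultimately show ?thesis by simp
qed

section \<open>State space collapse\<close>

text \<open>An upper bound, uniform in \<open>g \<ge> 0\<close>, for a polynomial \<open>p * g\<^sup>2 - c * g ^ 3\<close> plus a constant, as it arises in
  the drift estimate. What matters is that it does not depend on \<open>\<epsilon>\<close>.\<close>

definition imbalance_bound :: "nat \<Rightarrow> nat \<Rightarrow> real \<Rightarrow> real" where
  "imbalance_bound n L \<delta> = (let p = 2 * real n * (real L)\<^sup>2 + 32 * (real L)\<^sup>2 + 1; c = 2 * \<delta> / (real n)\<^sup>2
     in p ^ 3 / c\<^sup>2 + 2 * (real n)\<^sup>2 * (real L) ^ 4)"

lemma cubic_minus_quadratic_bound:
  fixes c p g :: real
  assumes "c > 0" "p \<ge> 0" "g \<ge> 0"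
  shows "p * g\<^sup>2 - c * g ^ 3 \<le> p ^ 3 / c\<^sup>2"
proof (cases "c * g \<le> p")
  case True
  have "p * g\<^sup>2 - c * g ^ 3 \<le> p * g\<^sup>2" using assms by simp
  also have "\<dots> \<le> p * (p / c)\<^sup>2"
    using assms True by (intro mult_left_mono power_mono) (auto simp: field_simps)
  finally show ?thesis by (simp add: power2_eq_square power3_eq_cube)
next
  case False
  then have "(p - c * g) * g\<^sup>2 \<le> 0" by (intro mult_nonpos_nonneg) auto
  moreover have "p * g\<^sup>2 - c * g ^ 3 = (p - c * g) * g\<^sup>2" by (simp add: algebra_simps power2_eq_square power3_eq_cube)
  moreover have "0 \<le> p ^ 3 / c\<^sup>2" using assms by simp
  ultimately show ?thesis by linarith
qed

text \<open>For dispersion \<open>D\<close> and imbalance \<open>g\<close> the left-hand side bounds the drift of \<open>D\<^sup>2\<close>. Because \<open>D\<close> is of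
  order \<open>g\<^sup>2\<close>, the negative term is of order \<open>g ^ 3\<close> and beats all others.\<close>

lemma drift_polynomial_bound:
  fixes g D \<delta> :: real
  assumes \<delta>: "\<delta> > 0" and g: "g \<ge> 0" and n: "n > 0" and D: "D \<le> g\<^sup>2" "g\<^sup>2 \<le> 2 * (real n)\<^sup>2 * D"
  shows "2 * D * (real n * (real L)\<^sup>2 - 2 * \<delta> * g) + (4 * real L * g + real n * (real L)\<^sup>2)\<^sup>2
    \<le> imbalance_bound n L \<delta> - g\<^sup>2"
proof -
  define c where "c = 2 * \<delta> / (real n)\<^sup>2"
  define p where "p = 2 * real n * (real L)\<^sup>2 + 32 * (real L)\<^sup>2 + 1"
  have c: "c > 0" using \<delta> n by (simp add: c_def)
  have "c * g\<^sup>2 * g \<le> c * (2 * (real n)\<^sup>2 * D) * g"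
    using D c g by (intro mult_right_mono mult_left_mono) auto
  also have "\<dots> = 4 * \<delta> * D * g" using n by (simp add: c_def)
  finally have 1: "c * g ^ 3 \<le> 4 * \<delta> * D * g" by (simp add: power2_eq_square power3_eq_cube)
  have "real n * (real L)\<^sup>2 * D \<le> real n * (real L)\<^sup>2 * g\<^sup>2" using D by (intro mult_left_mono) auto
  then have 2: "2 * D * (real n * (real L)\<^sup>2) \<le> 2 * (real n * (real L)\<^sup>2 * g\<^sup>2)" by (simp add: mult_ac)
  have "(4 * real L * g + real n * (real L)\<^sup>2)\<^sup>2 \<le> 2 * (4 * real L * g)\<^sup>2 + 2 * (real n * (real L)\<^sup>2)\<^sup>2"
    using zero_le_power2[of "4 * real L * g - real n * (real L)\<^sup>2"] by (simp add: power2_eq_square algebra_simps)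
  also have "\<dots> = 32 * (real L)\<^sup>2 * g\<^sup>2 + 2 * (real n)\<^sup>2 * (real L) ^ 4"
    by (simp add: power_mult_distrib flip: power_mult)
  finally have 3: "(4 * real L * g + real n * (real L)\<^sup>2)\<^sup>2 \<le> 32 * (real L)\<^sup>2 * g\<^sup>2 + 2 * (real n)\<^sup>2 * (real L) ^ 4" .
  have "p * g\<^sup>2 - c * g ^ 3 \<le> p ^ 3 / c\<^sup>2"
    by (rule cubic_minus_quadratic_bound) (use c g in \<open>auto simp: p_def\<close>)
  then have 4: "p * g\<^sup>2 - c * g ^ 3 \<le> imbalance_bound n L \<delta> - 2 * (real n)\<^sup>2 * (real L) ^ 4"
    by (simp add: imbalance_bound_def c_def p_def Let_def)
  have "p * g\<^sup>2 = 2 * (real n * (real L)\<^sup>2 * g\<^sup>2) + 32 * (real L)\<^sup>2 * g\<^sup>2 + g\<^sup>2"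
    by (simp add: p_def algebra_simps)
  moreover have "2 * D * (real n * (real L)\<^sup>2 - 2 * \<delta> * g) = 2 * D * (real n * (real L)\<^sup>2) - 4 * \<delta> * D * g"
    by (simp add: algebra_simps)
  ultimately show ?thesis using 1 2 3 4 by linarith
qed

text \<open>An invariant law \<open>\<pi>\<close> of the JSQ chain whose input per slot has law \<open>\<nu>\<close>. The bound \<open>L\<close> on the input is a
  parameter of its own because the estimates have to be uniform in \<open>\<epsilon>\<close>.\<close>

locale stationary_jsq =
  fixes \<pi> :: "('n::finite \<Rightarrow> nat) pmf" and \<nu> :: "(nat \<times> ('n \<Rightarrow> nat)) pmf" and \<epsilon> :: real and L :: nat
  assumes stationary: "bind_pmf \<pi> (jsq_kernel \<nu>) = \<pi>"
    and arrivals_le: "\<And>w. w \<in> set_pmf \<nu> \<Longrightarrow> fst w \<le> L"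
    and services_le: "\<And>w i. w \<in> set_pmf \<nu> \<Longrightarrow> snd w i \<le> L"
    and mean_total_input: "measure_pmf.expectation \<nu> total_input = - \<epsilon>"
begin

lemma finite_input: "finite (set_pmf \<nu>)"
proof (rule finite_subset)
  show "set_pmf \<nu> \<subseteq> {..L} \<times> (UNIV \<rightarrow>\<^sub>E {..L})"
    using arrivals_le services_le by (auto simp: PiE_def extensional_def)
qed (auto intro!: finite_PiE)

lemma integrable_input [simp]: "integrable (measure_pmf \<nu>) (f :: _ \<Rightarrow> real)"
  by (rule integrable_measure_pmf_finite[OF finite_input])

lemma finite_kernel: "finite (set_pmf (jsq_kernel \<nu> x))"
  using finite_input shortest_queues_nonempty[of x] by (simp add: jsq_kernel_def)

lemma expectation_kernel_le:
  assumes "\<And>i. i \<in> shortest_queues x \<Longrightarrow> measure_pmf.expectation \<nu> (\<lambda>w. f (jsq_next x i w)) \<le> c"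
  shows "measure_pmf.expectation (jsq_kernel \<nu> x) f \<le> (c::real)"
proof -
  let ?S = "shortest_queues x"
  have S: "finite ?S" "?S \<noteq> {}" using shortest_queues_nonempty by auto
  have "measure_pmf.expectation (jsq_kernel \<nu> x) f
    = (\<Sum>i\<in>?S. pmf (pmf_of_set ?S) i *\<^sub>R measure_pmf.expectation (map_pmf (jsq_next x i) \<nu>) f)"
    unfolding jsq_kernel_def by (rule pmf_expectation_bind) (use S finite_input in auto)
  also have "\<dots> \<le> (\<Sum>i\<in>?S. pmf (pmf_of_set ?S) i * c)"
    using assms by (intro sum_mono) (auto intro!: mult_left_mono)
  also have "\<dots> = c" using S by (simp add: sum_distrib_right[symmetric] sum_pmf_eq_1)
  finally show ?thesis .
qed

text \<open>Lowering each service rate by \<open>\<epsilon> / n\<close> makes the total rate equal to the arrival rate without changing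
  the centred inner product. Arrivals enter at the minimum, so each queue contributes its reduced rate times its
  excess over the minimum, with a negative sign.\<close>

lemma mean_inner_centred_net_input:
  assumes i: "i \<in> shortest_queues x"
    and rate: "\<And>j. \<delta> \<le> measure_pmf.expectation \<nu> (\<lambda>w. real (snd w j)) - \<epsilon> / real CARD('n)"
  shows "measure_pmf.expectation \<nu> (\<lambda>w. inner_centred (\<lambda>j. real (x j)) (net_input i w)) \<le> - \<delta> * imbalance x"
proof -
  define \<mu> where "\<mu> j = measure_pmf.expectation \<nu> (\<lambda>w. real (snd w j))" for j
  define m where "m = real (shortest_length x)"
  let ?n = "real CARD('n)" and ?E = "measure_pmf.expectation \<nu>"
  have Ea: "?E (\<lambda>w. real (fst w)) = (\<Sum>j\<in>UNIV. \<mu> j) - \<epsilon>"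
    using mean_total_input by (simp add: total_input_def[abs_def] \<mu>_def)
  have "inner_centred (\<lambda>j. real (x j)) (net_input i w)
    = (\<Sum>j\<in>UNIV. (real (x j) - m) * net_input i w j) - imbalance x * total_input w / ?n" for w
  proof -
    have "inner_centred (\<lambda>j. real (x j)) (net_input i w) = inner_centred (\<lambda>j. real (x j) - m) (net_input i w)"
      by (simp add: inner_centred_shift)
    then show ?thesis by (simp add: inner_centred_def sum_net_input imbalance_def m_def)
  qed
  moreover have "(\<Sum>j\<in>UNIV. (real (x j) - m) * net_input i w j) = - (\<Sum>j\<in>UNIV. (real (x j) - m) * real (snd w j))" for w
  proof -
    have "(real (x j) - m) * net_input i w j = - ((real (x j) - m) * real (snd w j))" for j
      using i by (auto simp: net_input_def shortest_queues_iff m_def)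
    then show ?thesis by (simp add: sum_negf)
  qed
  ultimately have "?E (\<lambda>w. inner_centred (\<lambda>j. real (x j)) (net_input i w))
     = ?E (\<lambda>w. - (\<Sum>j\<in>UNIV. (real (x j) - m) * real (snd w j)) - imbalance x * total_input w / ?n)"
    by simp
  also have "\<dots> = - (\<Sum>j\<in>UNIV. (real (x j) - m) * \<mu> j) + imbalance x * \<epsilon> / ?n"
    by (simp add: mean_total_input \<mu>_def)
  also have "\<dots> = - (\<Sum>j\<in>UNIV. (real (x j) - m) * (\<mu> j - \<epsilon> / ?n))"
  proof -
    have "(\<Sum>j\<in>UNIV. (real (x j) - m) * (\<epsilon> / ?n)) = imbalance x * (\<epsilon> / ?n)"
      unfolding imbalance_def m_def by (rule sum_distrib_right[symmetric])
    then show ?thesis by (simp add: right_diff_distrib[of _ "\<mu> _"] sum_subtractf)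
  qed
  also have "\<dots> \<le> - (\<Sum>j\<in>UNIV. (real (x j) - m) * \<delta>)"
    using rate shortest_length_le[of x] by (auto simp: m_def \<mu>_def intro!: sum_mono mult_left_mono)
  finally show ?thesis by (simp add: imbalance_def m_def sum_distrib_left sum_negf mult.commute)
qed

text \<open>The dispersion itself as a Lyapunov function would only control the first moment of the imbalance;
  its square has a drift of cubic order and controls the second one.\<close>

lemma imbalance_second_moment:
  assumes \<delta>: "\<delta> > 0"
    and rate: "\<And>j. \<delta> \<le> measure_pmf.expectation \<nu> (\<lambda>w. real (snd w j)) - \<epsilon> / real CARD('n)"
  shows "integrable (measure_pmf \<pi>) (\<lambda>x. (imbalance x)\<^sup>2)"
    and "measure_pmf.expectation \<pi> (\<lambda>x. (imbalance x)\<^sup>2) \<le> imbalance_bound CARD('n) L \<delta>"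
proof -
  let ?n = "real CARD('n)" and ?E = "measure_pmf.expectation \<nu>"
  define D where "D x = dispersion (\<lambda>j. real (x j))" for x :: "'n \<Rightarrow> nat"
  have D0: "0 \<le> D x" for x by (simp add: D_def dispersion_nonneg)
  have b: "0 \<le> imbalance_bound CARD('n) L \<delta>"
    using \<delta> by (simp add: imbalance_bound_def Let_def)
  have drift: "measure_pmf.expectation (jsq_kernel \<nu> x) (\<lambda>y. (D y)\<^sup>2) + (imbalance x)\<^sup>2
     \<le> (D x)\<^sup>2 + imbalance_bound CARD('n) L \<delta>" for x
  proof -
    let ?I = "\<lambda>i w. inner_centred (\<lambda>j. real (x j)) (net_input i w)"
    define b1 where "b1 = ?n * (real L)\<^sup>2"
    define b2 where "b2 = (4 * real L * imbalance x + ?n * (real L)\<^sup>2)\<^sup>2"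
    have "?E (\<lambda>w. (D (jsq_next x i w))\<^sup>2) \<le> (D x)\<^sup>2 + 2 * D x * (b1 - 2 * \<delta> * imbalance x) + b2"
      if i: "i \<in> shortest_queues x" for i
    proof -
      have "?E (\<lambda>w. (D (jsq_next x i w))\<^sup>2) \<le> ?E (\<lambda>w. (D x)\<^sup>2 + 2 * D x * (2 * ?I i w + b1) + b2)"
      proof (rule integral_mono_AE)
        show "AE w in \<nu>. (D (jsq_next x i w))\<^sup>2 \<le> (D x)\<^sup>2 + 2 * D x * (2 * ?I i w + b1) + b2"
          unfolding AE_measure_pmf_iff
        proof
          fix w assume w: "w \<in> set_pmf \<nu>"
          define e where "e = D (jsq_next x i w) - D x"
          have "e \<le> 2 * ?I i w + b1"
            using dispersion_jsq_next_le[OF arrivals_le[OF w] services_le[OF w], of x i]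
            by (simp add: e_def D_def b1_def)
          then have "2 * D x * e \<le> 2 * D x * (2 * ?I i w + b1)"
            using D0[of x] by (intro mult_left_mono) auto
          moreover have "\<bar>e\<bar> \<le> 4 * real L * imbalance x + ?n * (real L)\<^sup>2"
            using dispersion_increment_le[OF arrivals_le[OF w] services_le[OF w], of x i]
            by (simp add: e_def D_def)
          then have "e\<^sup>2 \<le> b2" unfolding b2_def by (metis abs_ge_zero power2_abs power_mono)
          moreover have "(D (jsq_next x i w))\<^sup>2 = (D x)\<^sup>2 + 2 * D x * e + e\<^sup>2"
            by (simp add: e_def power2_eq_square algebra_simps)
          ultimately show "(D (jsq_next x i w))\<^sup>2 \<le> (D x)\<^sup>2 + 2 * D x * (2 * ?I i w + b1) + b2" by linarith
        qed
      qed auto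
      also have "\<dots> = (D x)\<^sup>2 + 2 * D x * (2 * ?E (?I i) + b1) + b2" by simp
      also have "\<dots> \<le> (D x)\<^sup>2 + 2 * D x * (2 * (- \<delta> * imbalance x) + b1) + b2"
        using mean_inner_centred_net_input[OF i rate] D0[of x]
        by (intro add_mono mult_left_mono order_refl) auto
      finally show ?thesis by (simp add: algebra_simps)
    qed
    then have "measure_pmf.expectation (jsq_kernel \<nu> x) (\<lambda>y. (D y)\<^sup>2)
        \<le> (D x)\<^sup>2 + 2 * D x * (b1 - 2 * \<delta> * imbalance x) + b2"
      by (rule expectation_kernel_le)
    moreover have "2 * D x * (b1 - 2 * \<delta> * imbalance x) + b2 \<le> imbalance_bound CARD('n) L \<delta> - (imbalance x)\<^sup>2"
      unfolding b1_def b2_def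
      by (rule drift_polynomial_bound[OF \<delta> imbalance_nonneg])
        (use dispersion_le_imbalance[of x] imbalance_le_dispersion[of x] in \<open>auto simp: D_def\<close>)
    ultimately show ?thesis by linarith
  qed
  show "integrable (measure_pmf \<pi>) (\<lambda>x. (imbalance x)\<^sup>2)"
    by (rule stationary_drift_bound(1)[OF stationary finite_kernel _ _ b drift]) auto
  show "measure_pmf.expectation \<pi> (\<lambda>x. (imbalance x)\<^sup>2) \<le> imbalance_bound CARD('n) L \<delta>"
    by (rule stationary_drift_bound(2)[OF stationary finite_kernel _ _ b drift]) auto
qed

end

section \<open>Positivity of the service rates\<close>

context stationary_jsq
begin

text \<open>The joint law of the queue lengths, the route and the input in one slot of the stationary system.\<close>

definition slot :: "(('n \<Rightarrow> nat) \<times> 'n \<times> nat \<times> ('n \<Rightarrow> nat)) pmf" where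
  "slot = bind_pmf \<pi> (\<lambda>x. bind_pmf (pmf_of_set (shortest_queues x)) (\<lambda>i. map_pmf (\<lambda>w. (x, i, w)) \<nu>))"

lemma set_slot: "(x, i, w) \<in> set_pmf slot \<longleftrightarrow> x \<in> set_pmf \<pi> \<and> i \<in> shortest_queues x \<and> w \<in> set_pmf \<nu>"
  unfolding slot_def by (auto simp: shortest_queues_nonempty)

lemma map_slot_before: "map_pmf (\<lambda>(x, i, w). x) slot = \<pi>"
  by (simp add: slot_def map_bind_pmf map_pmf_comp bind_return_pmf')

lemma map_slot_after: "map_pmf (\<lambda>(x, i, w). jsq_next x i w) slot = \<pi>"
  using stationary by (simp add: slot_def map_bind_pmf map_pmf_comp jsq_kernel_def[abs_def])

lemma map_slot_input: "map_pmf (\<lambda>(x, i, w). (x, w)) slot = pair_pmf \<pi> \<nu>"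
  by (simp add: slot_def map_bind_pmf map_pmf_comp) (simp add: pair_pmf_def map_pmf_def)

lemma expectation_slot_after:
  "measure_pmf.expectation slot (\<lambda>(x, i, w). f (jsq_next x i w)) = (measure_pmf.expectation \<pi> f :: real)"
  by (subst map_slot_after[symmetric]) (simp add: split_def)

lemma integrable_slot_after:
  "integrable (measure_pmf slot) (\<lambda>(x, i, w). f (jsq_next x i w)) \<longleftrightarrow> integrable (measure_pmf \<pi>) (f :: _ \<Rightarrow> real)"
  by (subst (2) map_slot_after[symmetric]) (simp add: split_def)

lemma expectation_slot_product:
  fixes f :: "('n \<Rightarrow> nat) \<Rightarrow> real" and h :: "nat \<times> ('n \<Rightarrow> nat) \<Rightarrow> real"
  assumes f: "\<And>x. \<bar>f x\<bar> \<le> A"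
  shows "measure_pmf.expectation slot (\<lambda>(x, i, w). f x * h w) = measure_pmf.expectation \<pi> f * measure_pmf.expectation \<nu> h"
proof -
  obtain B where B: "\<And>w. w \<in> set_pmf \<nu> \<Longrightarrow> \<bar>h w\<bar> \<le> B"
  proof
    show "\<bar>h w\<bar> \<le> Max ((\<lambda>w. \<bar>h w\<bar>) ` set_pmf \<nu>)" if "w \<in> set_pmf \<nu>" for w
      using finite_input that by (intro Max_ge) auto
  qed
  have "measure_pmf.expectation slot (\<lambda>(x, i, w). f x * h w)
      = measure_pmf.expectation (pair_pmf \<pi> \<nu>) (\<lambda>(x, w). f x * h w)"
    by (subst map_slot_input[symmetric]) (simp add: split_def)
  also have "\<dots> = measure_pmf.expectation \<pi> (\<lambda>x. measure_pmf.expectation (map_pmf (Pair x) \<nu>) (\<lambda>(x, w). f x * h w))"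
    unfolding pair_pmf_def map_pmf_def[symmetric]
  proof (rule expectation_bind_pmf_bounded_on)
    fix x :: "'n \<Rightarrow> nat" and y assume "y \<in> set_pmf (map_pmf (Pair x) \<nu>)"
    then obtain w where w: "y = (x, w)" "w \<in> set_pmf \<nu>" by auto
    show "\<bar>case y of (x, w) \<Rightarrow> f x * h w\<bar> \<le> A * B"
      using f[of x] B[OF w(2)] by (auto simp: w abs_mult intro!: mult_mono)
  qed
  finally show ?thesis by simp
qed

lemma jsq_next_in_support:
  assumes "x \<in> set_pmf \<pi>" "i \<in> shortest_queues x" "w \<in> set_pmf \<nu>"
  shows "jsq_next x i w \<in> set_pmf \<pi>"
proof -
  have "(x, i, w) \<in> set_pmf slot" using assms by (simp add: set_slot)
  then have "jsq_next x i w \<in> set_pmf (map_pmf (\<lambda>(x, i, w). jsq_next x i w) slot)" by force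
  then show ?thesis by (simp only: map_slot_after)
qed

text \<open>The length of \<open>i\<^sub>0\<close> never decreases, and by stationarity its mean increment is 0, so almost surely it
  does not change. A slot in which \<open>i\<^sub>0\<close> is a shortest queue would have a positive chance of an arrival there.\<close>

lemma unserved_queue_not_shortest:
  assumes unserved: "\<And>w. w \<in> set_pmf \<nu> \<Longrightarrow> snd w i\<^sub>0 = 0"
    and w: "w \<in> set_pmf \<nu>" "fst w > 0" and x: "x \<in> set_pmf \<pi>"
  shows "i\<^sub>0 \<notin> shortest_queues x"
proof
  assume i: "i\<^sub>0 \<in> shortest_queues x"
  let ?X = "\<lambda>(x, i, w). real (x i\<^sub>0)" and ?Y = "\<lambda>(x, i, w). real (jsq_next x i w i\<^sub>0)"
  have bd: "\<bar>?Y t - ?X t\<bar> \<le> real L" if "t \<in> set_pmf slot" for t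
  proof -
    obtain x i w where [simp]: "t = (x, i, w)" by (cases t)
    have w: "w \<in> set_pmf \<nu>" using that by (simp add: set_slot)
    show ?thesis using jsq_next_increment_le[OF arrivals_le[OF w] services_le[OF w]] by simp
  qed
  have nonneg: "0 \<le> ?Y t - ?X t" if "t \<in> set_pmf slot" for t
  proof -
    obtain x i w where [simp]: "t = (x, i, w)" by (cases t)
    have w: "w \<in> set_pmf \<nu>" using that by (simp add: set_slot)
    show ?thesis using unserved[OF w] by (simp add: jsq_next_def)
  qed
  have "map_pmf ?X slot = map_pmf (\<lambda>x. real (x i\<^sub>0)) (map_pmf (\<lambda>(x, i, w). x) slot)"
    by (simp add: map_pmf_comp split_def)
  also have "\<dots> = map_pmf (\<lambda>x. real (x i\<^sub>0)) (map_pmf (\<lambda>(x, i, w). jsq_next x i w) slot)"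
    by (simp only: map_slot_before map_slot_after)
  also have "\<dots> = map_pmf ?Y slot"
    by (simp add: map_pmf_comp split_def)
  finally have "measure_pmf.expectation slot (\<lambda>t. ?Y t - ?X t) = 0"
    by (rule equidistributed_bounded_increment_mean_zero[OF _ _ _ bd]) auto
  moreover have "integrable (measure_pmf slot) (\<lambda>t. ?Y t - ?X t)"
    by (rule integrable_measure_pmf_bounded[OF bd])
  ultimately have "AE t in slot. ?Y t - ?X t = 0"
    using nonneg by (subst integral_nonneg_eq_0_iff_AE[symmetric]) (auto simp: AE_measure_pmf_iff)
  moreover have "(x, i\<^sub>0, w) \<in> set_pmf slot" using x i w by (simp add: set_slot)
  ultimately have "?Y (x, i\<^sub>0, w) - ?X (x, i\<^sub>0, w) = 0" unfolding AE_measure_pmf_iff by blast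
  then show False using w unserved[OF w(1)] by (simp add: jsq_next_def)
qed

text \<open>Suppose \<open>i\<^sub>0\<close> is never served and repeat the input \<open>w\<close>. The states stay in the support of the invariant
  law, so \<open>i\<^sub>0\<close> stays constant and never gets arrivals; every arrival therefore goes to a queue that is no
  longer than \<open>i\<^sub>0\<close>, which bounds all queues. Yet the total grows by at least one job per slot.\<close>

lemma every_queue_served:
  assumes w: "w \<in> set_pmf \<nu>" and growth: "0 < total_input w"
  shows "\<exists>w\<in>set_pmf \<nu>. snd w i\<^sub>0 \<noteq> 0"
proof (rule ccontr)
  assume "\<not> ?thesis"
  then have unserved: "\<And>w. w \<in> set_pmf \<nu> \<Longrightarrow> snd w i\<^sub>0 = 0" by auto
  have "0 \<le> (\<Sum>j\<in>UNIV. real (snd w j))" by (simp add: sum_nonneg)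
  then have a: "fst w > 0" using growth by (simp add: total_input_def)
  have avoid: "i\<^sub>0 \<notin> shortest_queues x" if "x \<in> set_pmf \<pi>" for x
    using unserved_queue_not_shortest[OF _ w a that] unserved by blast
  obtain x\<^sub>0 where x0: "x\<^sub>0 \<in> set_pmf \<pi>" using set_pmf_not_empty[of \<pi>] by blast
  \<comment> \<open>A queue only receives \<open>fst w\<close> jobs while it is no longer than \<open>i\<^sub>0\<close>, so it never exceeds this level.\<close>
  define c where "c j = max (x\<^sub>0 j) (x\<^sub>0 i\<^sub>0 + fst w)" for j
  have "\<exists>x\<in>set_pmf \<pi>. x i\<^sub>0 = x\<^sub>0 i\<^sub>0 \<and> (\<forall>j. x j \<le> c j) \<and> real k \<le> (\<Sum>j\<in>UNIV. real (x j))" for k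
  proof (induction k)
    case 0
    show ?case using x0 by (intro bexI[of _ x\<^sub>0]) (auto simp: c_def sum_nonneg)
  next
    case (Suc k)
    then obtain x where x: "x \<in> set_pmf \<pi>" "x i\<^sub>0 = x\<^sub>0 i\<^sub>0" "\<And>j. x j \<le> c j" "real k \<le> (\<Sum>j\<in>UNIV. real (x j))"
      by auto
    obtain i where i: "i \<in> shortest_queues x" using ex_shortest_queue .
    have "i \<noteq> i\<^sub>0" using avoid[OF x(1)] i by auto
    have "x i \<le> x i\<^sub>0" using i by (auto simp: shortest_queues_def)
    let ?y = "jsq_next x i w"
    have "?y i\<^sub>0 = x\<^sub>0 i\<^sub>0" using \<open>i \<noteq> i\<^sub>0\<close> unserved[OF w] x(2) by (simp add: jsq_next_def)
    moreover have "?y j \<le> c j" for j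
      using x(3)[of j] \<open>x i \<le> x i\<^sub>0\<close> x(2) by (auto simp: jsq_next_def c_def)
    moreover have "real (Suc k) \<le> (\<Sum>j\<in>UNIV. real (?y j))"
    proof -
      have "(\<Sum>j\<in>UNIV. real (?y j)) = (\<Sum>j\<in>UNIV. real (x j)) + total_input w + (\<Sum>j\<in>UNIV. unused_service x i w j)"
        by (simp add: jsq_next_decomp sum.distrib sum_net_input)
      moreover have "0 \<le> (\<Sum>j\<in>UNIV. unused_service x i w j)" by (simp add: sum_nonneg unused_service_nonneg)
      moreover have "1 \<le> total_input w"
      proof -
        have "total_input w = real_of_int (int (fst w) - (\<Sum>j\<in>UNIV. int (snd w j)))" by (simp add: total_input_def)
        then show ?thesis using growth by (metis of_int_0_less_iff of_int_1_le_iff zless_imp_add1_zle add_0)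
      qed
      ultimately show ?thesis using x(4) by simp
    qed
    ultimately show ?case using jsq_next_in_support[OF x(1) i w] by blast
  qed
  from this[of "Suc (\<Sum>j\<in>UNIV. c j)"] obtain x where
    x: "\<And>j. x j \<le> c j" "real (Suc (\<Sum>j\<in>UNIV. c j)) \<le> (\<Sum>j\<in>UNIV. real (x j))" by auto
  have "(\<Sum>j\<in>UNIV. real (x j)) \<le> (\<Sum>j\<in>UNIV. real (c j))" using x(1) by (intro sum_mono) simp
  then show False using x(2) by simp
qed

end

section \<open>The Laplace transform of the total queue length\<close>

definition total_unused :: "('n::finite \<Rightarrow> nat) \<Rightarrow> 'n \<Rightarrow> nat \<times> ('n \<Rightarrow> nat) \<Rightarrow> real" where
  "total_unused x i w = (\<Sum>j\<in>UNIV. unused_service x i w j)"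

definition total_queue :: "('n::finite \<Rightarrow> nat) \<Rightarrow> real" where
  "total_queue x = (\<Sum>j\<in>UNIV. real (x j))"

lemma total_jsq_next: "total_queue (jsq_next x i w) = total_queue x + total_input w + total_unused x i w"
  by (simp add: total_queue_def jsq_next_decomp sum.distrib sum_net_input total_unused_def)

lemma total_nonneg: "0 \<le> total_queue x" by (simp add: total_queue_def sum_nonneg)

text \<open>Wasted service leaves an empty queue, and then the total length is the excess over the shortest
  queue.\<close>

lemma unused_total_le: "total_unused x i w * total_queue (jsq_next x i w) \<le> total_unused x i w * imbalance (jsq_next x i w)"
proof (cases "total_unused x i w = 0")
  case False
  then obtain j where "unused_service x i w j \<noteq> 0"
    unfolding total_unused_def by (meson sum.not_neutral_contains_not_neutral)
  then have "jsq_next x i w j = 0" using unused_service_complementary[of x i w j] by auto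
  then have "shortest_length (jsq_next x i w) = 0" using shortest_length_le[of "jsq_next x i w" j] by simp
  then have "total_queue (jsq_next x i w) = imbalance (jsq_next x i w)" by (simp add: total_queue_def imbalance_def)
  then show ?thesis by simp
qed simp

lemma exp_second_order:
  fixes y :: real
  assumes "\<bar>y\<bar> \<le> 1"
  shows "\<bar>exp (- y) - (1 - y + y\<^sup>2 / 2)\<bar> \<le> 2 * \<bar>y\<bar> ^ 3"
proof -
  have "norm (exp (- y) - (\<Sum>i\<le>2. (- y) ^ i / fact i)) \<le> exp (norm (- y)) * (norm (- y) ^ Suc 2) / fact 2"
    by (rule Taylor_exp_field)
  also have "exp (norm (- y)) \<le> 3"
    using exp_le assms by (smt (verit) exp_le_cancel_iff norm_minus_cancel real_norm_def)
  then have "exp (norm (- y)) * (norm (- y) ^ Suc 2) / fact 2 \<le> 3 * (norm (- y) ^ Suc 2) / fact 2"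
    by (intro divide_right_mono mult_right_mono) auto
  finally have "\<bar>exp (- y) - (\<Sum>i\<le>2. (- y) ^ i / fact i)\<bar> \<le> 3 * \<bar>y\<bar> ^ 3 / 2"
    by (simp add: eval_nat_numeral)
  moreover have "(\<Sum>i\<le>2. (- y) ^ i / fact i) = 1 - y + y\<^sup>2 / 2"
    by (simp add: eval_nat_numeral)
  moreover have "3 * \<bar>y\<bar> ^ 3 / 2 \<le> 2 * \<bar>y\<bar> ^ 3" by simp
  ultimately show ?thesis by linarith
qed

context stationary_jsq
begin

lemma unused_bounds:
  assumes "w \<in> set_pmf \<nu>"
  shows "0 \<le> total_unused x i w" "total_unused x i w \<le> real CARD('n) * real L"
proof -
  show "0 \<le> total_unused x i w" by (simp add: total_unused_def sum_nonneg unused_service_nonneg)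
  have "total_unused x i w \<le> (\<Sum>j\<in>(UNIV::'n set). real L)"
    unfolding total_unused_def using services_le[OF assms]
    by (intro sum_mono order_trans[OF unused_service_le]) auto
  then show "total_unused x i w \<le> real CARD('n) * real L" by simp
qed

lemma total_input_abs_le:
  assumes "w \<in> set_pmf \<nu>"
  shows "\<bar>total_input w\<bar> \<le> real CARD('n) * real L"
proof -
  have "\<bar>total_input w\<bar> \<le> (\<Sum>j\<in>(UNIV::'n set). real L)"
    unfolding sum_net_input[of undefined w, symmetric]
    by (rule order_trans[OF sum_abs], intro sum_mono net_input_abs_le arrivals_le services_le assms)
  then show ?thesis by simp
qed

text \<open>The total has mean increment 0, so the mean wasted service compensates the mean \<open>- \<epsilon>\<close> of the input.\<close>

lemma mean_unused: "measure_pmf.expectation slot (\<lambda>(x, i, w). total_unused x i w) = \<epsilon>"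
proof -
  let ?X = "\<lambda>(x :: 'n \<Rightarrow> nat, i :: 'n, w :: nat \<times> ('n \<Rightarrow> nat)). total_queue x" and ?Y = "\<lambda>(x, i, w). total_queue (jsq_next x i w)"
  have d: "?Y t - ?X t = (case t of (x, i, w) \<Rightarrow> total_input w) + (case t of (x, i, w) \<Rightarrow> total_unused x i w)" for t
    by (cases t) (simp add: total_jsq_next)
  have "map_pmf ?X slot = map_pmf total_queue (map_pmf (\<lambda>(x, i, w). x) slot)"
    by (simp add: map_pmf_comp split_def)
  also have "\<dots> = map_pmf total_queue (map_pmf (\<lambda>(x, i, w). jsq_next x i w) slot)"
    by (simp only: map_slot_before map_slot_after)
  also have "\<dots> = map_pmf ?Y slot"
    by (simp add: map_pmf_comp split_def)
  finally have "measure_pmf.expectation slot (\<lambda>t. ?Y t - ?X t) = 0"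
  proof (rule equidistributed_bounded_increment_mean_zero)
    fix t assume t: "t \<in> set_pmf slot"
    obtain x i w where [simp]: "t = (x, i, w)" by (cases t)
    have w: "w \<in> set_pmf \<nu>" using t by (simp add: set_slot)
    show "\<bar>?Y t - ?X t\<bar> \<le> 2 * (real CARD('n) * real L)"
      using total_input_abs_le[OF w] unused_bounds[OF w, of x i] by (simp add: total_jsq_next)
  qed (auto simp: total_nonneg)
  then have "measure_pmf.expectation slot (\<lambda>t. (case t of (x, i, w) \<Rightarrow> total_input w) + (case t of (x, i, w) \<Rightarrow> total_unused x i w)) = 0"
    by (simp only: d)
  moreover have "integrable slot (\<lambda>(x, i, w). total_input w)"
    by (rule integrable_measure_pmf_bounded[of _ _ "real CARD('n) * real L"]) (auto simp: set_slot total_input_abs_le)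
  moreover have "integrable slot (\<lambda>(x, i, w). total_unused x i w)"
    by (rule integrable_measure_pmf_bounded[of _ _ "real CARD('n) * real L"]) (auto simp: set_slot unused_bounds)
  moreover have "measure_pmf.expectation slot (\<lambda>(x, i, w). total_input w) = - \<epsilon>"
    using expectation_slot_product[of "\<lambda>_. 1" 1 total_input] mean_total_input by simp
  ultimately show ?thesis by simp
qed

end

context stationary_jsq
begin

text \<open>Replacing \<open>exp (- (h * total_queue y))\<close> by 1 costs \<open>h\<^sup>2 * u * total_queue y\<close>, and the total may be
  replaced by the imbalance. The free parameter \<open>\<kappa>\<close> of the inequality between the geometric and the
  arithmetic mean separates \<open>u\<close>, whose mean is \<open>\<epsilon>\<close>, from the imbalance, whose second moment
  is bounded.\<close>

lemma unused_exponential_bounds: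
  fixes h \<kappa> :: real and x :: "'n \<Rightarrow> nat" and i :: 'n
  assumes w: "w \<in> set_pmf \<nu>" and h: "0 < h" "h * (real CARD('n) * real L) \<le> 1" and \<kappa>: "\<kappa> > 0"
  defines "u \<equiv> total_unused x i w" and "y \<equiv> jsq_next x i w" and "K \<equiv> real CARD('n) * real L"
  shows "exp (- (h * total_queue y)) * (exp (h * u) - 1) \<le> h * u + h\<^sup>2 * K * u" (is ?A)
    and "h * u - h\<^sup>2 * (K * u / \<kappa> + \<kappa> * (imbalance y)\<^sup>2) / 2 \<le> exp (- (h * total_queue y)) * (exp (h * u) - 1)" (is ?B)
proof -
  have u: "0 \<le> u" "u \<le> K" using unused_bounds[OF w] by (auto simp: u_def K_def)
  have "h * u \<le> h * K" using u h by (intro mult_left_mono) auto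
  also have "h * K \<le> 1" using h(2) by (simp only: K_def)
  finally have hu: "0 \<le> h * u" "h * u \<le> 1" using u(1) h(1) by auto
  have e1: "0 \<le> exp (h * u) - 1" "h * u \<le> exp (h * u) - 1"
    using hu exp_ge_add_one_self[of "h * u"] by linarith+
  have uu: "u * u \<le> K * u" using u by (intro mult_right_mono) auto
  have T: "0 \<le> total_queue y" by (rule total_nonneg)
  have "exp (- (h * total_queue y)) * (exp (h * u) - 1) \<le> 1 * (exp (h * u) - 1)"
    using e1 h T by (intro mult_right_mono) auto
  also have "\<dots> \<le> h * u + (h * u)\<^sup>2" using exp_bound[OF hu] by simp
  also have "(h * u)\<^sup>2 \<le> h\<^sup>2 * (K * u)"
    using mult_left_mono[OF uu, of "h\<^sup>2"] by (simp add: power_mult_distrib power2_eq_square[of u])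
  finally show ?A by (simp add: mult_ac)
  have "u * total_queue y \<le> u * imbalance y" unfolding u_def y_def by (rule unused_total_le)
  also have "\<dots> \<le> (u * u / \<kappa> + \<kappa> * (imbalance y)\<^sup>2) / 2"
  proof -
    have "0 \<le> (u - \<kappa> * imbalance y)\<^sup>2 / \<kappa>" using \<kappa> by simp
    also have "\<dots> = u * u / \<kappa> - 2 * (u * imbalance y) + \<kappa> * (imbalance y)\<^sup>2"
      using \<kappa> by (simp add: power2_eq_square field_simps)
    finally show ?thesis by simp
  qed
  also have "\<dots> \<le> (K * u / \<kappa> + \<kappa> * (imbalance y)\<^sup>2) / 2"
    using uu \<kappa> by (simp add: divide_right_mono)
  finally have "h\<^sup>2 * (u * total_queue y) \<le> h\<^sup>2 * ((K * u / \<kappa> + \<kappa> * (imbalance y)\<^sup>2) / 2)"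
    by (rule mult_left_mono) simp
  moreover have "h * u - h\<^sup>2 * (u * total_queue y) = (1 - h * total_queue y) * (h * u)"
    by (simp add: power2_eq_square algebra_simps)
  moreover have "(1 - h * total_queue y) * (h * u) \<le> exp (- (h * total_queue y)) * (h * u)"
    using exp_ge_add_one_self[of "- (h * total_queue y)"] hu by (intro mult_right_mono) auto
  moreover have "exp (- (h * total_queue y)) * (h * u) \<le> exp (- (h * total_queue y)) * (exp (h * u) - 1)"
    using e1 by (intro mult_left_mono) auto
  ultimately show ?B by linarith
qed

text \<open>Stationarity of the transform of the total length. The product on the left comes from the independence of
  the queues and the input of a slot.\<close>

lemma laplace_transform_balance:
  assumes h: "0 < h"
  shows "measure_pmf.expectation \<pi> (\<lambda>x. exp (- (h * total_queue x))) * (measure_pmf.expectation \<nu> (\<lambda>w. exp (- (h * total_input w))) - 1)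
    = measure_pmf.expectation slot (\<lambda>(x, i, w). exp (- (h * total_queue (jsq_next x i w))) * (exp (h * total_unused x i w) - 1))"
    (is "?\<psi> * (?m - 1) = ?r")
    and "integrable slot (\<lambda>(x, i, w). exp (- (h * total_queue (jsq_next x i w))) * (exp (h * total_unused x i w) - 1))"
      (is "integrable slot ?R")
proof -
  let ?K = "real CARD('n) * real L"
  let ?P = "\<lambda>(x :: 'n \<Rightarrow> nat, i :: 'n, w). exp (- (h * total_queue (jsq_next x i w)))"
  have hT: "0 \<le> h * total_queue x" for x using h total_nonneg[of x] by simp
  then have le1: "exp (- (h * total_queue x)) \<le> 1" for x by simp
  show iR: "integrable slot ?R"
  proof (rule integrable_measure_pmf_bounded[of _ _ "exp (h * ?K)"])
    fix t assume t: "t \<in> set_pmf slot"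
    obtain x i w where [simp]: "t = (x, i, w)" by (cases t)
    have w: "w \<in> set_pmf \<nu>" using t by (simp add: set_slot)
    have 1: "1 \<le> exp (h * total_unused x i w)" "exp (h * total_unused x i w) \<le> exp (h * ?K)"
      using unused_bounds[OF w, of x i] h by auto
    then have "exp (- (h * total_queue (jsq_next x i w))) * (exp (h * total_unused x i w) - 1) \<le> 1 * (exp (h * total_unused x i w) - 1)"
      by (intro mult_right_mono le1) simp
    also have "\<dots> \<le> exp (h * ?K)" by (rule order_trans[OF _ 1(2)]) simp
    finally have "exp (- (h * total_queue (jsq_next x i w))) * (exp (h * total_unused x i w) - 1) \<le> exp (h * ?K)" .
    then show "\<bar>?R t\<bar> \<le> exp (h * ?K)" using 1 by (simp add: abs_mult)
  qed
  have iP: "integrable slot ?P"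
    by (rule integrable_measure_pmf_bounded[of _ _ 1]) (auto simp: hT)
  have "?\<psi> * ?m = measure_pmf.expectation slot (\<lambda>(x, i, w). exp (- (h * total_queue x)) * exp (- (h * total_input w)))"
    by (rule expectation_slot_product[symmetric, of _ 1]) (simp add: hT)
  also have "\<dots> = measure_pmf.expectation slot (\<lambda>t. ?P t + ?R t)"
    by (intro Bochner_Integration.integral_cong)
      (auto simp: exp_add[symmetric] right_diff_distrib total_jsq_next algebra_simps)
  also have "\<dots> = measure_pmf.expectation slot ?P + ?r" using iP iR by simp
  also have "measure_pmf.expectation slot ?P = ?\<psi>"
    by (rule expectation_slot_after)
  finally show "?\<psi> * (?m - 1) = ?r" by (simp add: algebra_simps)
qed

lemma laplace_transform_input:
  assumes h: "0 < h" "h * (real CARD('n) * real L) \<le> 1"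
  shows "\<bar>measure_pmf.expectation \<nu> (\<lambda>w. exp (- (h * total_input w))) - 1
      - (h * \<epsilon> + h\<^sup>2 * measure_pmf.expectation \<nu> (\<lambda>w. (total_input w)\<^sup>2) / 2)\<bar>
    \<le> 2 * (h * (real CARD('n) * real L)) ^ 3"
proof -
  let ?K = "real CARD('n) * real L" and ?E = "measure_pmf.expectation \<nu>"
  let ?e = "\<lambda>w. exp (- (h * total_input w)) - (1 - h * total_input w + (h * total_input w)\<^sup>2 / 2)"
  have "?E ?e = ?E (\<lambda>w. exp (- (h * total_input w))) - (1 - h * ?E total_input + h\<^sup>2 * ?E (\<lambda>w. (total_input w)\<^sup>2) / 2)"
    by (simp add: power_mult_distrib)
  moreover have "\<bar>?E ?e\<bar> \<le> 2 * (h * ?K) ^ 3"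
  proof -
    have "\<bar>?E ?e\<bar> \<le> ?E (\<lambda>w. \<bar>?e w\<bar>)" by (rule integral_abs_bound)
    also have "\<dots> \<le> 2 * (h * ?K) ^ 3"
    proof (rule measure_pmf.integral_le_const)
      show "AE w in \<nu>. \<bar>?e w\<bar> \<le> 2 * (h * ?K) ^ 3"
        unfolding AE_measure_pmf_iff
      proof
        fix w assume w: "w \<in> set_pmf \<nu>"
        have le: "\<bar>h * total_input w\<bar> \<le> h * ?K"
          using total_input_abs_le[OF w] h(1) by (simp add: abs_mult)
        then have "\<bar>?e w\<bar> \<le> 2 * \<bar>h * total_input w\<bar> ^ 3"
          using h(2) by (intro exp_second_order) linarith
        also have "\<dots> \<le> 2 * (h * ?K) ^ 3"
          using le by (intro mult_left_mono power_mono) auto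
        finally show "\<bar>?e w\<bar> \<le> 2 * (h * ?K) ^ 3" .
      qed
    qed simp
    finally show ?thesis .
  qed
  ultimately show ?thesis by (simp add: mean_total_input algebra_simps)
qed

text \<open>The choice \<open>\<kappa> = sqrt \<epsilon>\<close> balances the two contributions to the effect of wasted service, both of
  relative order \<open>sqrt \<epsilon>\<close>.\<close>

lemma laplace_transform_estimate:
  assumes \<epsilon>: "\<epsilon> > 0" and \<delta>: "\<delta> > 0"
    and rate: "\<And>j. \<delta> \<le> measure_pmf.expectation \<nu> (\<lambda>w. real (snd w j)) - \<epsilon> / real CARD('n)"
    and \<theta>: "0 < \<theta>" "\<theta> * \<epsilon> * (real CARD('n) * real L) \<le> 1"
  defines "K \<equiv> real CARD('n) * real L" and "C \<equiv> imbalance_bound CARD('n) L \<delta>"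
    and "v \<equiv> measure_pmf.expectation \<nu> (\<lambda>w. (total_input w)\<^sup>2)"
    and "\<psi> \<equiv> measure_pmf.expectation \<pi> (\<lambda>x. exp (- (\<theta> * \<epsilon> * total_queue x)))"
  shows "\<bar>\<psi> * (\<theta> + \<theta>\<^sup>2 * v / 2) - \<theta>\<bar> \<le> 2 * \<epsilon> * (\<theta> * K) ^ 3 + \<theta>\<^sup>2 * (K * \<epsilon> + sqrt \<epsilon> * (K + C) / 2)"
proof -
  define h where "h = \<theta> * \<epsilon>"
  have h: "0 < h" "h * K \<le> 1" using \<theta> \<epsilon> by (auto simp: h_def K_def)
  define \<kappa> where "\<kappa> = sqrt \<epsilon>"
  have \<kappa>: "\<kappa> > 0" "\<epsilon> / \<kappa> = \<kappa>" using \<epsilon> by (auto simp: \<kappa>_def real_div_sqrt)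
  let ?E = "measure_pmf.expectation slot"
  let ?R = "\<lambda>(x, i, w). exp (- (h * total_queue (jsq_next x i w))) * (exp (h * total_unused x i w) - 1)"
  let ?u = "\<lambda>(x, i, w). total_unused x i w" and ?g = "\<lambda>(x, i, w). (imbalance (jsq_next x i w))\<^sup>2"
  note bal = laplace_transform_balance[OF h(1)]
  have iu: "integrable slot ?u"
    by (rule integrable_measure_pmf_bounded[of _ _ K]) (auto simp: set_slot unused_bounds K_def)
  have ig: "integrable slot ?g"
    using imbalance_second_moment(1)[OF \<delta> rate] integrable_slot_after[of "\<lambda>x. (imbalance x)\<^sup>2"] by blast
  have Eg: "?E ?g \<le> C"
    using imbalance_second_moment(2)[OF \<delta> rate] expectation_slot_after[of "\<lambda>x. (imbalance x)\<^sup>2"]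
    unfolding C_def by simp
  have "?E ?R \<le> ?E (\<lambda>t. h * ?u t + h\<^sup>2 * K * ?u t)"
  proof (rule integral_mono_AE[OF bal(2)])
    show "AE t in slot. ?R t \<le> h * ?u t + h\<^sup>2 * K * ?u t"
      using unused_exponential_bounds(1)[OF _ h[unfolded K_def] \<kappa>(1)]
      by (auto simp: AE_measure_pmf_iff set_slot K_def)
  qed (use iu in auto)
  also have "\<dots> = h * \<epsilon> + h\<^sup>2 * (K * \<epsilon>)" using iu mean_unused by simp
  finally have up: "?E ?R - h * \<epsilon> \<le> h\<^sup>2 * (K * \<epsilon>)" by simp
  have "h * \<epsilon> - h\<^sup>2 * (K * \<epsilon> / \<kappa> + \<kappa> * ?E ?g) / 2
      = ?E (\<lambda>t. h * ?u t - h\<^sup>2 * (K * ?u t / \<kappa> + \<kappa> * ?g t) / 2)"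
    using iu ig mean_unused by simp
  also have "\<dots> \<le> ?E ?R"
  proof (rule integral_mono_AE[OF _ bal(2)])
    show "AE t in slot. h * ?u t - h\<^sup>2 * (K * ?u t / \<kappa> + \<kappa> * ?g t) / 2 \<le> ?R t"
      using unused_exponential_bounds(2)[OF _ h[unfolded K_def] \<kappa>(1)]
      by (auto simp: AE_measure_pmf_iff set_slot K_def)
  qed (use iu ig in auto)
  finally have "h * \<epsilon> - ?E ?R \<le> h\<^sup>2 * (K * \<kappa> + \<kappa> * ?E ?g) / 2"
    using \<kappa>(2) by (simp add: mult.assoc flip: times_divide_eq_right)
  also have "\<dots> \<le> h\<^sup>2 * (K * \<kappa> + \<kappa> * C) / 2"
    using Eg \<kappa> by (intro divide_right_mono mult_left_mono add_left_mono) auto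
  finally have lo: "h * \<epsilon> - ?E ?R \<le> h\<^sup>2 * (\<kappa> * (K + C) / 2)" by (simp add: algebra_simps)
  have C0: "0 \<le> C" using \<delta> by (simp add: C_def imbalance_bound_def Let_def)
  have K0: "0 \<le> K" by (simp add: K_def)
  have nn: "0 \<le> h\<^sup>2 * (K * \<epsilon>)" "0 \<le> h\<^sup>2 * (\<kappa> * (K + C) / 2)"
    using C0 K0 \<kappa> \<epsilon> by auto
  have r: "\<bar>?E ?R - h * \<epsilon>\<bar> \<le> h\<^sup>2 * (K * \<epsilon>) + h\<^sup>2 * (\<kappa> * (K + C) / 2)"
    using up lo nn by linarith
  have \<psi>: "\<psi> = measure_pmf.expectation \<pi> (\<lambda>x. exp (- (h * total_queue x)))" by (simp add: \<psi>_def h_def)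
  have hT: "0 \<le> h * total_queue x" for x using h(1) total_nonneg[of x] by simp
  have \<psi>01: "0 \<le> \<psi>" "\<psi> \<le> 1"
    unfolding \<psi> using hT
    by (auto intro!: AE_pmfI integral_nonneg_AE measure_pmf.integral_le_const integrable_measure_pmf_bounded[of _ _ 1])
  define m where "m = measure_pmf.expectation \<nu> (\<lambda>w. exp (- (h * total_input w)))"
  have m: "\<bar>m - 1 - (h * \<epsilon> + h\<^sup>2 * v / 2)\<bar> \<le> 2 * (h * K) ^ 3"
    using laplace_transform_input[OF h[unfolded K_def]] by (simp add: m_def v_def K_def)
  have "\<bar>\<psi> * (m - 1 - (h * \<epsilon> + h\<^sup>2 * v / 2))\<bar> \<le> 1 * (2 * (h * K) ^ 3)"
    unfolding abs_mult using m \<psi>01 by (intro mult_mono) auto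
  moreover have "\<psi> * (m - 1) = ?E ?R" using bal(1) by (simp add: \<psi> m_def)
  moreover have "\<psi> * (m - 1 - (h * \<epsilon> + h\<^sup>2 * v / 2)) = \<psi> * (m - 1) - \<psi> * (h * \<epsilon> + h\<^sup>2 * v / 2)"
    by (simp add: algebra_simps)
  ultimately have "\<bar>\<psi> * (h * \<epsilon> + h\<^sup>2 * v / 2) - h * \<epsilon>\<bar>
      \<le> 2 * (h * K) ^ 3 + (h\<^sup>2 * (K * \<epsilon>) + h\<^sup>2 * (\<kappa> * (K + C) / 2))"
    using r by linarith
  also have "\<psi> * (h * \<epsilon> + h\<^sup>2 * v / 2) - h * \<epsilon> = \<epsilon>\<^sup>2 * (\<psi> * (\<theta> + \<theta>\<^sup>2 * v / 2) - \<theta>)"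
    by (simp add: h_def power2_eq_square algebra_simps)
  also have "2 * (h * K) ^ 3 + (h\<^sup>2 * (K * \<epsilon>) + h\<^sup>2 * (\<kappa> * (K + C) / 2))
      = \<epsilon>\<^sup>2 * (2 * \<epsilon> * (\<theta> * K) ^ 3 + \<theta>\<^sup>2 * (K * \<epsilon> + sqrt \<epsilon> * (K + C) / 2))"
    by (simp add: h_def \<kappa>_def power2_eq_square power3_eq_cube algebra_simps)
  finally show ?thesis using \<epsilon> by (simp add: abs_mult)
qed

end

section \<open>Heavy traffic limit of invariant laws\<close>

lemma real_vec_nth [simp]: "real_vec x $ i = real (x i)"
  by (simp add: real_vec_def)

lemma laplace_transform_limit:
  fixes \<pi> :: "real \<Rightarrow> ('n::finite \<Rightarrow> nat) pmf" and \<delta> \<theta> V :: real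
  assumes stat: "\<forall>\<^sub>F \<epsilon> in at_right 0. stationary_jsq (\<pi> \<epsilon>) (\<nu> \<epsilon>) \<epsilon> L"
    and \<delta>: "\<delta> > 0"
    and rate: "\<forall>\<^sub>F \<epsilon> in at_right 0. \<forall>j. \<delta> \<le> measure_pmf.expectation (\<nu> \<epsilon>) (\<lambda>w. real (snd w j)) - \<epsilon> / real CARD('n)"
    and v: "((\<lambda>\<epsilon>. measure_pmf.expectation (\<nu> \<epsilon>) (\<lambda>w. (total_input w)\<^sup>2)) \<longlongrightarrow> V) (at_right 0)" and V: "0 \<le> V"
    and \<theta>: "0 \<le> \<theta>"
  shows "((\<lambda>\<epsilon>. measure_pmf.expectation (\<pi> \<epsilon>) (\<lambda>x. exp (- (\<theta> * \<epsilon> * total_queue x)))) \<longlongrightarrow> 1 / (1 + \<theta> * V / 2)) (at_right 0)"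
proof (cases "\<theta> = 0")
  case False
  with \<theta> have \<theta>: "0 < \<theta>" by simp
  define K where "K = real CARD('n) * real L"
  define C where "C = imbalance_bound CARD('n) L \<delta>"
  define err where "err \<epsilon> = 2 * \<epsilon> * (\<theta> * K) ^ 3 + \<theta>\<^sup>2 * (K * \<epsilon> + sqrt \<epsilon> * (K + C) / 2)" for \<epsilon> :: real
  define \<psi> where "\<psi> \<epsilon> = measure_pmf.expectation (\<pi> \<epsilon>) (\<lambda>x. exp (- (\<theta> * \<epsilon> * total_queue x)))" for \<epsilon>
  define D where "D \<epsilon> = \<theta> + \<theta>\<^sup>2 * measure_pmf.expectation (\<nu> \<epsilon>) (\<lambda>w. (total_input w)\<^sup>2) / 2" for \<epsilon>
  have "(err \<longlongrightarrow> 2 * 0 * (\<theta> * K) ^ 3 + \<theta>\<^sup>2 * (K * 0 + sqrt 0 * (K + C) / 2)) (at_right 0)"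
    unfolding err_def by (intro tendsto_intros) simp
  then have err0: "(err \<longlongrightarrow> 0) (at_right 0)" by simp
  have D: "(D \<longlongrightarrow> \<theta> + \<theta>\<^sup>2 * V / 2) (at_right 0)"
    using tendsto_add[OF tendsto_const tendsto_mult[OF tendsto_const v], of \<theta> "\<theta>\<^sup>2 / 2"]
    by (simp add: D_def[abs_def])
  have D0: "\<theta> + \<theta>\<^sup>2 * V / 2 > 0" using \<theta> V by (simp add: add_pos_nonneg)
  have small: "\<forall>\<^sub>F \<epsilon> in at_right 0. \<theta> * \<epsilon> * K \<le> 1"
  proof -
    have "((\<lambda>\<epsilon>. \<theta> * \<epsilon> * K) \<longlongrightarrow> \<theta> * 0 * K) (at_right 0)" by (intro tendsto_intros)
    then have "\<forall>\<^sub>F \<epsilon> in at_right 0. \<theta> * \<epsilon> * K < 1" by (rule order_tendstoD) simp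
    then show ?thesis by (rule eventually_mono) simp
  qed
  have "\<forall>\<^sub>F \<epsilon> in at_right 0. norm (\<psi> \<epsilon> * D \<epsilon> - \<theta>) \<le> err \<epsilon>"
    using stat rate small eventually_at_right_less[of 0]
  proof eventually_elim
    case (elim \<epsilon>)
    interpret stationary_jsq "\<pi> \<epsilon>" "\<nu> \<epsilon>" \<epsilon> L by (rule elim)
    show ?case
      unfolding real_norm_def \<psi>_def D_def err_def K_def C_def
      by (rule laplace_transform_estimate) (use elim \<delta> \<theta> in \<open>auto simp: K_def\<close>)
  qed
  then have "((\<lambda>\<epsilon>. \<psi> \<epsilon> * D \<epsilon> - \<theta>) \<longlongrightarrow> 0) (at_right 0)"
    using err0 by (rule Lim_null_comparison)
  then have "((\<lambda>\<epsilon>. \<psi> \<epsilon> * D \<epsilon>) \<longlongrightarrow> \<theta>) (at_right 0)" by (simp add: LIM_zero_iff)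
  then have "((\<lambda>\<epsilon>. \<psi> \<epsilon> * D \<epsilon> / D \<epsilon>) \<longlongrightarrow> \<theta> / (\<theta> + \<theta>\<^sup>2 * V / 2)) (at_right 0)"
    using D D0 by (intro tendsto_divide) auto
  moreover have "\<forall>\<^sub>F \<epsilon> in at_right 0. \<psi> \<epsilon> * D \<epsilon> / D \<epsilon> = \<psi> \<epsilon>"
    using order_tendstoD(1)[OF D D0] by eventually_elim simp
  ultimately have "(\<psi> \<longlongrightarrow> \<theta> / (\<theta> + \<theta>\<^sup>2 * V / 2)) (at_right 0)"
    by (rule Lim_transform_eventually)
  moreover have "\<theta> + \<theta>\<^sup>2 * V / 2 = \<theta> * (1 + \<theta> * V / 2)" by (simp add: power2_eq_square algebra_simps)
  ultimately show ?thesis using \<theta> by (simp add: \<psi>_def[abs_def])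
qed simp

lemma dist_diagonal_le_imbalance:
  fixes x :: "'n::finite \<Rightarrow> nat"
  shows "dist (real_vec x) ((total_queue x / real CARD('n)) *\<^sub>R (\<chi> i. 1)) \<le> real CARD('n) * imbalance x"
proof -
  let ?n = "real CARD('n)" and ?m = "real (shortest_length x)"
  have m: "?n * ?m \<le> total_queue x" "total_queue x - ?n * ?m = imbalance x"
    using imbalance_nonneg[of x] by (auto simp: imbalance_def total_queue_def sum_subtractf)
  have "imbalance x \<le> ?n * imbalance x"
    using mult_right_mono[of 1 ?n "imbalance x"] imbalance_nonneg[of x] by (simp add: Suc_leI)
  then have avg: "?m \<le> total_queue x / ?n" "total_queue x / ?n \<le> ?m + imbalance x"
    using m by (auto simp: field_simps)
  have "norm (real_vec x - (total_queue x / ?n) *\<^sub>R (\<chi> i. 1))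
      \<le> (\<Sum>i\<in>UNIV. \<bar>(real_vec x - (total_queue x / ?n) *\<^sub>R (\<chi> i. 1)) $ i\<bar>)"
    by (rule norm_le_l1_cart)
  also have "\<dots> \<le> (\<Sum>i\<in>(UNIV :: 'n set). imbalance x)"
  proof (rule sum_mono)
    fix i
    have "\<bar>real (x i) - total_queue x / ?n\<bar> \<le> imbalance x"
      using avg shortest_length_le[of x i] imbalance_ge[of x i] by linarith
    then show "\<bar>(real_vec x - (total_queue x / ?n) *\<^sub>R (\<chi> i. 1)) $ i\<bar> \<le> imbalance x" by simp
  qed
  finally show ?thesis by (simp add: dist_norm)
qed

text \<open>Markov's inequality for the second moment of the imbalance, which is bounded while the space scale
  \<open>1 / \<epsilon>\<close> grows.\<close>

lemma state_space_collapse: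
  fixes \<pi> :: "real \<Rightarrow> ('n::finite \<Rightarrow> nat) pmf"
  assumes stat: "\<forall>\<^sub>F \<epsilon> in at_right 0. stationary_jsq (\<pi> \<epsilon>) (\<nu> \<epsilon>) \<epsilon> L"
    and \<delta>: "\<delta> > 0"
    and rate: "\<forall>\<^sub>F \<epsilon> in at_right 0. \<forall>j. \<delta> \<le> measure_pmf.expectation (\<nu> \<epsilon>) (\<lambda>w. real (snd w j)) - \<epsilon> / real CARD('n)"
    and r: "r > 0"
  shows "((\<lambda>\<epsilon>. measure (\<pi> \<epsilon>) {x. r \<le> dist (\<epsilon> *\<^sub>R real_vec x) ((\<epsilon> * total_queue x / real CARD('n)) *\<^sub>R (\<chi> i. 1))}) \<longlongrightarrow> 0) (at_right 0)"
proof (rule Lim_null_comparison)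
  let ?n = "real CARD('n)" and ?C = "imbalance_bound CARD('n) L \<delta>"
  let ?A = "\<lambda>\<epsilon>. {x :: 'n \<Rightarrow> nat. r \<le> dist (\<epsilon> *\<^sub>R real_vec x) ((\<epsilon> * total_queue x / ?n) *\<^sub>R (\<chi> i. 1))}"
  have "((\<lambda>\<epsilon>. (\<epsilon> * ?n / r)\<^sup>2 * ?C) \<longlongrightarrow> (0 * ?n / r)\<^sup>2 * ?C) (at_right 0)"
    using r by (intro tendsto_intros) auto
  then show "((\<lambda>\<epsilon>. (\<epsilon> * ?n / r)\<^sup>2 * ?C) \<longlongrightarrow> 0) (at_right 0)" by simp
  show "\<forall>\<^sub>F \<epsilon> in at_right 0. norm (measure (\<pi> \<epsilon>) (?A \<epsilon>)) \<le> (\<epsilon> * ?n / r)\<^sup>2 * ?C"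
    using stat rate eventually_at_right_less[of 0]
  proof eventually_elim
    case (elim \<epsilon>)
    interpret stationary_jsq "\<pi> \<epsilon>" "\<nu> \<epsilon>" \<epsilon> L by (rule elim)
    have rate': "\<And>j. \<delta> \<le> measure_pmf.expectation (\<nu> \<epsilon>) (\<lambda>w. real (snd w j)) - \<epsilon> / ?n" using elim by blast
    note mom = imbalance_second_moment[OF \<delta> rate']
    have pointwise: "indicator (?A \<epsilon>) x \<le> (\<epsilon> * ?n / r)\<^sup>2 * (imbalance x)\<^sup>2" for x
    proof (cases "x \<in> ?A \<epsilon>")
      case True
      have "r \<le> dist (\<epsilon> *\<^sub>R real_vec x) (\<epsilon> *\<^sub>R (total_queue x / ?n) *\<^sub>R (\<chi> i. 1))" using True by simp
      also have "\<dots> = \<epsilon> * dist (real_vec x) ((total_queue x / ?n) *\<^sub>R (\<chi> i. 1))"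
        unfolding dist_norm scaleR_diff_right[symmetric] norm_scaleR using elim by simp
      also have "\<dots> \<le> \<epsilon> * (?n * imbalance x)"
        using elim dist_diagonal_le_imbalance[of x] by (intro mult_left_mono) auto
      finally have "1 \<le> \<epsilon> * ?n / r * imbalance x" using r by (simp add: field_simps)
      then have "1\<^sup>2 \<le> (\<epsilon> * ?n / r * imbalance x)\<^sup>2" by (rule power_mono) simp
      then show ?thesis using True by (simp only: power_mult_distrib) simp
    qed simp
    have "measure (\<pi> \<epsilon>) (?A \<epsilon>) = measure_pmf.expectation (\<pi> \<epsilon>) (indicator (?A \<epsilon>))" by simp
    also have "\<dots> \<le> measure_pmf.expectation (\<pi> \<epsilon>) (\<lambda>x. (\<epsilon> * ?n / r)\<^sup>2 * (imbalance x)\<^sup>2)"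
    proof (rule integral_mono[OF _ _ pointwise])
      show "integrable (measure_pmf (\<pi> \<epsilon>)) (indicator (?A \<epsilon>) :: _ \<Rightarrow> real)"
        by (rule integrable_measure_pmf_bounded[of _ _ 1]) auto
    qed (use mom(1) in simp)
    also have "\<dots> \<le> (\<epsilon> * ?n / r)\<^sup>2 * ?C"
      using mom by (simp add: mult_left_mono)
    finally show ?case by simp
  qed
qed

lemma norm_diagonal_ge: "\<bar>y\<bar> \<le> norm (y *\<^sub>R (\<chi> i. 1) :: real ^ 'n)"
  using component_le_norm_cart[of "y *\<^sub>R (\<chi> i. 1) :: real ^ 'n" undefined] by simp

text \<open>The limit theorem for invariant laws. The scaled vector and its projection on the diagonal differ by
  little, and the projection is a function of the total length, whose Laplace transform converges.\<close>

lemma stationary_jsq_heavy_traffic: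
  fixes \<pi> :: "real \<Rightarrow> ('n::finite \<Rightarrow> nat) pmf"
  assumes stat: "\<forall>\<^sub>F \<epsilon> in at_right 0. stationary_jsq (\<pi> \<epsilon>) (\<nu> \<epsilon>) \<epsilon> L"
    and \<delta>: "\<delta> > 0"
    and rate: "\<forall>\<^sub>F \<epsilon> in at_right 0. \<forall>j. \<delta> \<le> measure_pmf.expectation (\<nu> \<epsilon>) (\<lambda>w. real (snd w j)) - \<epsilon> / real CARD('n)"
    and N: "prob_space N" and l: "0 < l" and \<Upsilon>: "distributed N lborel \<Upsilon> (exponential_density l)"
    and v: "((\<lambda>\<epsilon>. measure_pmf.expectation (\<nu> \<epsilon>) (\<lambda>w. (total_input w)\<^sup>2)) \<longlongrightarrow> 2 * real CARD('n) / l) (at_right 0)"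
  shows "converges_in_distribution (at_right 0) (\<lambda>\<epsilon>. measure_pmf (\<pi> \<epsilon>)) (\<lambda>\<epsilon> x. \<epsilon> *\<^sub>R real_vec x)
    N (\<lambda>\<omega>. \<Upsilon> \<omega> *\<^sub>R (\<chi> i. 1))"
proof (rule converges_in_distribution_compact_support[OF _ N])
  let ?n = "real CARD('n)"
  interpret N: prob_space N by (rule N)
  have [measurable]: "\<Upsilon> \<in> borel_measurable N" using \<Upsilon> by (auto simp: distributed_def)
  show "(\<lambda>\<omega>. \<Upsilon> \<omega> *\<^sub>R (\<chi> i. 1) :: real ^ 'n) \<in> borel_measurable N"
    by (intro borel_measurable_scaleR borel_measurable_const) measurable
  show "\<forall>\<^sub>F \<epsilon> in at_right 0. prob_space (measure_pmf (\<pi> \<epsilon>)) \<and> (\<lambda>x. \<epsilon> *\<^sub>R real_vec x) \<in> borel_measurable (measure_pmf (\<pi> \<epsilon>))"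
    by (simp add: measure_pmf.prob_space_axioms)
  fix f :: "real ^ 'n \<Rightarrow> real" and r
  assume f: "continuous_on UNIV f" and supp: "\<And>x. r \<le> norm x \<Longrightarrow> f x = 0"
  define g where "g y = f ((y / ?n) *\<^sub>R (\<chi> i. 1))" for y
  have gc: "continuous_on UNIV g"
    unfolding g_def by (intro continuous_on_compose2[OF f] continuous_intros) auto
  have g_supp: "g y = 0" if "max 0 (?n * r) \<le> y" for y
  proof -
    have "r \<le> \<bar>y / ?n\<bar>" using that by (auto simp: field_simps)
    then show ?thesis unfolding g_def by (intro supp order_trans[OF _ norm_diagonal_ge])
  qed
  have lap: "((\<lambda>\<epsilon>. measure_pmf.expectation (\<pi> \<epsilon>) (\<lambda>x. exp (- (real j * (\<epsilon> * total_queue x)))))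
      \<longlongrightarrow> N.expectation (\<lambda>\<omega>. exp (- (real j * (?n * \<Upsilon> \<omega>))))) (at_right 0)" for j :: nat
  proof -
    have "N.expectation (\<lambda>\<omega>. exp (- (real j * ?n * \<Upsilon> \<omega>))) = l / (l + real j * ?n)"
      by (rule N.exponential_distributed_laplace_transform[OF \<Upsilon> l]) simp
    also have "\<dots> = 1 / (1 + real j * (2 * ?n / l) / 2)"
      using l by (simp add: field_simps)
    finally show ?thesis
      using laplace_transform_limit[OF stat \<delta> rate v, of "real j"] l by (simp add: mult.assoc)
  qed
  have "((\<lambda>\<epsilon>. measure_pmf.expectation (\<pi> \<epsilon>) (\<lambda>x. g (\<epsilon> * total_queue x)))
      \<longlongrightarrow> N.expectation (\<lambda>\<omega>. g (?n * \<Upsilon> \<omega>))) (at_right 0)"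
  proof (rule laplace_convergence_compact_support[where r="max 0 (?n * r)", OF _ N _ _ lap gc g_supp])
    show "\<forall>\<^sub>F \<epsilon> in at_right 0. prob_space (measure_pmf (\<pi> \<epsilon>)) \<and>
      (\<lambda>x. \<epsilon> * total_queue x) \<in> borel_measurable (measure_pmf (\<pi> \<epsilon>)) \<and> (AE x in \<pi> \<epsilon>. 0 \<le> \<epsilon> * total_queue x)"
      using eventually_at_right_less[of 0]
      by eventually_elim (simp add: measure_pmf.prob_space_axioms total_nonneg)
    show "AE \<omega> in N. 0 \<le> ?n * \<Upsilon> \<omega>"
      using N.exponential_distributed_AE_nonneg[OF \<Upsilon> l] by eventually_elim simp
  qed auto
  then have lim: "((\<lambda>\<epsilon>. measure_pmf.expectation (\<pi> \<epsilon>) (\<lambda>x. f ((\<epsilon> * total_queue x / ?n) *\<^sub>R (\<chi> i. 1))))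
      \<longlongrightarrow> N.expectation (\<lambda>\<omega>. f (\<Upsilon> \<omega> *\<^sub>R (\<chi> i. 1)))) (at_right 0)"
    by (simp add: g_def)
  show "((\<lambda>\<epsilon>. measure_pmf.expectation (\<pi> \<epsilon>) (\<lambda>x. f (\<epsilon> *\<^sub>R real_vec x)))
      \<longlongrightarrow> N.expectation (\<lambda>\<omega>. f (\<Upsilon> \<omega> *\<^sub>R (\<chi> i. 1)))) (at_right 0)"
  proof (rule compact_support_converging_together[OF _ _ f supp lim])
    show "((\<lambda>\<epsilon>. measure (\<pi> \<epsilon>) {x \<in> space (\<pi> \<epsilon>). d \<le> dist (\<epsilon> *\<^sub>R real_vec x) ((\<epsilon> * total_queue x / ?n) *\<^sub>R (\<chi> i. 1))}) \<longlongrightarrow> 0) (at_right 0)"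
      if "d > 0" for d
      using state_space_collapse[OF stat \<delta> rate that] by simp
  qed (auto simp: measure_pmf.prob_space_axioms)
qed

text \<open>If arrivals never exceeded the total service, the second moment of \<open>total_input\<close> would be at most
  \<open>\<epsilon>\<close> times a bound for \<open>total_input\<close>, because a nonpositive variable has no cancellation in its mean.\<close>

lemma (in stationary_jsq) service_rate_positive:
  assumes v: "real CARD('n) * real L * \<epsilon> < measure_pmf.expectation \<nu> (\<lambda>w. (total_input w)\<^sup>2)"
  shows "0 < measure_pmf.expectation \<nu> (\<lambda>w. real (snd w j))"
proof -
  let ?K = "real CARD('n) * real L"
  have "\<exists>w\<in>set_pmf \<nu>. 0 < total_input w"
  proof (rule ccontr)
    assume "\<not> ?thesis"
    then have neg: "total_input w \<le> 0" if "w \<in> set_pmf \<nu>" for w using that by force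
    have "measure_pmf.expectation \<nu> (\<lambda>w. (total_input w)\<^sup>2) \<le> measure_pmf.expectation \<nu> (\<lambda>w. - ?K * total_input w)"
    proof (rule integral_mono_AE)
      show "AE w in \<nu>. (total_input w)\<^sup>2 \<le> - ?K * total_input w"
      proof (rule AE_pmfI)
        fix w assume w: "w \<in> set_pmf \<nu>"
        have "- total_input w * - total_input w \<le> ?K * - total_input w"
          using total_input_abs_le[OF w] neg[OF w] by (intro mult_right_mono) auto
        then show "(total_input w)\<^sup>2 \<le> - ?K * total_input w" by (simp add: power2_eq_square)
      qed
    qed auto
    also have "\<dots> = ?K * \<epsilon>" by (simp add: mean_total_input)
    finally show False using v by simp
  qed
  then obtain w where "w \<in> set_pmf \<nu>" "snd w j \<noteq> 0" using every_queue_served by blast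
  then have "\<not> (AE w in \<nu>. real (snd w j) = 0)" by (auto simp: AE_measure_pmf_iff)
  then have "measure_pmf.expectation \<nu> (\<lambda>w. real (snd w j)) \<noteq> 0"
    by (subst integral_nonneg_eq_0_iff_AE) auto
  moreover have "0 \<le> measure_pmf.expectation \<nu> (\<lambda>w. real (snd w j))" by (intro integral_nonneg_AE) auto
  ultimately show ?thesis by linarith
qed

section \<open>The steady state as an invariant law\<close>

context prob_space
begin

text \<open>Passing to \<open>pmf\<close> makes all functions measurable and turns independence into \<open>pair_pmf\<close>.\<close>

definition law :: "('a \<Rightarrow> 'c::countable) \<Rightarrow> 'c pmf" where
  "law X = Abs_pmf (distr M (count_space UNIV) X)"

lemma measure_pmf_law:
  assumes "random_variable (count_space UNIV) X"
  shows "measure_pmf (law X) = distr M (count_space UNIV) X"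
proof -
  interpret D: prob_space "distr M (count_space UNIV) X" by (rule prob_space_distr[OF assms])
  have "AE x in distr M (count_space UNIV) X. measure (distr M (count_space UNIV) X) {x} \<noteq> 0"
    by (subst D.AE_support_countable) (auto intro!: exI[of _ UNIV])
  then show ?thesis
    unfolding law_def by (intro Abs_pmf_inverse) (auto intro: D.prob_space_axioms)
qed

lemma pmf_law:
  assumes "random_variable (count_space UNIV) X"
  shows "pmf (law X) x = prob {\<omega> \<in> space M. X \<omega> = x}"
proof -
  have "pmf (law X) x = measure (distr M (count_space UNIV) X) {x}"
    by (simp add: pmf.rep_eq measure_pmf_law[OF assms])
  also have "\<dots> = prob (X -` {x} \<inter> space M)" using assms by (intro measure_distr) auto
  also have "X -` {x} \<inter> space M = {\<omega> \<in> space M. X \<omega> = x}" by auto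
  finally show ?thesis .
qed

lemma expectation_law:
  assumes "random_variable (count_space UNIV) X"
  shows "measure_pmf.expectation (law X) f = expectation (\<lambda>\<omega>. f (X \<omega>) :: real)"
  unfolding measure_pmf_law[OF assms] by (rule integral_distr[OF assms]) simp

lemma law_compose:
  assumes "random_variable (count_space UNIV) X"
  shows "law (\<lambda>\<omega>. h (X \<omega>)) = map_pmf h (law X)"
proof -
  have "measure_pmf (law (\<lambda>\<omega>. h (X \<omega>))) = distr M (count_space UNIV) (\<lambda>\<omega>. h (X \<omega>))"
    by (intro measure_pmf_law measurable_compose[OF assms]) simp
  also have "\<dots> = measure_pmf (map_pmf h (law X))"
    by (simp add: map_pmf_rep_eq measure_pmf_law[OF assms] distr_distr assms comp_def)
  finally show ?thesis by (simp add: measure_pmf_inject)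
qed

lemma law_cong: "(\<And>\<omega>. \<omega> \<in> space M \<Longrightarrow> X \<omega> = Y \<omega>) \<Longrightarrow> law X = law Y"
  unfolding law_def by (intro arg_cong[of _ _ Abs_pmf] distr_cong) auto

lemma random_variable_combine:
  fixes X :: "'a \<Rightarrow> 'c::countable"
  assumes X: "random_variable (count_space UNIV) X" and Y: "random_variable (count_space UNIV) Y"
  shows "random_variable (count_space UNIV) (\<lambda>\<omega>. h (X \<omega>) (Y \<omega>))"
  by (rule measurable_compose_countable[OF _ X], rule measurable_compose[OF Y]) simp

lemma indep_rvs_prob:
  assumes "indep_rvs A X B Y" "E \<in> sets A" "F \<in> sets B"
  shows "prob ((X -` E \<inter> space M) \<inter> (Y -` F \<inter> space M)) = prob (X -` E \<inter> space M) * prob (Y -` F \<inter> space M)"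
proof (rule indep_setD)
  show "indep_set {X -` E \<inter> space M | E. E \<in> sets A} {Y -` E \<inter> space M | E. E \<in> sets B}"
    using assms(1) by (simp add: indep_rvs_def)
qed (use assms in blast)+

lemma AE_law:
  assumes "random_variable (count_space UNIV) X" and "AE \<omega> in M. P (X \<omega>)" and "x \<in> set_pmf (law X)"
  shows "P x"
proof -
  have "AE x in measure_pmf (law X). P x"
    unfolding measure_pmf_law[OF assms(1)] using assms(1,2) by (subst AE_distr_iff) auto
  then show ?thesis using assms(3) by (simp add: AE_measure_pmf_iff)
qed

end

lemma pmf_bind_map_Pair:
  "pmf (bind_pmf p (\<lambda>y. map_pmf (Pair y) (K y))) (y, i) = pmf p y * pmf (K y) i"
proof -
  have "pmf (map_pmf (Pair y') (K y')) (y, i) = pmf (K y) i * indicator {y} y'" for y'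
  proof (cases "y' = y")
    case True
    then show ?thesis by (simp add: pmf_map_inj' inj_on_def)
  next
    case False
    then have "(y, i) \<notin> set_pmf (map_pmf (Pair y') (K y'))" by auto
    then have "pmf (map_pmf (Pair y') (K y')) (y, i) = 0" by (simp only: pmf_eq_0_set_pmf not_False_eq_True)
    then show ?thesis using False by simp
  qed
  then show ?thesis by (simp add: pmf_bind measure_pmf_single)
qed

context jsq_system
begin

lemma s_rv: "k \<ge> 1 \<Longrightarrow> random_variable (count_space UNIV) (s k)"
  using s_iid by (auto simp: iid_slots_def indep_vars_def)

lemma a_rv: "k \<ge> 1 \<Longrightarrow> random_variable (count_space UNIV) (a k)"
  using a_iid by (auto simp: iid_slots_def indep_vars_def)

definition input_law :: "(nat \<times> ('n \<Rightarrow> nat)) pmf" where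
  "input_law = pair_pmf (law (a 1)) (law (s 1))"

lemma input_rv: "k \<ge> 1 \<Longrightarrow> random_variable (count_space UNIV) (\<lambda>\<omega>. (a k \<omega>, s k \<omega>))"
  by (rule random_variable_combine[OF a_rv s_rv])

lemma law_input:
  assumes k: "k \<ge> 1"
  shows "law (\<lambda>\<omega>. (a k \<omega>, s k \<omega>)) = input_law"
proof (rule pmf_eqI)
  fix w :: "nat \<times> ('n \<Rightarrow> nat)"
  obtain b r where w: "w = (b, r)" by (cases w)
  have "distr M (count_space UNIV) (a k) = distr M (count_space UNIV) (a 1)"
    and "distr M (count_space UNIV) (s k) = distr M (count_space UNIV) (s 1)"
    using a_iid s_iid k unfolding iid_slots_def by blast+
  then have la: "law (a k) = law (a 1)" and ls: "law (s k) = law (s 1)"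
    by (simp_all only: law_def)
  let ?A = "(\<lambda>f. f k) -` {b} \<inter> space (\<Pi>\<^sub>M k\<in>{1..}. count_space (UNIV :: nat set))"
  let ?S = "(\<lambda>f. f k) -` {r} \<inter> space (\<Pi>\<^sub>M k\<in>{1..}. count_space (UNIV :: ('n \<Rightarrow> nat) set))"
  have sA: "?A \<in> sets (\<Pi>\<^sub>M k\<in>{1..}. count_space UNIV)" and sS: "?S \<in> sets (\<Pi>\<^sub>M k\<in>{1..}. count_space UNIV)"
    by (rule measurable_sets[OF measurable_component_singleton]; use k in simp)+
  have eA: "(\<lambda>\<omega>. \<lambda>k\<in>{1..}. a k \<omega>) -` ?A \<inter> space M = {\<omega> \<in> space M. a k \<omega> = b}"
    and eS: "(\<lambda>\<omega>. \<lambda>k\<in>{1..}. s k \<omega>) -` ?S \<inter> space M = {\<omega> \<in> space M. s k \<omega> = r}"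
    using k by (auto simp: space_PiM)
  have "prob ({\<omega> \<in> space M. a k \<omega> = b} \<inter> {\<omega> \<in> space M. s k \<omega> = r})
      = prob {\<omega> \<in> space M. a k \<omega> = b} * prob {\<omega> \<in> space M. s k \<omega> = r}"
    using indep_rvs_prob[OF a_indep_s sA sS] unfolding eA eS .
  moreover have "{\<omega> \<in> space M. (a k \<omega>, s k \<omega>) = w} = {\<omega> \<in> space M. a k \<omega> = b} \<inter> {\<omega> \<in> space M. s k \<omega> = r}"
    by (auto simp: w)
  ultimately show "pmf (law (\<lambda>\<omega>. (a k \<omega>, s k \<omega>))) w = pmf input_law w"
    unfolding w input_law_def pmf_pair la[symmetric] ls[symmetric]
      pmf_law[OF input_rv[OF k]] pmf_law[OF a_rv[OF k]] pmf_law[OF s_rv[OF k]] by (simp only:)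
qed

lemma queue_route_rv: "k \<ge> 1 \<Longrightarrow> random_variable (count_space UNIV) (\<lambda>\<omega>. (q k \<omega>, route k \<omega>))"
proof -
  assume k: "k \<ge> 1"
  have "random_variable (count_space UNIV) (\<lambda>\<omega>. Pair (q k \<omega>) (route k \<omega>))"
    by (rule random_variable_combine[OF q_rv[OF k] route_rv[OF k]])
  then show ?thesis .
qed

text \<open>The hypothesis on ties conditions on the whole history of queue lengths. Only the last entry of that history
  matters for the route, so the history can be projected away; it is encoded as a list to have a countable type.\<close>

lemma law_queue_route:
  assumes k: "k \<ge> 1"
  shows "law (\<lambda>\<omega>. (q k \<omega>, route k \<omega>)) = bind_pmf (law (q k)) (\<lambda>x. map_pmf (Pair x) (pmf_of_set (shortest_queues x)))"
proof -
  define Y where "Y \<omega> = map (\<lambda>j. q j \<omega>) [1..<Suc k]" for \<omega>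
  have "random_variable (count_space UNIV) (\<lambda>\<omega>. map (\<lambda>j. q j \<omega>) js)" if "\<forall>j\<in>set js. j \<ge> 1" for js
    using that
  proof (induction js)
    case (Cons j js)
    then have rv: "random_variable (count_space UNIV) (q j)" "random_variable (count_space UNIV) (\<lambda>\<omega>. map (\<lambda>j. q j \<omega>) js)"
      using q_rv by auto
    show ?case using random_variable_combine[OF rv, of "(#)"] by simp
  qed simp
  then have Y: "random_variable (count_space UNIV) Y"
    unfolding Y_def[abs_def] by (rule) auto
  have YR: "random_variable (count_space UNIV) (\<lambda>\<omega>. (Y \<omega>, route k \<omega>))"
  proof -
    have "random_variable (count_space UNIV) (\<lambda>\<omega>. Pair (Y \<omega>) (route k \<omega>))"
      by (rule random_variable_combine[OF Y route_rv[OF k]])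
    then show ?thesis .
  qed
  have last: "last (Y \<omega>) = q k \<omega>" for \<omega> using k by (simp add: Y_def)
  have Y_iff: "Y \<omega> = y \<longleftrightarrow> (\<forall>j\<in>{1..k}. q j \<omega> = y ! (j - 1))" if "length y = k" for y \<omega>
  proof -
    have "Y \<omega> = y \<longleftrightarrow> (\<forall>l<k. q (Suc l) \<omega> = y ! l)"
      using that by (auto simp: list_eq_iff_nth_eq Y_def simp del: upt_Suc)
    also have "\<dots> \<longleftrightarrow> (\<forall>j\<in>{1..k}. q j \<omega> = y ! (j - 1))"
    proof safe
      fix j assume *: "\<forall>l<k. q (Suc l) \<omega> = y ! l" "j \<in> {1..k}"
      then show "q j \<omega> = y ! (j - 1)" by (cases j) auto
    qed force
    finally show ?thesis .
  qed
  have "law (\<lambda>\<omega>. (Y \<omega>, route k \<omega>)) = bind_pmf (law Y) (\<lambda>y. map_pmf (Pair y) (pmf_of_set (shortest_queues (last y))))"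
  proof (rule pmf_eqI)
    fix p :: "('n \<Rightarrow> nat) list \<times> 'n"
    obtain y i where p: "p = (y, i)" by (cases p)
    have "prob {\<omega> \<in> space M. Y \<omega> = y \<and> route k \<omega> = i}
        = prob {\<omega> \<in> space M. Y \<omega> = y} * pmf (pmf_of_set (shortest_queues (last y))) i"
    proof (cases "length y = k")
      case True
      then have "last y = y ! (k - 1)" using k by (subst last_conv_nth) auto
      then show ?thesis
        using random_ties[OF k, of "\<lambda>j. y ! (j - 1)" i] by (simp only: Y_iff[OF True])
    next
      case False
      then have "Y \<omega> \<noteq> y" for \<omega> by (auto simp: Y_def)
      then show ?thesis by simp
    qed
    then show "pmf (law (\<lambda>\<omega>. (Y \<omega>, route k \<omega>))) p
        = pmf (bind_pmf (law Y) (\<lambda>y. map_pmf (Pair y) (pmf_of_set (shortest_queues (last y))))) p"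
      by (simp add: p pmf_bind_map_Pair pmf_law[OF YR] pmf_law[OF Y])
  qed
  then have "map_pmf (\<lambda>(y, i). (last y, i)) (law (\<lambda>\<omega>. (Y \<omega>, route k \<omega>)))
      = bind_pmf (map_pmf last (law Y)) (\<lambda>x. map_pmf (Pair x) (pmf_of_set (shortest_queues x)))"
    by (simp add: map_bind_pmf map_pmf_comp bind_map_pmf)
  then show ?thesis
    using law_compose[OF YR, of "\<lambda>(y, i). (last y, i)"] law_compose[OF Y, of last] by (simp add: last)
qed

lemma law_slot:
  assumes k: "k \<ge> 1"
  shows "law (\<lambda>\<omega>. ((q k \<omega>, route k \<omega>), (a k \<omega>, s k \<omega>))) = pair_pmf (law (\<lambda>\<omega>. (q k \<omega>, route k \<omega>))) input_law"
proof (rule pmf_eqI)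
  fix p :: "(('n \<Rightarrow> nat) \<times> 'n) \<times> nat \<times> ('n \<Rightarrow> nat)"
  obtain z w where p: "p = (z, w)" by (cases p)
  have rv: "random_variable (count_space UNIV) (\<lambda>\<omega>. ((q k \<omega>, route k \<omega>), (a k \<omega>, s k \<omega>)))"
  proof -
    have "random_variable (count_space UNIV) (\<lambda>\<omega>. Pair (q k \<omega>, route k \<omega>) (a k \<omega>, s k \<omega>))"
      by (rule random_variable_combine[OF queue_route_rv[OF k] input_rv[OF k]])
    then show ?thesis .
  qed
  let ?P = "\<Pi>\<^sub>M j\<in>{1..k}. count_space (UNIV :: (('n \<Rightarrow> nat) \<times> 'n) set)"
  let ?Z = "(\<lambda>f. f k) -` {z} \<inter> space ?P"
  have sZ: "?Z \<in> sets ?P"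
    by (rule measurable_sets[OF measurable_component_singleton]) (use k in simp_all)
  have eZ: "(\<lambda>\<omega>. \<lambda>j\<in>{1..k}. (q j \<omega>, route j \<omega>)) -` ?Z \<inter> space M = {\<omega> \<in> space M. (q k \<omega>, route k \<omega>) = z}"
    using k by (auto simp: space_PiM)
  have eW: "(\<lambda>\<omega>. (a k \<omega>, s k \<omega>)) -` {w} \<inter> space M = {\<omega> \<in> space M. (a k \<omega>, s k \<omega>) = w}" by auto
  have "prob ({\<omega> \<in> space M. (a k \<omega>, s k \<omega>) = w} \<inter> {\<omega> \<in> space M. (q k \<omega>, route k \<omega>) = z})
      = prob {\<omega> \<in> space M. (a k \<omega>, s k \<omega>) = w} * prob {\<omega> \<in> space M. (q k \<omega>, route k \<omega>) = z}"
    using indep_rvs_prob[OF indep_past[OF k] _ sZ, of "{w}"] unfolding eZ eW by simp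
  moreover have "{\<omega> \<in> space M. ((q k \<omega>, route k \<omega>), (a k \<omega>, s k \<omega>)) = p}
      = {\<omega> \<in> space M. (a k \<omega>, s k \<omega>) = w} \<inter> {\<omega> \<in> space M. (q k \<omega>, route k \<omega>) = z}"
    by (auto simp: p)
  ultimately show "pmf (law (\<lambda>\<omega>. ((q k \<omega>, route k \<omega>), (a k \<omega>, s k \<omega>)))) p
      = pmf (pair_pmf (law (\<lambda>\<omega>. (q k \<omega>, route k \<omega>))) input_law) p"
    unfolding pmf_law[OF rv] p pmf_pair law_input[OF k, symmetric]
      pmf_law[OF queue_route_rv[OF k]] pmf_law[OF input_rv[OF k]] by (simp only: mult.commute)
qed

text \<open>Independence of the input from the past and the uniform choice between ties make the queue lengths a Markov chain.\<close>

lemma law_queue_Suc: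
  assumes k: "k \<ge> 1"
  shows "law (q (Suc k)) = bind_pmf (law (q k)) (jsq_kernel input_law)"
proof -
  have rv: "random_variable (count_space UNIV) (\<lambda>\<omega>. ((q k \<omega>, route k \<omega>), (a k \<omega>, s k \<omega>)))"
  proof -
    have "random_variable (count_space UNIV) (\<lambda>\<omega>. Pair (q k \<omega>, route k \<omega>) (a k \<omega>, s k \<omega>))"
      by (rule random_variable_combine[OF queue_route_rv[OF k] input_rv[OF k]])
    then show ?thesis .
  qed
  have "q (Suc k) \<omega> = (\<lambda>((x, i), w). jsq_next x i w) ((q k \<omega>, route k \<omega>), (a k \<omega>, s k \<omega>))"
    if "\<omega> \<in> space M" for \<omega>
  proof
    fix j
    have "int (q (Suc k) \<omega> j) = int (jsq_next (q k \<omega>) (route k \<omega>) (a k \<omega>, s k \<omega>) j)"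
      using dynamics[OF k that, of j] by (auto simp: jsq_next_def)
    then show "q (Suc k) \<omega> j = (\<lambda>((x, i), w). jsq_next x i w) ((q k \<omega>, route k \<omega>), (a k \<omega>, s k \<omega>)) j"
      by simp
  qed
  then have "law (q (Suc k)) = law (\<lambda>\<omega>. (\<lambda>((x, i), w). jsq_next x i w) ((q k \<omega>, route k \<omega>), (a k \<omega>, s k \<omega>)))"
    by (rule law_cong)
  also have "\<dots> = map_pmf (\<lambda>((x, i), w). jsq_next x i w)
      (pair_pmf (bind_pmf (law (q k)) (\<lambda>x. map_pmf (Pair x) (pmf_of_set (shortest_queues x)))) input_law)"
    by (subst law_compose[OF rv]) (simp only: law_slot[OF k] law_queue_route[OF k])
  also have "\<dots> = bind_pmf (law (q k)) (jsq_kernel input_law)"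
    unfolding pair_pmf_def jsq_kernel_def[abs_def] map_pmf_def bind_assoc_pmf bind_return_pmf split_conv ..
  finally show ?thesis .
qed

end

lemma real_vec_dist_less_1:
  assumes "dist (real_vec x) (real_vec y) < 1"
  shows "x = y"
proof
  fix i
  have "\<bar>(real_vec x - real_vec y) $ i\<bar> \<le> norm (real_vec x - real_vec y)" by (rule component_le_norm_cart)
  then have "\<bar>real (x i) - real (y i)\<bar> < 1" using assms by (simp add: dist_norm)
  then show "x i = y i" by linarith
qed

text \<open>The lattice of integer vectors is closed and uniformly discrete. A test function vanishing exactly on it shows
  that the limit is carried by the lattice, and by Tietze's theorem every bounded function on the lattice is the restriction of
  a bounded continuous one, so convergence in distribution tests all of them.\<close>

lemma lattice_limit_law:
  fixes X :: "nat \<Rightarrow> 'a \<Rightarrow> 'n::finite \<Rightarrow> nat" and Y :: "'b \<Rightarrow> real ^ 'n"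
  assumes Q: "prob_space Q" and Y: "Y \<in> borel_measurable Q"
    and conv: "converges_in_distribution sequentially (\<lambda>_. M) (\<lambda>k \<omega>. real_vec (X k \<omega>)) Q Y"
  obtains \<pi> where
    "\<And>(g :: ('n \<Rightarrow> nat) \<Rightarrow> real) B. (\<And>x. \<bar>g x\<bar> \<le> B) \<Longrightarrow> (\<lambda>k. \<integral>\<omega>. g (X k \<omega>) \<partial>M) \<longlonglongrightarrow> measure_pmf.expectation \<pi> g"
    "\<And>f :: real ^ 'n \<Rightarrow> real. f \<in> borel_measurable borel \<Longrightarrow> (\<integral>\<omega>. f (Y \<omega>) \<partial>Q) = measure_pmf.expectation \<pi> (\<lambda>x. f (real_vec x))"
proof -
  interpret Q: prob_space Q by (rule Q)
  note [measurable] = Y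
  define S where "S = range (real_vec :: ('n \<Rightarrow> nat) \<Rightarrow> _)"
  \<comment> \<open>Any measurable left inverse of \<open>real_vec\<close> will do.\<close>
  define r where "r v = (\<lambda>i. nat \<lfloor>v $ i\<rfloor>)" for v :: "real ^ 'n"
  have r: "r (real_vec x) = x" for x by (simp add: r_def)
  have S: "closed S"
    by (rule discrete_imp_closed[of 1]) (auto simp: S_def dest: real_vec_dist_less_1)
  have lim: "(\<lambda>k. \<integral>\<omega>. f (real_vec (X k \<omega>)) \<partial>M) \<longlonglongrightarrow> (\<integral>\<omega>. f (Y \<omega>) \<partial>Q)"
    if "continuous_on UNIV f" "bounded (range f)" for f :: "real ^ 'n \<Rightarrow> real"
    using conv that unfolding converges_in_distribution_def by blast
  \<comment> \<open>Vanishes on the lattice only; it tests whether the limit is carried by it.\<close>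
  define d where "d v = min 1 (infdist v S)" for v
  have d_cont: "continuous_on UNIV d" unfolding d_def by (intro continuous_intros)
  have d01: "0 \<le> d v" "d v \<le> 1" for v by (auto simp: d_def infdist_nonneg)
  have [measurable]: "d \<in> borel_measurable borel" using d_cont by (rule borel_measurable_continuous_onI)
  have "d (real_vec x) = 0" for x by (simp add: d_def S_def)
  moreover have "bounded (range d)" unfolding bounded_iff using d01 by (auto intro!: exI[of _ 1])
  ultimately have "(\<lambda>k. 0) \<longlonglongrightarrow> (\<integral>\<omega>. d (Y \<omega>) \<partial>Q)"
    using lim[OF d_cont] by simp
  then have "(\<integral>\<omega>. d (Y \<omega>) \<partial>Q) = 0" by (simp add: LIMSEQ_const_iff)
  moreover have "integrable Q (\<lambda>\<omega>. d (Y \<omega>))"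
    by (rule Q.integrable_bounded_real[of _ 1]) (use d01 in auto)
  ultimately have "AE \<omega> in Q. d (Y \<omega>) = 0"
    using d01 by (subst integral_nonneg_eq_0_iff_AE[symmetric]) auto
  then have AE_S: "AE \<omega> in Q. Y \<omega> = real_vec (r (Y \<omega>))"
  proof eventually_elim
    case (elim \<omega>)
    then have "infdist (Y \<omega>) S = 0" by (simp add: d_def min_def split: if_splits)
    then have "Y \<omega> \<in> S" using in_closed_iff_infdist_zero[OF S] by (auto simp: S_def)
    then show ?case by (auto simp: S_def r)
  qed
  have r_m: "(\<lambda>\<omega>. r (Y \<omega>)) \<in> measurable Q (count_space UNIV)"
  proof (rule measurable_count_space_eq_countable[THEN iffD2, OF countableI_type], intro conjI ballI)
    fix x :: "'n \<Rightarrow> nat"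
    have [measurable]: "(\<lambda>\<omega>. Y \<omega> $ i) \<in> borel_measurable Q" for i
      by (rule measurable_compose[OF Y], rule borel_measurable_continuous_onI) (intro continuous_intros)
    have "(\<lambda>\<omega>. r (Y \<omega>)) -` {x} \<inter> space Q = {\<omega> \<in> space Q. \<forall>i. nat \<lfloor>Y \<omega> $ i\<rfloor> = x i}"
      by (auto simp: r_def fun_eq_iff)
    also have "\<dots> \<in> sets Q" by measurable
    finally show "(\<lambda>\<omega>. r (Y \<omega>)) -` {x} \<inter> space Q \<in> sets Q" .
  qed auto
  define \<pi> where "\<pi> = Q.law (\<lambda>\<omega>. r (Y \<omega>))"
  have transfer: "(\<integral>\<omega>. f (Y \<omega>) \<partial>Q) = measure_pmf.expectation \<pi> (\<lambda>x. f (real_vec x))"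
    if [measurable]: "f \<in> borel_measurable borel" for f :: "real ^ 'n \<Rightarrow> real"
  proof -
    have [measurable]: "(\<lambda>\<omega>. f (real_vec (r (Y \<omega>)))) \<in> borel_measurable Q"
      by (rule measurable_compose[OF r_m]) simp
    have "(\<integral>\<omega>. f (Y \<omega>) \<partial>Q) = (\<integral>\<omega>. f (real_vec (r (Y \<omega>))) \<partial>Q)"
      using AE_S by (intro integral_cong_AE) (auto elim!: eventually_mono)
    then show ?thesis unfolding \<pi>_def by (subst Q.expectation_law[OF r_m]) simp
  qed
  show ?thesis
  proof (rule that[OF _ transfer])
    fix g :: "('n \<Rightarrow> nat) \<Rightarrow> real" and B
    assume B: "\<And>x. \<bar>g x\<bar> \<le> B"
    have "continuous_on S (\<lambda>v. g (r v))"
      unfolding continuous_on_iff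
    proof (intro ballI allI impI exI[of _ 1] conjI)
      fix v w :: "real ^ 'n" and e :: real
      assume "v \<in> S" "w \<in> S" "dist w v < 1" "0 < e"
      then show "dist (g (r w)) (g (r v)) < e"
        by (auto simp: S_def r dest: real_vec_dist_less_1)
    qed simp
    moreover have "0 \<le> B" using B[of undefined] by linarith
    ultimately obtain G where G: "continuous_on UNIV G" "\<And>v. v \<in> S \<Longrightarrow> G v = g (r v)" "\<And>v. norm (G v) \<le> B"
      using Tietze[of S "\<lambda>v. g (r v)" UNIV B] S B by (auto simp: closedin_closed_eq)
    have "G (real_vec x) = g x" for x using G(2)[of "real_vec x"] by (simp add: S_def r)
    moreover have "bounded (range G)" unfolding bounded_iff using G(3) by (auto intro!: exI[of _ B])
    ultimately show "(\<lambda>k. \<integral>\<omega>. g (X k \<omega>) \<partial>M) \<longlonglongrightarrow> measure_pmf.expectation \<pi> g"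
      using lim[OF G(1)] transfer[OF borel_measurable_continuous_onI[OF G(1)]] by simp
  qed
qed

lemma expectation_pair_pmf_product:
  fixes f :: "'a \<Rightarrow> real" and g :: "'b \<Rightarrow> real"
  assumes "finite (set_pmf p)" "finite (set_pmf r)"
  shows "measure_pmf.expectation (pair_pmf p r) (\<lambda>z. f (fst z) * g (snd z))
    = measure_pmf.expectation p f * measure_pmf.expectation r g"
proof -
  have "measure_pmf.expectation (pair_pmf p r) (\<lambda>z. f (fst z) * g (snd z))
      = (\<Sum>z\<in>set_pmf p \<times> set_pmf r. (f (fst z) * pmf p (fst z)) * (g (snd z) * pmf r (snd z)))"
    using assms by (subst integral_measure_pmf_real[of "set_pmf p \<times> set_pmf r"])
      (auto simp: pmf_pair intro!: sum.cong)
  also have "\<dots> = (\<Sum>x\<in>set_pmf p. f x * pmf p x) * (\<Sum>y\<in>set_pmf r. g y * pmf r y)"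
    by (simp add: sum_product sum.cartesian_product split_def)
  finally show ?thesis
    using assms by (simp add: integral_measure_pmf_real[of "set_pmf p"] integral_measure_pmf_real[of "set_pmf r"])
qed

context jsq_system
begin

text \<open>Passing to the limit on both sides of the Markov property, tested against an indicator and its image
  under the kernel, gives invariance.\<close>

lemma stationary_limit_law:
  assumes "prob_space Q" "Y \<in> borel_measurable Q"
    and "converges_in_distribution sequentially (\<lambda>_. M) (\<lambda>k \<omega>. real_vec (q k \<omega>)) Q Y"
  obtains \<pi> where "bind_pmf \<pi> (jsq_kernel input_law) = \<pi>"
    "\<And>f :: real ^ 'n \<Rightarrow> real. f \<in> borel_measurable borel \<Longrightarrow> (\<integral>\<omega>. f (Y \<omega>) \<partial>Q) = measure_pmf.expectation \<pi> (\<lambda>x. f (real_vec x))"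
proof -
  obtain \<pi> where lim: "\<And>(g :: ('n \<Rightarrow> nat) \<Rightarrow> real) B. (\<And>x. \<bar>g x\<bar> \<le> B) \<Longrightarrow> (\<lambda>k. \<integral>\<omega>. g (q k \<omega>) \<partial>M) \<longlonglongrightarrow> measure_pmf.expectation \<pi> g"
    and transfer: "\<And>f :: real ^ 'n \<Rightarrow> real. f \<in> borel_measurable borel \<Longrightarrow> (\<integral>\<omega>. f (Y \<omega>) \<partial>Q) = measure_pmf.expectation \<pi> (\<lambda>x. f (real_vec x))"
    using lattice_limit_law[OF assms] by blast
  have "bind_pmf \<pi> (jsq_kernel input_law) = \<pi>"
  proof (rule pmf_eqI)
    fix y :: "'n \<Rightarrow> nat"
    define g :: "('n \<Rightarrow> nat) \<Rightarrow> real" where "g = indicator {y}"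
    define Pg where "Pg x = measure_pmf.expectation (jsq_kernel input_law x) g" for x
    have g: "\<bar>g x\<bar> \<le> 1" for x by (simp add: g_def)
    have Pg: "\<bar>Pg x\<bar> \<le> 1" for x by (simp add: Pg_def g_def)
    have step: "(\<integral>\<omega>. g (q (Suc k) \<omega>) \<partial>M) = (\<integral>\<omega>. Pg (q k \<omega>) \<partial>M)" if k: "k \<ge> 1" for k
    proof -
      have "(\<integral>\<omega>. g (q (Suc k) \<omega>) \<partial>M) = measure_pmf.expectation (law (q (Suc k))) g"
        by (rule expectation_law[OF q_rv, symmetric]) simp
      also have "\<dots> = measure_pmf.expectation (law (q k)) Pg"
        unfolding law_queue_Suc[OF k] Pg_def by (rule expectation_bind_pmf_bounded[OF g])
      also have "\<dots> = (\<integral>\<omega>. Pg (q k \<omega>) \<partial>M)" by (rule expectation_law[OF q_rv[OF k]])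
      finally show ?thesis .
    qed
    have "(\<lambda>k. \<integral>\<omega>. g (q (Suc k) \<omega>) \<partial>M) \<longlonglongrightarrow> measure_pmf.expectation \<pi> g"
      by (rule LIMSEQ_Suc, rule lim[of g 1], rule g)
    moreover have "\<forall>\<^sub>F k in sequentially. (\<integral>\<omega>. g (q (Suc k) \<omega>) \<partial>M) = (\<integral>\<omega>. Pg (q k \<omega>) \<partial>M)"
      using eventually_ge_at_top[of 1] by eventually_elim (rule step)
    ultimately have "(\<lambda>k. \<integral>\<omega>. Pg (q k \<omega>) \<partial>M) \<longlonglongrightarrow> measure_pmf.expectation \<pi> g"
      by (rule Lim_transform_eventually)
    moreover have "(\<lambda>k. \<integral>\<omega>. Pg (q k \<omega>) \<partial>M) \<longlonglongrightarrow> measure_pmf.expectation \<pi> Pg"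
      by (rule lim[of Pg 1], rule Pg)
    ultimately have "measure_pmf.expectation \<pi> g = measure_pmf.expectation \<pi> Pg"
      by (rule LIMSEQ_unique)
    also have "\<dots> = measure_pmf.expectation (bind_pmf \<pi> (jsq_kernel input_law)) g"
      unfolding Pg_def by (rule expectation_bind_pmf_bounded[OF g, symmetric])
    finally show "pmf (bind_pmf \<pi> (jsq_kernel input_law)) y = pmf \<pi> y"
      by (simp add: g_def measure_pmf_single)
  qed
  then show ?thesis using that transfer by blast
qed

definition input_bound :: nat where "input_bound = nat \<lceil>max A_max S_max\<rceil>"

lemma arrivals_le_input_bound: "b \<in> set_pmf (law (a 1)) \<Longrightarrow> b \<le> input_bound"
proof -
  assume "b \<in> set_pmf (law (a 1))"
  then have "real b \<le> A_max" using AE_law[OF a_rv[OF order_refl], of "\<lambda>b. real b \<le> A_max"] a_bounded[OF order_refl] by blast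
  then show ?thesis unfolding input_bound_def by linarith
qed

lemma services_le_input_bound: "r \<in> set_pmf (law (s 1)) \<Longrightarrow> r i \<le> input_bound"
proof -
  assume "r \<in> set_pmf (law (s 1))"
  then have "real (r i) \<le> S_max" using AE_law[OF s_rv[OF order_refl], of "\<lambda>r. real (r i) \<le> S_max"] s_bounded[OF order_refl] by blast
  then show ?thesis unfolding input_bound_def by linarith
qed

lemma finite_arrival_law: "finite (set_pmf (law (a 1)))"
  by (rule finite_subset[of _ "{..input_bound}"]) (auto simp del: One_nat_def dest: arrivals_le_input_bound)

lemma finite_service_law: "finite (set_pmf (law (s 1)))"
proof (rule finite_subset)
  show "set_pmf (law (s 1)) \<subseteq> UNIV \<rightarrow>\<^sub>E {..input_bound}"
    by (auto simp: PiE_def extensional_def simp del: One_nat_def dest: services_le_input_bound)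
qed (auto intro!: finite_PiE)

lemma finite_input_law: "finite (set_pmf input_law)"
  by (simp add: input_law_def finite_arrival_law finite_service_law del: One_nat_def)

lemma mean_service: "measure_pmf.expectation input_law (\<lambda>w. real (snd w j)) = (\<integral>\<omega>. real (s 1 \<omega> j) \<partial>M)"
  unfolding input_law_def expectation_pair_pmf_snd[of _ _ "\<lambda>r. real (r j)"]
  by (rule expectation_law[OF s_rv]) simp

lemma mean_arrival: "measure_pmf.expectation input_law (\<lambda>w. real (fst w)) = (\<integral>\<omega>. real (a 1 \<omega>) \<partial>M)"
  unfolding input_law_def expectation_pair_pmf_fst[of _ _ real]
  by (rule expectation_law[OF a_rv]) simp

lemma mean_total_input_law: "measure_pmf.expectation input_law total_input = - \<epsilon>"
proof -
  note [simp] = integrable_measure_pmf_finite[OF finite_input_law]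
  have "measure_pmf.expectation input_law total_input
    = (\<integral>\<omega>. real (a 1 \<omega>) \<partial>M) - (\<Sum>j\<in>UNIV. \<integral>\<omega>. real (s 1 \<omega> j) \<partial>M)"
    unfolding total_input_def[abs_def] by (simp add: mean_service mean_arrival del: One_nat_def)
  then show ?thesis by (simp add: a_mean total_service_rate_def del: One_nat_def)
qed

text \<open>Arrivals and services are independent, so the variances add.\<close>

lemma second_moment_total_input:
  "measure_pmf.expectation input_law (\<lambda>w. (total_input w)\<^sup>2)
   = variance (\<lambda>\<omega>. real (a 1 \<omega>))
     + (\<Sum>i\<in>UNIV. \<Sum>j\<in>UNIV. covariance M (\<lambda>\<omega>. real (s 1 \<omega> i)) (\<lambda>\<omega>. real (s 1 \<omega> j))) + \<epsilon>\<^sup>2"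
proof -
  note [simp] = integrable_measure_pmf_finite[OF finite_input_law]
    integrable_measure_pmf_finite[OF finite_arrival_law] integrable_measure_pmf_finite[OF finite_service_law]
  note One_nat_def [simp del]
  let ?E = "measure_pmf.expectation input_law"
  define \<alpha> where "\<alpha> = (\<integral>\<omega>. real (a 1 \<omega>) \<partial>M)"
  define \<mu> where "\<mu> j = (\<integral>\<omega>. real (s 1 \<omega> j) \<partial>M)" for j
  define A where "A b = real b - \<alpha>" for b
  define R where "R r = (\<Sum>j\<in>UNIV. real (r j) - \<mu> j)" for r :: "'n \<Rightarrow> nat"
  have \<alpha>: "\<alpha> = (\<Sum>j\<in>UNIV. \<mu> j) - \<epsilon>" unfolding \<alpha>_def \<mu>_def a_mean total_service_rate_def ..
  have tot: "total_input w = A (fst w) - R (snd w) - \<epsilon>" for w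
    by (simp add: total_input_def A_def R_def sum_subtractf \<alpha>)
  have EA: "measure_pmf.expectation (law (a 1)) A = 0"
    using expectation_law[OF a_rv, of 1 real] by (simp add: A_def[abs_def] \<alpha>_def)
  have ER: "measure_pmf.expectation (law (s 1)) R = 0"
    using expectation_law[OF s_rv, of 1 "\<lambda>r. real (r _)"] by (simp add: R_def[abs_def] \<mu>_def)
  have EA': "?E (\<lambda>w. A (fst w)) = 0" unfolding input_law_def expectation_pair_pmf_fst EA ..
  have ER': "?E (\<lambda>w. R (snd w)) = 0" unfolding input_law_def expectation_pair_pmf_snd ER ..
  have EAR: "?E (\<lambda>w. A (fst w) * R (snd w)) = 0"
    unfolding input_law_def using expectation_pair_pmf_product[OF finite_arrival_law finite_service_law, of A R] EA by simp
  have EA2: "?E (\<lambda>w. (A (fst w))\<^sup>2) = variance (\<lambda>\<omega>. real (a 1 \<omega>))"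
    unfolding input_law_def expectation_pair_pmf_fst[of _ _ "\<lambda>b. (A b)\<^sup>2"]
    by (subst expectation_law[OF a_rv]) (simp_all add: A_def \<alpha>_def)
  have "measure_pmf.expectation (law (s 1)) (\<lambda>r. (R r)\<^sup>2)
     = measure_pmf.expectation (law (s 1)) (\<lambda>r. \<Sum>i\<in>UNIV. \<Sum>j\<in>UNIV. (real (r i) - \<mu> i) * (real (r j) - \<mu> j))"
    by (simp add: R_def power2_eq_square sum_product)
  also have "\<dots> = (\<Sum>i\<in>UNIV. \<Sum>j\<in>UNIV. measure_pmf.expectation (law (s 1)) (\<lambda>r. (real (r i) - \<mu> i) * (real (r j) - \<mu> j)))"
    by simp
  also have "\<dots> = (\<Sum>i\<in>UNIV. \<Sum>j\<in>UNIV. covariance M (\<lambda>\<omega>. real (s 1 \<omega> i)) (\<lambda>\<omega>. real (s 1 \<omega> j)))"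
    unfolding covariance_def \<mu>_def by (intro sum.cong refl expectation_law[OF s_rv]) simp
  finally have ER2: "?E (\<lambda>w. (R (snd w))\<^sup>2) = (\<Sum>i\<in>UNIV. \<Sum>j\<in>UNIV. covariance M (\<lambda>\<omega>. real (s 1 \<omega> i)) (\<lambda>\<omega>. real (s 1 \<omega> j)))"
    unfolding input_law_def expectation_pair_pmf_snd[of _ _ "\<lambda>r. (R r)\<^sup>2"] .
  have "?E (\<lambda>w. (total_input w)\<^sup>2) = ?E (\<lambda>w. (A (fst w))\<^sup>2 + (R (snd w))\<^sup>2 + \<epsilon>\<^sup>2
      - 2 * (A (fst w) * R (snd w)) - 2 * \<epsilon> * A (fst w) + 2 * \<epsilon> * R (snd w))"
    by (simp add: tot power2_eq_square algebra_simps)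
  also have "\<dots> = ?E (\<lambda>w. (A (fst w))\<^sup>2) + ?E (\<lambda>w. (R (snd w))\<^sup>2) + \<epsilon>\<^sup>2"
    by (simp add: EA' ER' EAR)
  finally show ?thesis by (simp add: EA2 ER2)
qed

lemma stationary_jsq_limit:
  assumes "bind_pmf \<pi> (jsq_kernel input_law) = \<pi>"
  shows "stationary_jsq \<pi> input_law \<epsilon> input_bound"
  by unfold_locales
    (use assms mean_total_input_law in \<open>auto simp: input_law_def simp del: One_nat_def dest: arrivals_le_input_bound services_le_input_bound\<close>)

end

section \<open>The heavy traffic limit of the steady state\<close>

theorem corollary1:
  fixes M :: "'a measure"
    and s :: "nat \<Rightarrow> 'a \<Rightarrow> 'n::finite \<Rightarrow> nat"
    and a :: "real \<Rightarrow> nat \<Rightarrow> 'a \<Rightarrow> nat"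
    and q :: "real \<Rightarrow> nat \<Rightarrow> 'a \<Rightarrow> 'n \<Rightarrow> nat"
    and route :: "real \<Rightarrow> nat \<Rightarrow> 'a \<Rightarrow> 'n"
    and A_max S_max \<sigma>\<^sub>a :: real
    and \<sigma> :: "real \<Rightarrow> real"
    and Q :: "real \<Rightarrow> 'b measure"
    and q_bar :: "real \<Rightarrow> 'b \<Rightarrow> real ^ 'n"
    and N :: "'c measure"
    and \<Upsilon> :: "'c \<Rightarrow> real"
  assumes "0 < total_service_rate M s"
    and "\<And>\<epsilon>. \<epsilon> \<in> {0<..<total_service_rate M s} \<Longrightarrow>
      jsq_system M s (a \<epsilon>) (q \<epsilon>) (route \<epsilon>) \<epsilon> A_max S_max"
    and "\<And>\<epsilon>. \<epsilon> \<in> {0<..<total_service_rate M s} \<Longrightarrow>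
      prob_space.variance M (\<lambda>\<omega>. real (a \<epsilon> 1 \<omega>)) = (\<sigma> \<epsilon>)\<^sup>2"
    and "(\<sigma> \<longlongrightarrow> \<sigma>\<^sub>a) (at_right 0)"
    and "\<And>\<epsilon>. \<epsilon> \<in> {0<..<total_service_rate M s} \<Longrightarrow>
      prob_space (Q \<epsilon>) \<and> q_bar \<epsilon> \<in> borel_measurable (Q \<epsilon>) \<and>
      converges_in_distribution sequentially (\<lambda>_. M) (\<lambda>k \<omega>. real_vec (q \<epsilon> k \<omega>)) (Q \<epsilon>) (q_bar \<epsilon>)"
    and "prob_space N"
    and "\<exists>l>0. distributed N lborel \<Upsilon> (exponential_density l)"
    and "(\<integral>\<omega>. \<Upsilon> \<omega> \<partial>N) =
      1 / (2 * real CARD('n)) *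
      (\<sigma>\<^sub>a\<^sup>2 + (\<Sum>i\<in>UNIV. \<Sum>j\<in>UNIV.
        covariance M (\<lambda>\<omega>. real (s 1 \<omega> i)) (\<lambda>\<omega>. real (s 1 \<omega> j))))"
  shows "converges_in_distribution (at_right 0) Q (\<lambda>\<epsilon> \<omega>. \<epsilon> *\<^sub>R q_bar \<epsilon> \<omega>)
    N (\<lambda>\<omega>. \<Upsilon> \<omega> *\<^sub>R (\<chi> i. 1))"
proof -
  let ?n = "real CARD('n)" and ?I = "{0<..<total_service_rate M s}"
  define c where "c = (\<Sum>i\<in>UNIV. \<Sum>j\<in>UNIV. covariance M (\<lambda>\<omega>. real (s 1 \<omega> i)) (\<lambda>\<omega>. real (s 1 \<omega> j)))"
  define L where "L = nat \<lceil>max A_max S_max\<rceil>"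
  define \<nu> where "\<nu> \<epsilon> = jsq_system.input_law M s (a \<epsilon>)" for \<epsilon>
  define v where "v \<epsilon> = measure_pmf.expectation (\<nu> \<epsilon>) (\<lambda>w. (total_input w)\<^sup>2)" for \<epsilon>
  define \<mu> where "\<mu> j = (\<integral>\<omega>. real (s 1 \<omega> j) \<partial>M)" for j
  have near_0: "\<forall>\<^sub>F \<epsilon> in at_right 0. \<epsilon> \<in> ?I"
    using eventually_at_right_real[OF assms(1)] by simp
  obtain l where l: "0 < l" "distributed N lborel \<Upsilon> (exponential_density l)"
    using assms(7) by blast
  interpret N: prob_space N by (rule assms(6))
  have V: "\<sigma>\<^sub>a\<^sup>2 + c = 2 * ?n / l"
    using assms(8) N.exponential_distributed_expectation[OF l] l(1)
    unfolding c_def[symmetric] by (simp add: field_simps)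
  have "\<forall>\<epsilon>\<in>?I. \<exists>\<pi>. stationary_jsq \<pi> (\<nu> \<epsilon>) \<epsilon> L \<and> (\<forall>f :: real ^ 'n \<Rightarrow> real. f \<in> borel_measurable borel \<longrightarrow>
      (\<integral>\<omega>. f (q_bar \<epsilon> \<omega>) \<partial>Q \<epsilon>) = measure_pmf.expectation \<pi> (\<lambda>x. f (real_vec x)))"
  proof
    fix \<epsilon> assume \<epsilon>: "\<epsilon> \<in> ?I"
    interpret jsq_system M s "a \<epsilon>" "q \<epsilon>" "route \<epsilon>" \<epsilon> A_max S_max by (rule assms(2)[OF \<epsilon>])
    have "prob_space (Q \<epsilon>)" "q_bar \<epsilon> \<in> borel_measurable (Q \<epsilon>)"
      "converges_in_distribution sequentially (\<lambda>_. M) (\<lambda>k \<omega>. real_vec (q \<epsilon> k \<omega>)) (Q \<epsilon>) (q_bar \<epsilon>)"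
      using assms(5)[OF \<epsilon>] by auto
    from stationary_limit_law[OF this] obtain \<pi> where \<pi>: "bind_pmf \<pi> (jsq_kernel input_law) = \<pi>"
      "\<And>f :: real ^ 'n \<Rightarrow> real. f \<in> borel_measurable borel \<Longrightarrow> (\<integral>\<omega>. f (q_bar \<epsilon> \<omega>) \<partial>Q \<epsilon>) = measure_pmf.expectation \<pi> (\<lambda>x. f (real_vec x))"
      by blast
    then show "\<exists>\<pi>. stationary_jsq \<pi> (\<nu> \<epsilon>) \<epsilon> L \<and> (\<forall>f :: real ^ 'n \<Rightarrow> real. f \<in> borel_measurable borel \<longrightarrow>
      (\<integral>\<omega>. f (q_bar \<epsilon> \<omega>) \<partial>Q \<epsilon>) = measure_pmf.expectation \<pi> (\<lambda>x. f (real_vec x)))"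
      using stationary_jsq_limit[OF \<pi>(1)] by (auto simp: \<nu>_def L_def input_bound_def)
  qed
  then obtain \<pi> where stat: "\<And>\<epsilon>. \<epsilon> \<in> ?I \<Longrightarrow> stationary_jsq (\<pi> \<epsilon>) (\<nu> \<epsilon>) \<epsilon> L"
    and transfer: "\<And>\<epsilon> f. \<epsilon> \<in> ?I \<Longrightarrow> f \<in> borel_measurable borel \<Longrightarrow>
      (\<integral>\<omega>. f (q_bar \<epsilon> \<omega>) \<partial>Q \<epsilon>) = (measure_pmf.expectation (\<pi> \<epsilon>) (\<lambda>x. f (real_vec x)) :: real)"
    using bchoice by metis
  have v_eq: "v \<epsilon> = (\<sigma> \<epsilon>)\<^sup>2 + c + \<epsilon>\<^sup>2" and \<mu>_eq: "measure_pmf.expectation (\<nu> \<epsilon>) (\<lambda>w. real (snd w j)) = \<mu> j"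
    if \<epsilon>: "\<epsilon> \<in> ?I" for \<epsilon> j
  proof -
    interpret jsq_system M s "a \<epsilon>" "q \<epsilon>" "route \<epsilon>" \<epsilon> A_max S_max by (rule assms(2)[OF \<epsilon>])
    show "v \<epsilon> = (\<sigma> \<epsilon>)\<^sup>2 + c + \<epsilon>\<^sup>2"
      unfolding v_def \<nu>_def second_moment_total_input c_def assms(3)[OF \<epsilon>] ..
    show "measure_pmf.expectation (\<nu> \<epsilon>) (\<lambda>w. real (snd w j)) = \<mu> j"
      unfolding \<nu>_def \<mu>_def by (rule mean_service)
  qed
  have "((\<lambda>\<epsilon>. (\<sigma> \<epsilon>)\<^sup>2 + c + \<epsilon>\<^sup>2) \<longlongrightarrow> \<sigma>\<^sub>a\<^sup>2 + c + 0\<^sup>2) (at_right 0)"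
    by (intro tendsto_intros assms(4))
  then have "((\<lambda>\<epsilon>. (\<sigma> \<epsilon>)\<^sup>2 + c + \<epsilon>\<^sup>2) \<longlongrightarrow> 2 * ?n / l) (at_right 0)"
    by (simp add: V)
  moreover have "\<forall>\<^sub>F \<epsilon> in at_right 0. (\<sigma> \<epsilon>)\<^sup>2 + c + \<epsilon>\<^sup>2 = v \<epsilon>"
    using near_0 by eventually_elim (simp add: v_eq)
  ultimately have v_lim: "(v \<longlongrightarrow> 2 * ?n / l) (at_right 0)"
    by (rule Lim_transform_eventually)
  have \<mu>_pos: "0 < \<mu> j" for j
  proof -
    have "((\<lambda>\<epsilon>. v \<epsilon> - ?n * real L * \<epsilon>) \<longlongrightarrow> 2 * ?n / l - ?n * real L * 0) (at_right 0)"
      by (intro tendsto_intros v_lim)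
    then have "\<forall>\<^sub>F \<epsilon> in at_right 0. 0 < v \<epsilon> - ?n * real L * \<epsilon>"
      by (rule order_tendstoD) (use l(1) in simp)
    then have "\<forall>\<^sub>F \<epsilon> in at_right 0. 0 < v \<epsilon> - ?n * real L * \<epsilon> \<and> \<epsilon> \<in> ?I"
      using near_0 by (rule eventually_conj)
    then obtain \<epsilon> where \<epsilon>: "0 < v \<epsilon> - ?n * real L * \<epsilon>" "\<epsilon> \<in> ?I"
      using eventually_happens'[OF trivial_limit_at_right_real] by blast
    interpret stationary_jsq "\<pi> \<epsilon>" "\<nu> \<epsilon>" \<epsilon> L by (rule stat[OF \<epsilon>(2)])
    show ?thesis using service_rate_positive[of j] \<epsilon>(1) by (simp add: v_def \<mu>_eq[OF \<epsilon>(2)])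
  qed
  \<comment> \<open>Half of the smallest service rate is left once \<open>\<epsilon> / n\<close> is at most the other half.\<close>
  define \<delta> where "\<delta> = Min (range \<mu>) / 2"
  have \<delta>: "0 < \<delta>" "\<And>j. 2 * \<delta> \<le> \<mu> j" using \<mu>_pos by (auto simp: \<delta>_def)
  have "((\<lambda>\<epsilon>. \<epsilon> / ?n) \<longlongrightarrow> 0 / ?n) (at_right 0)" by (intro tendsto_intros) simp
  then have "\<forall>\<^sub>F \<epsilon> in at_right 0. \<epsilon> / ?n < \<delta>" by (rule order_tendstoD) (use \<delta> in simp)
  then have rate: "\<forall>\<^sub>F \<epsilon> in at_right 0. \<forall>j. \<delta> \<le> measure_pmf.expectation (\<nu> \<epsilon>) (\<lambda>w. real (snd w j)) - \<epsilon> / ?n"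
    using near_0
  proof eventually_elim
    case (elim \<epsilon>)
    show ?case
    proof
      fix j
      show "\<delta> \<le> measure_pmf.expectation (\<nu> \<epsilon>) (\<lambda>w. real (snd w j)) - \<epsilon> / ?n"
        using \<delta>(2)[of j] elim(1) unfolding \<mu>_eq[OF elim(2)] by linarith
    qed
  qed
  have stat_ev: "\<forall>\<^sub>F \<epsilon> in at_right 0. stationary_jsq (\<pi> \<epsilon>) (\<nu> \<epsilon>) \<epsilon> L"
    using near_0 by eventually_elim (rule stat)
  have "((\<lambda>\<epsilon>. measure_pmf.expectation (\<nu> \<epsilon>) (\<lambda>w. (total_input w)\<^sup>2)) \<longlongrightarrow> 2 * ?n / l) (at_right 0)"
    using v_lim unfolding v_def .
  then have conv: "converges_in_distribution (at_right 0) (\<lambda>\<epsilon>. measure_pmf (\<pi> \<epsilon>)) (\<lambda>\<epsilon> x. \<epsilon> *\<^sub>R real_vec x)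
    N (\<lambda>\<omega>. \<Upsilon> \<omega> *\<^sub>R (\<chi> i. 1))"
    by (rule stationary_jsq_heavy_traffic[OF stat_ev \<delta>(1) rate assms(6) l])
  show ?thesis
    unfolding converges_in_distribution_def
  proof (intro allI impI)
    fix f :: "real ^ 'n \<Rightarrow> real"
    assume f: "continuous_on UNIV f \<and> bounded (range f)"
    have "\<forall>\<^sub>F \<epsilon> in at_right 0. measure_pmf.expectation (\<pi> \<epsilon>) (\<lambda>x. f (\<epsilon> *\<^sub>R real_vec x)) = (\<integral>\<omega>. f (\<epsilon> *\<^sub>R q_bar \<epsilon> \<omega>) \<partial>Q \<epsilon>)"
      using near_0
    proof eventually_elim
      case (elim \<epsilon>)
      have "continuous_on UNIV (\<lambda>v. f (\<epsilon> *\<^sub>R v))"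
        by (rule continuous_on_compose2[OF conjunct1[OF f]]) (intro continuous_intros, simp)
      then show ?case
        using transfer[OF elim, of "\<lambda>v. f (\<epsilon> *\<^sub>R v)"] by (simp add: borel_measurable_continuous_onI)
    qed
    then show "((\<lambda>\<epsilon>. \<integral>\<omega>. f (\<epsilon> *\<^sub>R q_bar \<epsilon> \<omega>) \<partial>Q \<epsilon>) \<longlongrightarrow> (\<integral>\<omega>. f (\<Upsilon> \<omega> *\<^sub>R (\<chi> i. 1)) \<partial>N)) (at_right 0)"
      by (rule Lim_transform_eventually[OF conv[unfolded converges_in_distribution_def, rule_format, OF f]])
  qed
qed

end
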